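(* Let $1\le n\leq 9$ and let $G$ be a connected $3$-regular $3$-edge-colored graph on $2n$ vertices. Assume that $G$ is not maximally single-trace (MST) and that $G$ is not isomorphic to the exceptional graph $G_{\mathrm{ex}}$ on $16$ vertices. Then there exists a pairing $M$ of the vertex set of $G$ (viewed as edges of a new color $0$) such that $F(M,G)>\frac{3n}{2}$.
   Context: A pairing of a finite set $V$ of even cardinality is a partition of $V$ into unordered pairs. A $3$-regular $3$-edge-colored graph on $2n$ vertices is a tuple $G=(V,E_1,E_2,E_3)$ with $|V|=2n$ and each $E_i$ a pairing of $V$, called the set of edges of color $i$ (edges of different colors may join the same two vertices). $G$ is connected if the graph with vertex set $V$ and edge set $E_1\cup E_2\cup E_3$ is connected. Two such graphs are isomorphic if there is a bijection of their vertex sets mapping edges of color $i$ to edges of color $i$ for each $i\in\{1,2,3\}$. Faces: for $i\ne j$, a face of colors $(i,j)$ is a connected component of $(V,E_i,E_j)$, i.e. a cycle whose edges alternate between colors $i$ and $j$ (a pair lying in both $E_i$ and $E_j$ gives a cycle of length two). $F_{ij}(G)$ is the number of faces of colors $(i,j)$. $G$ is maximally single-trace (MST) if $F_{12}(G)=F_{13}(G)=F_{23}(G)=1$. For a pairing $M$ of $V$, $G\cup M$ is the $4$-edge-colored graph obtained by adding the pairs of $M$ as edges of color $0$, and $F(M,G)=\sum_{i=1}^{3}F_{0i}(G\cup M)$, where $F_{0i}(G\cup M)$ is the number of connected components of $(V,M,E_i)$. The exceptional graph $G_{\mathrm{ex}}$ has vertex set $\{1,\dots,16\}$ and $E_1=\{\{1,2\},\{3,4\},\{5,6\},\{7,8\},\{9,10\},\{11,12\},\{13,14\},\{15,16\}\}$,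 $E_2=\{\{2,3\},\{4,5\},\{6,7\},\{8,1\},\{10,11\},\{12,13\},\{14,15\},\{16,9\}\}$, $E_3=\{\{1,3\},\{2,9\},\{4,11\},\{5,7\},\{6,13\},\{8,15\},\{10,12\},\{14,16\}\}$. *)

theory Defs
  imports Complex_Main "HOL-Library.Disjoint_Sets"
begin

definition is_pairing :: "'a set \<Rightarrow> 'a set set \<Rightarrow> bool" where
  "is_pairing V M \<longleftrightarrow> partition_on V M \<and> (\<forall>e\<in>M. card e = 2)"

(* Edges are unordered pairs, indexed by their color. A 3-edge-colored graph uses the
   colors 1, 2, 3; color 0 is reserved for an added pairing. The edge sets of all
   other colors are never inspected. *)
record 'a colored_graph =
  verts :: "'a set"
  edges :: "nat \<Rightarrow> 'a set set"

definition cubic_colored_graph :: "nat \<Rightarrow> 'a colored_graph \<Rightarrow> bool" where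
  "cubic_colored_graph n G \<longleftrightarrow>
     finite (verts G) \<and> card (verts G) = 2 * n \<and>
     (\<forall>i\<in>{1, 2, 3}. is_pairing (verts G) (edges G i))"

definition adj :: "'a set set \<Rightarrow> ('a \<times> 'a) set" where
  "adj E = {(x, y). {x, y} \<in> E}"

definition components :: "'a set \<Rightarrow> 'a set set \<Rightarrow> 'a set set" where
  "components V E = V // (adj E)\<^sup>*"

definition graph_connected :: "'a colored_graph \<Rightarrow> bool" where
  "graph_connected G \<longleftrightarrow>
     (\<forall>x\<in>verts G. \<forall>y\<in>verts G. (x, y) \<in> (adj (edges G 1 \<union> edges G 2 \<union> edges G 3))\<^sup>*)"

definition faces :: "nat \<Rightarrow> nat \<Rightarrow> 'a colored_graph \<Rightarrow> nat" where
  "faces i j G = card (components (verts G) (edges G i \<union> edges G j))"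

definition MST :: "'a colored_graph \<Rightarrow> bool" where
  "MST G \<longleftrightarrow> faces 1 2 G = 1 \<and> faces 1 3 G = 1 \<and> faces 2 3 G = 1"

definition add_pairing :: "'a colored_graph \<Rightarrow> 'a set set \<Rightarrow> 'a colored_graph" where
  "add_pairing G M = G\<lparr>edges := (edges G)(0 := M)\<rparr>"

definition total_faces :: "'a set set \<Rightarrow> 'a colored_graph \<Rightarrow> nat" where
  "total_faces M G = (\<Sum>i = 1..3. faces 0 i (add_pairing G M))"

definition graph_isomorphic :: "'a colored_graph \<Rightarrow> 'b colored_graph \<Rightarrow> bool" where
  "graph_isomorphic G H \<longleftrightarrow>
     (\<exists>f. bij_betw f (verts G) (verts H) \<and>
          (\<forall>i\<in>{1, 2, 3}. (\<lambda>e. f ` e) ` edges G i = edges H i))"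

definition exceptional_graph :: "nat colored_graph" where
  "exceptional_graph =
     \<lparr>verts = {1..16},
      edges = (\<lambda>_. {})
        (1 := {{1,2}, {3,4}, {5,6}, {7,8}, {9,10}, {11,12}, {13,14}, {15,16}},
         2 := {{2,3}, {4,5}, {6,7}, {8,1}, {10,11}, {12,13}, {14,15}, {16,9}},
         3 := {{1,3}, {2,9}, {4,11}, {5,7}, {6,13}, {8,15}, {10,12}, {14,16}})\<rparr>"

end

(*
  Contracting a pair {x, y} (delete both vertices, join their loose ends colour by colour) removes
  one face for every edge between x and y and keeps all other faces of colours (0, i) when {x, y}
  belongs to M.  So F(M, G) is the total multiplicity of the pairs of M, contracted one after the
  other, and a good M may be sought step by step.

  Let f(n) be the least integer above 3n/2 (except f(0) = 0 and f(1) = 3).  If k contractions gain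
  at least f(n) - f(n - k), the problem is reduced to n - k.  Every graph with n <= 7 reaches f(n):
  for odd n contract any edge, for n = 4 and n = 6 use a search over partially known graphs in
  which every branch ends with such a local gain.  A double edge or a 4-cycle always suffices, so
  for n = 8 a non-MST graph may be assumed to have a bicoloured face of length 6 or 8; the same
  kind of search works around a 6-face, and around an 8-face it leaves exactly one graph.
  For n = 9 contract an edge of a small face that is one of several with its two colours: the
  face becomes shorter than 8, where no exception occurs.

  The search trees were found by computer and serve as certificates.  A branch is also cut off
  when it contains an already solved pattern, up to renaming labels and colours.
*)
theory Submission
  imports Defs
begin

section \<open>Contracting pairs of vertices\<close>

text \<open>Contracting the k edges of one colour of a face of length 2k gains at least k + 1, since
  the last of them has become a double edge. For even n >= 4 this meets f(n) - f(n - 1) = 2 and f(n)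
  - f(n - 2) = 3 when k = 1, 2. A hexagon gains 4 where n = 6 and n = 8 require 5, an octagon gains
  5 where n = 8 requires 6: these faces need their surroundings, and there the searches are long.

  The values f(0) and f(1) are exact: two vertices are always joined by three edges. The surplus at
  n = 1 pays for the many branches that contract all pairs but one.

  A contraction may disconnect the graph or leave it with one face per colour pair, so the rest has
  to be treated as an arbitrary graph. This is why all graphs are covered up to n = 7, and why at n
  = 9 the contracted edge is chosen so that a short face survives or a double edge has been used.

  Colours 1, 2, 3 become 0, 1, 2, each a fixed-point-free involution, so that a contraction is a
  local change of three functions.\<close>

definition invol_graph :: "'a set \<Rightarrow> (nat \<Rightarrow> 'a \<Rightarrow> 'a) \<Rightarrow> bool" where
  "invol_graph V e \<longleftrightarrow> finite V \<and> (\<forall>c<3. \<forall>v\<in>V. e c v \<in> V \<and> e c v \<noteq> v \<and> e c (e c v) = v)"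

text \<open>The path \<open>v\<close>, \<open>x\<close>, \<open>y\<close>, \<open>e c y\<close>
  through the colour-0 pair {x, y} becomes a single edge from \<open>v\<close> to
  \<open>e c y\<close>. If \<open>e c x = y\<close>, this edge just vanishes. The values at
  \<open>x\<close> and \<open>y\<close> are meaningless, since both vertices leave the vertex
  set.\<close>

definition contract :: "(nat \<Rightarrow> 'a \<Rightarrow> 'a) \<Rightarrow> 'a \<Rightarrow> 'a \<Rightarrow> nat \<Rightarrow> 'a \<Rightarrow> 'a" where
  "contract e x y c v =
     (if e c v = x then e c y else if e c v = y then e c x else e c v)"

definition mult :: "(nat \<Rightarrow> 'a \<Rightarrow> 'a) \<Rightarrow> 'a \<Rightarrow> 'a \<Rightarrow> nat" where
  "mult e x y = card {c. c < 3 \<and> e c x = y}"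

text \<open>Pairs are chosen one at a time, each in view of the graph left by the earlier ones; a
  step pays the number of edges that join the pair at that moment. The inequality for
  \<open>j\<close> builds downward closure into the definition.\<close>

inductive attains :: "'a set \<Rightarrow> (nat \<Rightarrow> 'a \<Rightarrow> 'a) \<Rightarrow> nat \<Rightarrow> bool" where
  attains_empty: "attains {} e 0"
| attains_step: "\<lbrakk>x \<in> V; y \<in> V; x \<noteq> y; attains (V - {x, y}) (contract e x y) k; j \<le> k + mult e x y\<rbrakk>
    \<Longrightarrow> attains V e j"

lemma invol_graphD:
  assumes "invol_graph V e" "c < 3" "v \<in> V"
  shows "e c v \<in> V" "e c v \<noteq> v" "e c (e c v) = v"
  using assms by (auto simp: invol_graph_def)

lemma invol_graph_contract:
  assumes "invol_graph V e" "x \<in> V" "y \<in> V" "x \<noteq> y"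
  shows "invol_graph (V - {x, y}) (contract e x y)"
proof -
  have "contract e x y c v \<in> V - {x, y} \<and> contract e x y c v \<noteq> v \<and>
        contract e x y c (contract e x y c v) = v" if c: "c < 3" and v: "v \<in> V - {x, y}" for c v
  proof -
    have *: "e c u \<in> V" "e c u \<noteq> u" "e c (e c u) = u" if "u \<in> V" for u
      using invol_graphD[OF assms(1) c that] by auto
    have v': "v \<in> V" "v \<noteq> x" "v \<noteq> y" using v by auto
    consider "e c v = x" | "e c v = y" | "e c v \<noteq> x" "e c v \<noteq> y" by blast
    then show ?thesis
    proof cases
      case 1
      then have ex: "e c x = v" using *(3)[OF v'(1)] by simp
      have "e c y \<noteq> x" "e c y \<noteq> v"
        using *(3)[OF assms(3)] ex 1 v' assms(4) by metis+
      then show ?thesis using 1 ex *[OF assms(3)] assms(4) by (simp add: contract_def)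
    next
      case 2
      then have ey: "e c y = v" using *(3)[OF v'(1)] by simp
      have "e c x \<noteq> y" "e c x \<noteq> v"
        using *(3)[OF assms(2)] ey 2 v' assms(4) by metis+
      then show ?thesis using 2 ey *[OF assms(2)] assms(4) by (simp add: contract_def)
    next
      case 3
      then show ?thesis using *[OF v'(1)] v' by (simp add: contract_def)
    qed
  qed
  with assms(1) show ?thesis by (auto simp: invol_graph_def)
qed

lemma attains_mono: "attains V e k \<Longrightarrow> j \<le> k \<Longrightarrow> attains V e j"
  by (erule attains.cases) (auto intro: attains.intros order_trans)

lemma mult_eq: "mult e x y = (\<Sum>c<3. if e c x = y then 1 else 0)"
proof -
  have "{c. c < 3 \<and> e c x = y} = {..<3} \<inter> {c. e c x = y}" by auto
  then show ?thesis by (simp add: mult_def sum.If_cases)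
qed

lemma mult_permute:
  assumes "bij_betw \<sigma> {..<3} {..<3::nat}"
  shows "mult (e \<circ> \<sigma>) x y = mult e x y"
proof -
  have im: "\<sigma> ` {c. c < 3 \<and> (e \<circ> \<sigma>) c x = y} = {c. c < 3 \<and> e c x = y}"
  proof (rule set_eqI)
    fix d
    have "d \<in> {..<3} \<longleftrightarrow> d \<in> \<sigma> ` {..<3}" using assms by (simp add: bij_betw_def)
    then have "d < 3 \<longleftrightarrow> (\<exists>c<3. d = \<sigma> c)" by (simp add: image_iff Bex_def)
    then show "d \<in> \<sigma> ` {c. c < 3 \<and> (e \<circ> \<sigma>) c x = y} \<longleftrightarrow> d \<in> {c. c < 3 \<and> e c x = y}" by auto
  qed
  have "inj_on \<sigma> {c. c < 3 \<and> (e \<circ> \<sigma>) c x = y}"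
    using assms by (auto simp: bij_betw_def inj_on_def)
  then show ?thesis unfolding mult_def im[symmetric] by (rule card_image[symmetric])
qed

text \<open>Contraction acts on each colour separately, so it commutes with renaming the colours.
  This is what allows a certificate to cite a pattern that was solved in other colours.\<close>

lemma attains_permute:
  assumes "bij_betw \<sigma> {..<3} {..<3::nat}" and "attains V (e \<circ> \<sigma>) k"
  shows "attains V e k"
  using assms(2)
proof (induction V "e \<circ> \<sigma>" k arbitrary: e rule: attains.induct)
  case attains_empty
  show ?case by (rule attains.attains_empty)
next
  case (attains_step x V y k j)
  have "contract (e \<circ> \<sigma>) x y = contract e x y \<circ> \<sigma>"
    by (auto simp: fun_eq_iff contract_def)
  then have "attains (V - {x, y}) (contract e x y) k" using attains_step by blast
  with attains_step show ?case
    by (auto intro: attains.attains_step simp: mult_permute[OF assms(1)])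
qed

lemma invol_graph_permute:
  assumes "bij_betw \<sigma> {..<3} {..<3::nat}" and "invol_graph V e"
  shows "invol_graph V (e \<circ> \<sigma>)"
  using assms bij_betwE[OF assms(1)] by (auto simp: invol_graph_def)

fun contracts :: "(nat \<Rightarrow> 'a \<Rightarrow> 'a) \<Rightarrow> ('a \<times> 'a) list \<Rightarrow> nat \<Rightarrow> 'a \<Rightarrow> 'a" where
  "contracts e [] = e"
| "contracts e ((x, y) # ps) = contract (contracts e ps) x y"

fun gain :: "(nat \<Rightarrow> 'a \<Rightarrow> 'a) \<Rightarrow> ('a \<times> 'a) list \<Rightarrow> nat" where
  "gain e [] = 0"
| "gain e ((x, y) # ps) = mult (contracts e ps) x y + gain e ps"

definition flat :: "('a \<times> 'a) list \<Rightarrow> 'a list" where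
  "flat ps = concat (map (\<lambda>(x, y). [x, y]) ps)"

lemma flat_simps: "flat [] = []" "flat ((x, y) # ps) = x # y # flat ps"
  by (simp_all add: flat_def)

lemma length_flat: "length (flat ps) = 2 * length ps"
  by (induction ps) (auto simp: flat_simps)

lemma invol_graph_contracts:
  "\<lbrakk>invol_graph V e; distinct (flat ps); set (flat ps) \<subseteq> V\<rbrakk>
    \<Longrightarrow> invol_graph (V - set (flat ps)) (contracts e ps)"
proof (induction ps)
  case (Cons p ps)
  obtain x y where p: "p = (x, y)" by force
  have "V - set (flat (p # ps)) = V - set (flat ps) - {x, y}" by (auto simp: p flat_simps)
  with Cons p show ?case by (auto simp: flat_simps intro!: invol_graph_contract)
qed (simp add: flat_simps)

lemma attains_contracts:
  "\<lbrakk>distinct (flat ps); set (flat ps) \<subseteq> V; attains (V - set (flat ps)) (contracts e ps) k\<rbrakk>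
    \<Longrightarrow> attains V e (k + gain e ps)"
proof (induction ps arbitrary: k)
  case (Cons p ps)
  obtain x y where p: "p = (x, y)" by force
  have "V - set (flat (p # ps)) = V - set (flat ps) - {x, y}" by (auto simp: p flat_simps)
  with Cons.prems(3) have A: "attains (V - set (flat ps) - {x, y}) (contract (contracts e ps) x y) k"
    by (simp add: p)
  have "attains (V - set (flat ps)) (contracts e ps) (k + mult (contracts e ps) x y)"
    by (rule attains_step[OF _ _ _ A order_refl]) (use Cons.prems(1,2) in \<open>auto simp: p flat_simps\<close>)
  from Cons.IH[OF _ _ this] Cons.prems show ?case by (simp add: p flat_simps add.assoc)
qed (simp add: flat_simps)

section \<open>Contractions and faces\<close>

definition pairing_of :: "'a set \<Rightarrow> ('a \<Rightarrow> 'a) \<Rightarrow> 'a set set" where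
  "pairing_of V p = (\<lambda>v. {v, p v}) ` V"

text \<open>Disjointness of the edges makes the partner of a vertex unique, and uniqueness turns the
  chosen partner into an involution.\<close>

lemma pairing_is_pairing_of:
  assumes "is_pairing V M"
  obtains p where "\<forall>v\<in>V. p v \<in> V \<and> p v \<noteq> v \<and> p (p v) = v" and "M = pairing_of V p"
proof -
  have part: "partition_on V M" and two: "\<And>e. e \<in> M \<Longrightarrow> card e = 2"
    using assms by (auto simp: is_pairing_def)
  have sub: "e \<subseteq> V" if "e \<in> M" for e using part that by (auto simp: partition_on_def)
  have uniq: "e = e'" if "e \<in> M" "e' \<in> M" "v \<in> e" "v \<in> e'" for e e' v
    using part that by (auto simp: partition_on_def disjoint_def)
  have ex: "\<exists>w. {v, w} \<in> M \<and> w \<noteq> v" if v: "v \<in> V" for v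
  proof -
    obtain e where e: "e \<in> M" "v \<in> e" using part v by (auto simp: partition_on_def)
    then show ?thesis using two[of e] by (auto simp: card_2_iff insert_commute)
  qed
  define p where "p v = (SOME w. {v, w} \<in> M \<and> w \<noteq> v)" for v
  have p: "{v, p v} \<in> M" "p v \<noteq> v" if "v \<in> V" for v
    using someI_ex[OF ex[OF that]] by (auto simp: p_def)
  have pV: "p v \<in> V" if "v \<in> V" for v using sub[OF p(1)[OF that]] by auto
  have pp: "p (p v) = v" if "v \<in> V" for v
    using uniq[OF p(1)[OF that] p(1)[OF pV[OF that]], of "p v"] p(2)[OF that] p(2)[OF pV[OF that]]
    by (auto simp: doubleton_eq_iff)
  have "e \<in> pairing_of V p" if e: "e \<in> M" for e
  proof -
    obtain v w where "e = {v, w}" "v \<noteq> w" using two[OF e] by (auto simp: card_2_iff)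
    then have "v \<in> V" "e = {v, p v}" using sub[OF e] uniq[OF e p(1)[of v], of v] by auto
    then show ?thesis by (auto simp: pairing_of_def)
  qed
  then have "M = pairing_of V p" using p by (auto simp: pairing_of_def)
  with p pV pp that show thesis by blast
qed

lemma is_pairing_insert:
  assumes "is_pairing (V - {x, y}) M" "x \<in> V" "y \<in> V" "x \<noteq> y"
  shows "is_pairing V (insert {x, y} M)"
proof -
  have "partition_on (V - {x, y}) M" using assms(1) by (simp add: is_pairing_def)
  then have "partition_on V (insert {x, y} M)"
    using assms(2-4) unfolding partition_on_def disjoint_def by auto
  with assms show ?thesis by (auto simp: is_pairing_def)
qed

lemma sym_adj: "sym (adj E)"
  by (auto simp: sym_def adj_def insert_commute)

lemma components_image: "components V E = (\<lambda>v. (adj E)\<^sup>* `` {v}) ` V"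
  by (auto simp: components_def quotient_def)

lemma component_eq_iff:
  "(adj E)\<^sup>* `` {u} = (adj E)\<^sup>* `` {v} \<longleftrightarrow> (u, v) \<in> (adj E)\<^sup>*"
proof -
  have "equiv UNIV ((adj E)\<^sup>*)"
    by (intro equivI refl_rtrancl sym_rtrancl sym_adj trans_rtrancl) simp
  from eq_equiv_class_iff[OF this] show ?thesis by simp
qed

text \<open>Components are counted as images of the map from vertices to classes. Comparing the
  numbers of classes of two relations then amounts to comparing the kernels of two maps on one
  vertex set.\<close>

lemma card_image_kernel_eq:
  assumes "\<And>u v. u \<in> A \<Longrightarrow> v \<in> A \<Longrightarrow> f u = f v \<longleftrightarrow> g u = g v"
  shows "card (f ` A) = card (g ` A)"
proof (rule bij_betw_same_card)
  define k where "k z = g (SOME u. u \<in> A \<and> f u = z)" for z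
  have k: "k (f u) = g u" if "u \<in> A" for u
  proof -
    have "(SOME w. w \<in> A \<and> f w = f u) \<in> A \<and> f (SOME w. w \<in> A \<and> f w = f u) = f u"
      by (rule someI[of _ u]) (use that in simp)
    then show ?thesis using assms that by (auto simp: k_def)
  qed
  show "bij_betw k (f ` A) (g ` A)"
    unfolding bij_betw_def inj_on_def using k assms by (auto simp: image_iff)
qed

lemma adj_pairing_of:
  assumes "\<forall>v\<in>V. p v \<in> V \<and> p v \<noteq> v \<and> p (p v) = v"
  shows "(u, v) \<in> adj (pairing_of V p) \<longleftrightarrow> u \<in> V \<and> v = p u"
  using assms by (auto simp: adj_def pairing_of_def doubleton_eq_iff)

lemma adj_Un: "adj (E \<union> F) = adj E \<union> adj F"
  by (auto simp: adj_def)

lemma adj_insert: "adj (insert {x, y} E) = {(x, y), (y, x)} \<union> adj E"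
  by (auto simp: adj_def doubleton_eq_iff)

text \<open>With {x, y} as an edge of colour 0, contraction shortens the cycle through
  \<open>x\<close> and \<open>y\<close>; that cycle disappears only if it consists of
  \<open>x\<close> and \<open>y\<close> alone, that is, if \<open>p x = y\<close>. All other cycles
  are untouched.\<close>

lemma card_components_contract:
  fixes V :: "'a set"
  assumes fin: "finite V" and p: "\<forall>v\<in>V. p v \<in> V \<and> p v \<noteq> v \<and> p (p v) = v"
    and xy: "x \<in> V" "y \<in> V" "x \<noteq> y"
    and q: "\<forall>v\<in>V - {x, y}. q v \<in> V - {x, y} \<and> q v \<noteq> v \<and> q (q v) = v"
    and qp: "\<And>v. v \<in> V - {x, y} \<Longrightarrow> q v = (if p v = x then p y else if p v = y then p x else p v)"
    and M: "is_pairing (V - {x, y}) M"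
  shows "card (components V (insert {x, y} M \<union> pairing_of V p)) =
    card (components (V - {x, y}) (M \<union> pairing_of (V - {x, y}) q)) + (if p x = y then 1 else 0)"
proof -
  let ?V = "V - {x, y}"
  let ?F = "insert {x, y} M \<union> pairing_of V p" and ?F' = "M \<union> pairing_of ?V q"
  define R where "R = adj ?F"
  define R' where "R' = adj ?F'"
  have comps: "components V ?F = (\<lambda>v. R\<^sup>* `` {v}) ` V"
      "components ?V ?F' = (\<lambda>v. R'\<^sup>* `` {v}) ` ?V"
    by (simp_all only: components_image R_def R'_def)
  have sym_R: "sym (R\<^sup>*)" unfolding R_def by (rule sym_rtrancl[OF sym_adj])
  have R_class: "R\<^sup>* `` {u} = R\<^sup>* `` {v} \<longleftrightarrow> (u, v) \<in> R\<^sup>*"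
      "R'\<^sup>* `` {u} = R'\<^sup>* `` {v} \<longleftrightarrow> (u, v) \<in> R'\<^sup>*" for u v
    by (simp_all only: R_def R'_def component_eq_iff)
  have M_sub: "u \<in> ?V \<and> v \<in> ?V" if "(u, v) \<in> adj M" for u v
    using M that by (auto simp: is_pairing_def partition_on_def adj_def)
  have R_iff: "(u, v) \<in> R \<longleftrightarrow> (u, v) \<in> {(x, y), (y, x)} \<or> (u, v) \<in> adj M \<or> u \<in> V \<and> v = p u" for u v
    by (simp only: R_def adj_Un adj_insert Un_iff adj_pairing_of[OF p]) blast
  have R'_iff: "(u, v) \<in> R' \<longleftrightarrow> (u, v) \<in> adj M \<or> u \<in> ?V \<and> v = q u" for u v
    by (simp only: R'_def adj_Un Un_iff adj_pairing_of[OF q])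
  show ?thesis
  proof (cases "p x = y")
    case False
    \<comment> \<open>Each deleted vertex moves along its own \<open>p\<close>-edge to a surviving
      vertex of the same component; since \<open>p x \<noteq> y\<close>, both images survive.
      Connectivity is carried across the contraction by this retraction.\<close>
    define \<phi> where "\<phi> u = (if u = x then p x else if u = y then p y else u)" for u
    have px: "p x \<in> ?V" and py: "p y \<in> ?V" using p xy False by auto
    have pp: "p (p u) = u" if "u \<in> V" for u using p that by blast
    have 1: "(\<phi> u, \<phi> v) \<in> R'\<^sup>*" if "(u, v) \<in> R" for u v
    proof -
      consider "u = x" "v = y" | "u = y" "v = x" | "(u, v) \<in> adj M" | "u \<in> V" "v = p u"
        using \<open>(u, v) \<in> R\<close> unfolding R_iff by blast
      then show ?thesis
      proof cases
        case 1
        \<comment> \<open>The edge xy of \<open>M\<close> is mapped to the edge newly created by the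
          contraction.\<close>
        have "(p x, p y) \<in> R'" unfolding R'_iff using px qp[OF px] pp[OF xy(1)] by simp
        then show ?thesis using 1 xy(3) by (auto simp: \<phi>_def)
      next
        case 2
        have "(p y, p x) \<in> R'" unfolding R'_iff using py qp[OF py] pp[OF xy(2)] xy(3) by simp
        then show ?thesis using 2 xy(3) by (auto simp: \<phi>_def)
      next
        case 3
        then have "\<phi> u = u" "\<phi> v = v" using M_sub[OF 3] by (auto simp: \<phi>_def)
        then show ?thesis using 3 R'_iff by auto
      next
        case 4
        show ?thesis
        proof (cases "u \<in> {x, y} \<or> p u \<in> {x, y}")
          case True
          \<comment> \<open>A \<open>p\<close>-edge at \<open>x\<close> or \<open>y\<close>
            collapses to a point.\<close>
          then have "\<phi> u = \<phi> v" using 4 px py pp[OF 4(1)] pp xy by (auto simp: \<phi>_def)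
          then show ?thesis by simp
        next
          case u: False
          then have "(u, v) \<in> R'" unfolding R'_iff using 4 qp[of u] by auto
          then show ?thesis using u 4 by (auto simp: \<phi>_def)
        qed
      qed
    qed
    have 2: "(u, v) \<in> R\<^sup>*" if "(u, v) \<in> R'" for u v
    proof -
      have xyR: "(x, y) \<in> R" "(y, x) \<in> R" unfolding R_iff by auto
      have pR: "(w, p w) \<in> R" if "w \<in> V" for w unfolding R_iff using that by auto
      consider "(u, v) \<in> adj M" | "u \<in> ?V" "v = q u"
        using \<open>(u, v) \<in> R'\<close> unfolding R'_iff by blast
      then show ?thesis
      proof cases
        case 1
        then show ?thesis using R_iff by blast
      next
        case 2
        \<comment> \<open>A new edge of \<open>R'\<close> unrolls to a walk of length three through
          \<open>x\<close> and \<open>y\<close>.\<close>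
        consider "p u = x" "v = p y" | "p u = y" "v = p x" | "v = p u"
          using 2 qp[of u] by (auto split: if_splits)
        then show ?thesis
          using pR[of u] pR[OF xy(1)] pR[OF xy(2)] xyR 2(1)
          by cases (auto intro: rtrancl_into_rtrancl r_into_rtrancl)
      qed
    qed
    have 3: "(u, \<phi> u) \<in> R\<^sup>*" if "u \<in> V" for u
      unfolding \<phi>_def using R_iff[of x "p x"] R_iff[of y "p y"] xy by auto
    have 4: "(\<phi> u, u) \<in> R\<^sup>*" if "u \<in> V" for u
      by (rule symD[OF sym_R 3[OF that]])
    have iff: "(u, v) \<in> R\<^sup>* \<longleftrightarrow> (\<phi> u, \<phi> v) \<in> R'\<^sup>*" if "u \<in> V" "v \<in> V" for u v
    proof
      assume "(u, v) \<in> R\<^sup>*"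
      then show "(\<phi> u, \<phi> v) \<in> R'\<^sup>*"
        by (induction rule: rtrancl_induct) (auto dest: 1 intro: rtrancl_trans)
    next
      assume "(\<phi> u, \<phi> v) \<in> R'\<^sup>*"
      then have "(\<phi> u, \<phi> v) \<in> R\<^sup>*"
        by (induction rule: rtrancl_induct) (auto dest: 2 intro: rtrancl_trans)
      with 3[OF that(1)] 4[OF that(2)] show "(u, v) \<in> R\<^sup>*" by (meson rtrancl_trans)
    qed
    have "\<phi> ` V = ?V"
    proof
      show "\<phi> ` V \<subseteq> ?V" using px py by (auto simp: \<phi>_def)
      show "?V \<subseteq> \<phi> ` V" by (auto simp: \<phi>_def image_iff)
    qed
    then have "components ?V ?F' = (\<lambda>v. R'\<^sup>* `` {\<phi> v}) ` V"
      unfolding comps(2) by (simp only: image_image flip: \<open>\<phi> ` V = ?V\<close>)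
    moreover have "card ((\<lambda>v. R\<^sup>* `` {v}) ` V) = card ((\<lambda>v. R'\<^sup>* `` {\<phi> v}) ` V)"
      by (rule card_image_kernel_eq) (simp add: R_class iff)
    ultimately show ?thesis unfolding comps(1) using False by simp
  next
    case True
    \<comment> \<open>Now {x, y} is closed under \<open>R\<close>, hence a class of its own, and
      \<open>q\<close> agrees with \<open>p\<close> on all other vertices, whose classes stay as
      they are.\<close>
    then have py: "p y = x" using p xy by blast
    have Rx: "v \<in> {x, y}" if "(x, v) \<in> R\<^sup>*" for v
      using that by (induction rule: rtrancl_induct) (use R_iff M_sub True py in auto)
    have "(x, y) \<in> R" using R_iff by blast
    then have "(x, y) \<in> R\<^sup>*" by blast
    moreover from this have "(y, x) \<in> R\<^sup>*" by (rule symD[OF sym_R])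
    ultimately have clx: "R\<^sup>* `` {x} = {x, y}" "R\<^sup>* `` {y} = {x, y}"
      using Rx R_class[of x y] by auto
    have qp': "q u = p u" if "u \<in> ?V" for u
    proof -
      have "p u \<noteq> x" "p u \<noteq> y" using that p True py xy by (metis Diff_iff insertCI)+
      then show ?thesis using qp[OF that] by simp
    qed
    have sub: "R' \<subseteq> R" using R_iff R'_iff qp' by auto
    have fwd: "(u, v) \<in> R'\<^sup>* \<and> v \<in> ?V" if "(u, v) \<in> R\<^sup>*" "u \<in> ?V" for u v
      using that(1)
    proof (induction rule: rtrancl_induct)
      case base
      show ?case using that by simp
    next
      case (step v w)
      then have "(v, w) \<in> R'" unfolding R'_iff using step(2) unfolding R_iff using M_sub qp' by auto
      moreover from this have "w \<in> ?V" unfolding R'_iff using M_sub q by blast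
      ultimately show ?case using step(3) by (auto intro: rtrancl_into_rtrancl)
    qed
    have cl: "R\<^sup>* `` {u} = R'\<^sup>* `` {u}" if "u \<in> ?V" for u
      using fwd[OF _ that] rtrancl_mono[OF sub] by auto
    have "V = insert x (insert y ?V)" using xy by auto
    then have "components V ?F = insert {x, y} (components ?V ?F')"
      unfolding comps using clx cl by (metis (no_types, lifting) image_cong image_insert insert_absorb2)
    moreover have "{x, y} \<notin> components ?V ?F'" unfolding comps by auto
    moreover have "finite (components ?V ?F')" unfolding comps using fin by auto
    ultimately show ?thesis using True by simp
  qed
qed

text \<open>The contracted pairs themselves form \<open>M\<close>. Undoing one contraction adds one
  component for every colour that joined the pair, and these increments add up to
  \<open>mult\<close>.\<close>

lemma attains_pairing:
  assumes "attains V e k" "invol_graph V e"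
  shows "\<exists>M. is_pairing V M \<and> k \<le> (\<Sum>c<3. card (components V (M \<union> pairing_of V (e c))))"
  using assms
proof (induction rule: attains.induct)
  case (attains_empty e)
  have "is_pairing {} {}" by (simp add: is_pairing_def partition_on_def)
  then show ?case by blast
next
  case (attains_step x V y e k j)
  let ?V = "V - {x, y}" and ?e = "contract e x y"
  have inv: "invol_graph ?V ?e" using attains_step by (intro invol_graph_contract)
  then obtain M where M: "is_pairing ?V M"
    and k: "k \<le> (\<Sum>c<3. card (components ?V (M \<union> pairing_of ?V (?e c))))"
    using attains_step by blast
  have "card (components V (insert {x, y} M \<union> pairing_of V (e c))) =
      card (components ?V (M \<union> pairing_of ?V (?e c))) + (if e c x = y then 1 else 0)" if "c < 3" for c
    by (rule card_components_contract)
      (use attains_step.prems inv attains_step.hyps(1-3) M that in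
        \<open>auto simp: invol_graph_def contract_def\<close>)
  then have "(\<Sum>c<3. card (components V (insert {x, y} M \<union> pairing_of V (e c)))) =
      (\<Sum>c<3. card (components ?V (M \<union> pairing_of ?V (?e c)))) + mult e x y"
    by (simp add: mult_eq sum.distrib)
  with k attains_step.hyps have "j \<le> (\<Sum>c<3. card (components V (insert {x, y} M \<union> pairing_of V (e c))))"
    by linarith
  moreover have "is_pairing V (insert {x, y} M)" using M attains_step.hyps by (intro is_pairing_insert)
  ultimately show ?case by blast
qed

section \<open>Patterns and certificates\<close>

text \<open>From \<open>n = 2\<close> on the increments are 1, 1, 2, 1, 2, 1, 2, 1. Where the
  increment is 1 an edge of multiplicity one is enough, so only the sizes 4, 6 and 8 need a
  search.\<close>

definition target :: "nat \<Rightarrow> nat" where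
  "target n = [0, 3, 4, 5, 7, 8, 10, 11, 13, 14] ! n"

lemma target_eval:
  "target 0 = 0" "target 1 = 3" "target 2 = 4" "target 3 = 5" "target 4 = 7"
  "target 5 = 8" "target 6 = 10" "target 7 = 11" "target 8 = 13" "target 9 = 14"
  by (simp_all add: target_def)

text \<open>The type argument fixes the vertex type, which a predicate on \<open>n\<close> alone
  could not mention.\<close>

definition good :: "'a itself \<Rightarrow> nat \<Rightarrow> bool" where
  "good T n \<longleftrightarrow> (\<forall>V e. invol_graph (V :: 'a set) e \<and> card V = 2 * n \<longrightarrow> attains V e (target n))"

text \<open>A pattern \<^term>\<open>(K, t)\<close> is a partial edge-coloured graph on the labels below \<^term>\<open>K\<close>:
  \<^term>\<open>t ! c ! i\<close> is the neighbour of \<^term>\<open>i\<close> along colour \<^term>\<open>c\<close>, and 16 stands for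
  ``unknown''.  All rows are padded to length 16, so that each look-up is a single rewrite step.\<close>

type_synonym pattern = "nat \<times> nat list list"

definition labels :: "nat list" where
  "labels = [0, 1, 2, 3, 4, 5, 6, 7, 8, 9, 10, 11, 12, 13, 14, 15]"

text \<open>The row is passed twice, for look-ups and as the list to be traversed beside its
  indices, so that the test unfolds by recursion on lists.\<close>

definition wf_row :: "nat \<Rightarrow> nat list \<Rightarrow> nat list \<Rightarrow> nat list \<Rightarrow> bool" where
  "wf_row K r is xs \<longleftrightarrow> list_all2 (\<lambda>i x. x = 16 \<or> i < K \<and> x < K \<and> r ! x = i) is xs"

definition wf_table :: "nat \<Rightarrow> nat list list \<Rightarrow> bool" where
  "wf_table K t \<longleftrightarrow> K \<le> 16 \<and> length t = 3 \<and> wf_row K (t ! 0) labels (t ! 0) \<and>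
     wf_row K (t ! 1) labels (t ! 1) \<and> wf_row K (t ! 2) labels (t ! 2)"

lemma labels_eq: "labels = [0..<16]"
  by (simp add: labels_def upt_rec)

lemma length_labels: "length labels = 16"
  by (simp add: labels_eq)

lemma nth_labels: "i < 16 \<Longrightarrow> labels ! i = i"
  by (simp add: labels_eq)

lemma less_3_cases: "(c::nat) < 3 \<longleftrightarrow> c = 0 \<or> c = 1 \<or> c = 2"
  by auto

lemma wf_table_iff:
  "wf_table K t \<longleftrightarrow> K \<le> 16 \<and> length t = 3 \<and> (\<forall>c<3. length (t ! c) = 16 \<and>
     (\<forall>i<16. t ! c ! i \<noteq> 16 \<longrightarrow> i < K \<and> t ! c ! i < K \<and> t ! c ! (t ! c ! i) = i))"
  unfolding wf_table_def wf_row_def list_all2_conv_all_nth length_labels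
  by (auto simp: less_3_cases nth_labels)

lemma wf_tableD:
  assumes "wf_table K t"
  shows "K \<le> 16" "length t = 3"
    "c < 3 \<Longrightarrow> length (t ! c) = 16"
    "c < 3 \<Longrightarrow> i < 16 \<Longrightarrow> t ! c ! i \<noteq> 16 \<Longrightarrow> i < K"
    "c < 3 \<Longrightarrow> i < 16 \<Longrightarrow> t ! c ! i \<noteq> 16 \<Longrightarrow> t ! c ! i < K"
    "c < 3 \<Longrightarrow> i < 16 \<Longrightarrow> t ! c ! i \<noteq> 16 \<Longrightarrow> t ! c ! (t ! c ! i) = i"
  using assms by (auto simp: wf_table_iff)

definition occurs :: "'a set \<Rightarrow> (nat \<Rightarrow> 'a \<Rightarrow> 'a) \<Rightarrow> nat \<Rightarrow> nat list list \<Rightarrow> (nat \<Rightarrow> 'a) \<Rightarrow> bool" where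
  "occurs V e K t h \<longleftrightarrow> inj_on h {..<K} \<and> h ` {..<K} \<subseteq> V \<and>
     (\<forall>c<3. \<forall>i<K. t ! c ! i \<noteq> 16 \<longrightarrow> e c (h i) = h (t ! c ! i))"

text \<open>The exceptional graph, labelled as the one leaf that the search around an 8-face leaves open.\<close>

definition exceptional_table :: "nat list list" where
  "exceptional_table =
    [[1, 0, 3, 2, 5, 4, 7, 6, 9, 8, 11, 10, 13, 12, 15, 14],
     [7, 2, 1, 4, 3, 6, 5, 0, 10, 12, 8, 14, 9, 15, 11, 13],
     [2, 8, 0, 12, 6, 15, 4, 11, 1, 13, 14, 7, 3, 9, 10, 5]]"

text \<open>The colours are free up to a permutation, because references between patterns rename
  them. \<open>exceptional_graph_labellings\<close> removes this freedom at the end.\<close>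

definition exceptional :: "'a set \<Rightarrow> (nat \<Rightarrow> 'a \<Rightarrow> 'a) \<Rightarrow> bool" where
  "exceptional V e \<longleftrightarrow> (\<exists>\<sigma> h. bij_betw \<sigma> {..<3} {..<3} \<and> bij_betw h {..<16::nat} V \<and>
     (\<forall>c<3. \<forall>i<16. e (\<sigma> c) (h i) = h (exceptional_table ! c ! i)))"

lemma exceptional_permute:
  assumes "bij_betw \<sigma> {..<3} {..<3::nat}" "exceptional V (e \<circ> \<sigma>)"
  shows "exceptional V e"
proof -
  obtain \<tau> h where "bij_betw \<tau> {..<3} {..<3}" "bij_betw h {..<16::nat} V"
      "\<forall>c<3. \<forall>i<16. (e \<circ> \<sigma>) (\<tau> c) (h i) = h (exceptional_table ! c ! i)"
    using assms(2) by (auto simp: exceptional_def)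
  then show ?thesis
    using bij_betw_trans[of \<tau> "{..<3}" "{..<3}" \<sigma> "{..<3}"] assms(1)
    unfolding exceptional_def by (intro exI[of _ "\<sigma> \<circ> \<tau>"] exI[of _ h]) auto
qed

text \<open>The induction hypothesis on smaller sizes is part of the definition, so that each
  certificate yields an unconditional fact, which later certificates can cite as a rewrite rule. The
  flag \<open>b\<close> tells whether the exceptional graph is an admissible outcome.\<close>

definition solved :: "'a itself \<Rightarrow> bool \<Rightarrow> nat \<Rightarrow> pattern \<Rightarrow> bool" where
  "solved T b n P \<longleftrightarrow> wf_table (fst P) (snd P) \<and>
     ((\<forall>m<n. good T m) \<longrightarrow>
      (\<forall>V e h. invol_graph (V :: 'a set) e \<and> card V = 2 * n \<and> occurs V e (fst P) (snd P) h \<longrightarrow>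
        attains V e (target n) \<or> b \<and> exceptional V e))"

lemma solvedD:
  assumes "solved (T :: 'a itself) b n P" "\<And>m. m < n \<Longrightarrow> good T m"
    and "invol_graph (V :: 'a set) e" "card V = 2 * n" "occurs V e (fst P) (snd P) h"
  shows "attains V e (target n) \<or> b \<and> exceptional V e"
  using assms unfolding solved_def by blast

lemma solved_weaken: "solved T False n P \<Longrightarrow> solved T b n P"
  by (auto simp: solved_def)

text \<open>The pairs of a \<open>Close\<close> are listed with the last contraction first.  A \<open>Ref\<close> carries the
  images of the labels and of the colours of the pattern it refers to.\<close>

datatype cert =
    Close "(nat \<times> nat) list"
  | Split nat nat "cert list"
  | Ref pattern "nat list" "nat list"

text \<open>The neighbour of \<^term>\<open>v\<close> in \<^term>\<open>contracts e ps\<close>, computed without building the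
  contracted table.\<close>

fun follow :: "nat list list \<Rightarrow> (nat \<times> nat) list \<Rightarrow> nat \<Rightarrow> nat \<Rightarrow> nat" where
  "follow t [] c v = t ! c ! v"
| "follow t ((x, y) # ps) c v =
    (if follow t ps c v = x then follow t ps c y
     else if follow t ps c v = y then follow t ps c x
     else follow t ps c v)"

fun score :: "nat list list \<Rightarrow> (nat \<times> nat) list \<Rightarrow> nat" where
  "score t [] = 0"
| "score t ((x, y) # ps) =
     (if follow t ps 0 x = y then 1 else 0) + (if follow t ps 1 x = y then 1 else 0) +
     (if follow t ps 2 x = y then 1 else 0) + score t ps"

text \<open>At least one contraction is demanded, so that the graph left over is smaller and may be
  credited with its target by induction.\<close>

definition closes :: "nat \<Rightarrow> nat \<Rightarrow> nat list list \<Rightarrow> (nat \<times> nat) list \<Rightarrow> bool" where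
  "closes n K t ps \<longleftrightarrow> ps \<noteq> [] \<and> list_all (\<lambda>v. v < K) (flat ps) \<and> distinct (flat ps) \<and>
     target n \<le> score t ps + target (n - length ps)"

definition link :: "nat list list \<Rightarrow> nat \<Rightarrow> nat \<Rightarrow> nat \<Rightarrow> nat list list" where
  "link t c v w = t[c := (t ! c)[v := w, w := v]]"

text \<open>The bound \<open>w < N\<close> drops the fresh label once all vertices have been
  named.\<close>

definition candidates :: "nat \<Rightarrow> nat \<Rightarrow> nat list \<Rightarrow> nat \<Rightarrow> nat list \<Rightarrow> nat list" where
  "candidates N K r v ws = filter (\<lambda>w. w \<noteq> v \<and> w \<le> K \<and> w < N \<and> r ! w = 16) ws"

definition row_embeds :: "nat list \<Rightarrow> nat list \<Rightarrow> nat list \<Rightarrow> nat list \<Rightarrow> bool" where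
  "row_embeds m r xs ys \<longleftrightarrow> list_all2 (\<lambda>x y. y = 16 \<or> r ! x = m ! y) xs ys"

text \<open>Entries of \<open>m\<close> from position \<open>fst P\<close> on are padding: the rows
  of a well-formed pattern hold 16 there and impose nothing.\<close>

definition embeds :: "pattern \<Rightarrow> nat \<Rightarrow> nat list list \<Rightarrow> nat list \<Rightarrow> nat list \<Rightarrow> bool" where
  "embeds P K t m s \<longleftrightarrow> length m = 16 \<and> distinct (take (fst P) m) \<and>
     list_all (\<lambda>v. v < K) (take (fst P) m) \<and>
     s \<in> {[0, 1, 2], [0, 2, 1], [1, 0, 2], [1, 2, 0], [2, 0, 1], [2, 1, 0]} \<and>
     row_embeds m (t ! (s ! 0)) m (snd P ! 0) \<and>
     row_embeds m (t ! (s ! 1)) m (snd P ! 1) \<and>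
     row_embeds m (t ! (s ! 2)) m (snd P ! 2)"

text \<open>In a split, the candidate \<^term>\<open>K\<close> (the first unused label) stands for a vertex that has
  not been labelled yet.\<close>

fun check :: "nat \<Rightarrow> (pattern \<Rightarrow> bool) \<Rightarrow> nat \<Rightarrow> nat list list \<Rightarrow> cert \<Rightarrow> bool"
  and checks :: "nat \<Rightarrow> (pattern \<Rightarrow> bool) \<Rightarrow> nat \<Rightarrow> nat list list \<Rightarrow> nat \<Rightarrow> nat \<Rightarrow> nat list \<Rightarrow> cert list \<Rightarrow> bool" where
  "check n S K t (Close ps) \<longleftrightarrow> closes n K t ps"
| "check n S K t (Split c v xs) \<longleftrightarrow> c < 3 \<and> v < K \<and> t ! c ! v = 16 \<and>
     checks n S K t c v (candidates (2 * n) K (t ! c) v labels) xs"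
| "check n S K t (Ref P m s) \<longleftrightarrow> S P \<and> embeds P K t m s"
| "checks n S K t c v [] [] \<longleftrightarrow> True"
| "checks n S K t c v (w # ws) (x # xs) \<longleftrightarrow>
     check n S (if w = K then K + 1 else K) (link t c v w) x \<and> checks n S K t c v ws xs"
| "checks n S K t c v [] (x # xs) \<longleftrightarrow> False"
| "checks n S K t c v (w # ws) [] \<longleftrightarrow> False"

section \<open>Soundness of certificates\<close>

lemma follow_sound:
  assumes wf: "wf_table K t" and occ: "occurs V e K t h" and c: "c < 3"
    and "list_all (\<lambda>v. v < K) (flat ps)" "distinct (flat ps)" "v < K" "follow t ps c v \<noteq> 16"
  shows "follow t ps c v < K \<and> contracts e (map (map_prod h h) ps) c (h v) = h (follow t ps c v)"
  using assms(4-)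
proof (induction ps arbitrary: v)
  case Nil
  then show ?case using wf_tableD[OF wf] c occ by (auto simp: occurs_def)
next
  case (Cons p ps)
  obtain x y where p: "p = (x, y)" by force
  \<comment> \<open>Since \<open>K \<le> 16\<close>, the value 16 never equals a label. An unknown
    neighbour therefore stays 16 through all contractions, and any other answer rests on known
    entries only.\<close>
  have xy: "x < K" "y < K" "x \<noteq> y" and K: "K \<le> 16"
    using Cons.prems wf_tableD(1)[OF wf] by (auto simp: p flat_simps)
  have IH: "follow t ps c u < K" "contracts e (map (map_prod h h) ps) c (h u) = h (follow t ps c u)"
    if "u < K" "follow t ps c u \<noteq> 16" for u
    using Cons.IH[of u] that Cons.prems by (auto simp: p flat_simps)
  have inj: "h i = h j \<longleftrightarrow> i = j" if "i < K" "j < K" for i j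
    using occ that by (auto simp: occurs_def inj_on_def)
  show ?case
    using Cons.prems IH[of v] IH[OF xy(1)] IH[OF xy(2)] xy K inj
    by (auto simp: p contract_def split: if_splits)
qed

text \<open>Only an inequality, because unknown entries may hide further edges between the two
  vertices of a pair.\<close>

lemma score_le_gain:
  assumes wf: "wf_table K t" and occ: "occurs V e K t h"
    and "list_all (\<lambda>v. v < K) (flat ps)" "distinct (flat ps)"
  shows "score t ps \<le> gain e (map (map_prod h h) ps)"
  using assms(3-)
proof (induction ps)
  case (Cons p ps)
  obtain x y where p: "p = (x, y)" by force
  have "y \<noteq> 16" using Cons.prems wf_tableD(1)[OF wf] by (auto simp: p flat_simps)
  then have "contracts e (map (map_prod h h) ps) c (h x) = h y" if "c < 3" "follow t ps c x = y" for c
    using follow_sound[OF wf occ that(1), of ps x] Cons.prems that by (auto simp: p flat_simps)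
  then have "(if follow t ps c x = y then 1 else 0)
      \<le> (if contracts e (map (map_prod h h) ps) c (h x) = h y then 1 else (0 :: nat))" if "c < 3" for c
    using that by auto
  from this[of 0] this[of 1] this[of 2] Cons show ?case
    by (simp add: p flat_simps mult_eq numeral_3_eq_3 numeral_2_eq_2)
qed simp

lemma flat_map: "flat (map (map_prod h h) ps) = map h (flat ps)"
  by (induction ps) (auto simp: flat_simps)

lemma closes_sound:
  assumes wf: "wf_table K t" and occ: "occurs V e K t h" and "closes n K t ps"
    and inv: "invol_graph V e" and V: "card V = 2 * n"
    and good: "\<And>m. m < n \<Longrightarrow> good TYPE('a) m"
  shows "attains (V :: 'a set) e (target n)"
proof -
  let ?qs = "map (map_prod h h) ps"
  have ps: "ps \<noteq> []" "list_all (\<lambda>v. v < K) (flat ps)" "distinct (flat ps)"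
    and n: "target n \<le> score t ps + target (n - length ps)"
    using assms(3) by (auto simp: closes_def)
  have sub: "set (flat ps) \<subseteq> {..<K}" using ps(2) by (auto simp: list_all_iff)
  have dist: "distinct (flat ?qs)" and qV: "set (flat ?qs) \<subseteq> V"
    using occ ps(3) sub by (auto simp: flat_map distinct_map occurs_def intro: inj_on_subset)
  have "finite V" using inv by (simp add: invol_graph_def)
  have "card (set (flat ?qs)) = 2 * length ps" using dist by (simp add: distinct_card length_flat)
  then have "card (V - set (flat ?qs)) = 2 * (n - length ps)" and "length ps \<le> n"
    using qV V \<open>finite V\<close> card_mono[OF \<open>finite V\<close> qV] by (auto simp: card_Diff_subset)
  then have "attains (V - set (flat ?qs)) (contracts e ?qs) (target (n - length ps))"
    using good[of "n - length ps"] invol_graph_contracts[OF inv dist qV] ps(1)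
    unfolding good_def by (cases "ps") auto
  from attains_contracts[OF dist qV this] show ?thesis
    using n score_le_gain[OF wf occ ps(2,3)] by (auto intro: attains_mono)
qed

lemma nth_link:
  assumes "wf_table K t" "c < 3" "v < 16" "w < 16" "c' < 3" "i < 16"
  shows "link t c v w ! c' ! i =
    (if c' = c then (if i = w then v else if i = v then w else t ! c ! i) else t ! c' ! i)"
  using assms wf_tableD[OF assms(1)] by (simp add: link_def nth_list_update)

lemma wf_link:
  assumes wf: "wf_table K t" and "c < 3" "v < K" "t ! c ! v = 16" "w < L" "w \<noteq> v" "t ! c ! w = 16"
    and "K \<le> L" "L \<le> 16"
  shows "wf_table L (link t c v w)"
proof -
  have "length (link t c v w) = 3" "c' < 3 \<Longrightarrow> length (link t c v w ! c') = 16" for c'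
    using wf_tableD(2,3)[OF wf] assms(2) by (cases "c' = c"; simp add: link_def)+
  moreover have "i < L \<and> link t c v w ! c' ! i < L \<and> link t c v w ! c' ! (link t c v w ! c' ! i) = i"
    if "c' < 3" "i < 16" "link t c v w ! c' ! i \<noteq> 16" for c' i
  proof -
    have nl: "link t c v w ! c' ! j =
       (if c' = c then (if j = w then v else if j = v then w else t ! c ! j) else t ! c' ! j)"
      if "j < 16" for j
      using nth_link[OF wf] assms that \<open>c' < 3\<close> by simp
    have old: "i < L \<and> t ! c' ! i < L \<and> t ! c' ! i < 16 \<and> t ! c' ! (t ! c' ! i) = i" if "t ! c' ! i \<noteq> 16"
      using wf_tableD[OF wf] \<open>c' < 3\<close> \<open>i < 16\<close> that assms by fastforce
    show ?thesis
      using nl[OF \<open>i < 16\<close>] nl[of "t ! c' ! i"] nl[of v] nl[of w] old that assms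
      by (auto split: if_splits)
  qed
  ultimately show ?thesis using assms by (auto simp: wf_table_iff)
qed

text \<open>The true neighbour of \<open>h v\<close> either carries a label already or can be given
  the label \<open>K\<close>. In both cases it is among the candidates, so a split that treats all
  candidates is exhaustive.\<close>

lemma split_cases:
  assumes wf: "wf_table K t" and occ: "occurs V e K t h"
    and inv: "invol_graph V e" and V: "card V = 2 * n" "n \<le> 8"
    and cv: "c < 3" "v < K" "t ! c ! v = 16"
  obtains w h' where "w \<in> set (candidates (2 * n) K (t ! c) v labels)"
    and "wf_table (if w = K then K + 1 else K) (link t c v w)"
    and "occurs V e (if w = K then K + 1 else K) (link t c v w) h'"
    and "\<And>i. i < K \<Longrightarrow> h' i = h i"
proof -
  have fin: "finite V" using inv by (simp add: invol_graph_def)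
  have inj: "inj_on h {..<K}" and hV: "h ` {..<K} \<subseteq> V"
    and he: "\<And>c i. c < 3 \<Longrightarrow> i < K \<Longrightarrow> t ! c ! i \<noteq> 16 \<Longrightarrow> e c (h i) = h (t ! c ! i)"
    using occ by (auto simp: occurs_def)
  have K: "K \<le> 16" "K \<le> 2 * n" using wf_tableD(1)[OF wf] card_mono[OF fin hV] inj V by (auto simp: card_image)
  have cand: "w \<in> set (candidates (2 * n) K (t ! c) v labels) \<longleftrightarrow>
      w \<noteq> v \<and> w \<le> K \<and> w < 2 * n \<and> t ! c ! w = 16" if "w < 16" for w
    using that nth_labels[OF that] length_labels by (auto simp: candidates_def in_set_conv_nth)
  have hv: "h v \<in> V" using hV cv by auto
  note ev = invol_graphD[OF inv cv(1) hv]
  show thesis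
  proof (cases "e c (h v) \<in> h ` {..<K}")
    case True
    then obtain w where w: "w < K" "e c (h v) = h w" by auto
    have wv: "w \<noteq> v" using ev w by auto
    have t16: "t ! c ! w = 16"
    proof (rule ccontr)
      \<comment> \<open>A known partner of \<open>w\<close> would be \<open>v\<close> by injectivity
        of \<open>h\<close>, but the entry at \<open>v\<close> is still unknown.\<close>
      assume *: "t ! c ! w \<noteq> 16"
      then have "h (t ! c ! w) = h v" using he[OF cv(1) w(1) *] w ev by simp
      then have "t ! c ! w = v"
        using inj wf_tableD(5)[OF wf cv(1) _ *] w(1) K cv(2) by (auto simp: inj_on_def)
      with wf_tableD(6)[OF wf cv(1) _ *] w(1) K cv(3) show False by auto
    qed
    show thesis
    proof (rule that[of w h])
      show "w \<in> set (candidates (2 * n) K (t ! c) v labels)" using cand w K wv t16 by auto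
      show "wf_table (if w = K then K + 1 else K) (link t c v w)"
        using wf_link[OF wf cv _ wv t16, of K] w K by simp
      show "occurs V e (if w = K then K + 1 else K) (link t c v w) h"
        using nth_link[OF wf cv(1), of v w] w cv K he inj hV ev(3) by (auto simp: occurs_def)
    qed simp
  next
    case False
    \<comment> \<open>A vertex without label exists, so fewer than \<open>2 * n\<close> labels are
      in use and \<open>K\<close> is a legal candidate.\<close>
    have "h ` {..<K} \<noteq> V" using False ev(1) by auto
    then have "card (h ` {..<K}) < card V" using hV fin by (intro psubset_card_mono) auto
    then have Kn: "K < 2 * n" "K < 16" using inj V by (auto simp: card_image)
    have t16: "t ! c ! K = 16" using wf_tableD(4)[OF wf cv(1) Kn(2)] by auto
    define h' where "h' = h(K := e c (h v))"
    have h': "h' i = h i" if "i < K" for i using that by (auto simp: h'_def)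
    show thesis
    proof (rule that[of K h'])
      show "K \<in> set (candidates (2 * n) K (t ! c) v labels)" using cand Kn cv t16 by auto
      show "wf_table (if K = K then K + 1 else K) (link t c v K)"
        using wf_link[OF wf cv _ _ t16, of "K + 1"] cv Kn by simp
      have "inj_on h' {..<K + 1}"
        using inj False unfolding h'_def inj_on_def by (auto simp: less_Suc_eq image_iff dest: sym)
      moreover have "h' ` {..<K + 1} \<subseteq> V" using hV ev(1) by (auto simp: h'_def less_Suc_eq)
      moreover have "e c' (h' i) = h' (link t c v K ! c' ! i)"
        if "c' < 3" "i < K + 1" "link t c v K ! c' ! i \<noteq> 16" for c' i
      proof -
        have nl: "link t c v K ! c' ! i =
           (if c' = c then (if i = K then v else if i = v then K else t ! c ! i) else t ! c' ! i)"
          using nth_link[OF wf cv(1), of v K c' i] that cv Kn by simp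
        have old: "i < K \<and> t ! c' ! i < K" if "t ! c' ! i \<noteq> 16"
          using wf_tableD(4,5)[OF wf \<open>c' < 3\<close> _ that] \<open>i < K + 1\<close> Kn by auto
        show ?thesis
          using nl old that he cv ev h' by (auto simp: h'_def split: if_splits)
      qed
      ultimately show "occurs V e (if K = K then K + 1 else K) (link t c v K) h'"
        by (simp add: occurs_def)
    qed (rule h')
  qed
qed

text \<open>Composing the labelling of the table with the label map \<open>m\<close> gives an
  occurrence of the cited pattern in the recoloured graph. A known entry of the pattern is mapped to
  a label below \<open>K\<close>, hence to a known entry of the table.\<close>

lemma embeds_sound:
  assumes "embeds P K t m s" and wf: "wf_table K t" and occ: "occurs V e K t h"
    and wfP: "wf_table (fst P) (snd P)"
  shows "bij_betw (\<lambda>c. s ! c) {..<3} {..<3}"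
    and "occurs V (e \<circ> (\<lambda>c. s ! c)) (fst P) (snd P) (h \<circ> (\<lambda>i. m ! i))"
proof -
  have m: "length m = 16" "distinct (take (fst P) m)" "list_all (\<lambda>v. v < K) (take (fst P) m)"
    and s: "s \<in> {[0, 1, 2], [0, 2, 1], [1, 0, 2], [1, 2, 0], [2, 0, 1], [2, 1, 0]}"
    using assms(1) by (auto simp: embeds_def)
  have P: "fst P \<le> 16" using wf_tableD(1)[OF wfP] .
  have three: "{..<3::nat} = {0, 1, 2}" by auto
  have s_image: "(\<lambda>c. s ! c) ` {..<3} = {..<3}" unfolding three using s by (elim insertE) auto
  then have s3: "s ! c < 3" if "c < 3" for c using that by blast
  from s_image show "bij_betw (\<lambda>c. s ! c) {..<3} {..<3}"
    by (simp add: bij_betw_def eq_card_imp_inj_on)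
  have mK: "m ! i < K" if "i < fst P" for i
    using m that P by (auto simp: list_all_length)
  have minj: "i = j" if "i < fst P" "j < fst P" "m ! i = m ! j" for i j
    using m that P by (auto simp: distinct_conv_nth)
  have row: "row_embeds m (t ! (s ! c)) m (snd P ! c)" if "c < 3" for c
    using assms(1) that by (auto simp: embeds_def less_3_cases)
  have e: "t ! (s ! c) ! (m ! i) = m ! (snd P ! c ! i)"
    if "c < 3" "i < fst P" "snd P ! c ! i \<noteq> 16" for c i
  proof -
    have "i < length m" using that(2) P m(1) by simp
    then show ?thesis
      using row[OF that(1)] that(3) unfolding row_embeds_def list_all2_conv_all_nth by blast
  qed
  have "e (s ! c) (h (m ! i)) = h (m ! (snd P ! c ! i))"
    if c: "c < 3" and i: "i < fst P" and ne: "snd P ! c ! i \<noteq> 16" for c i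
  proof -
    have "m ! (snd P ! c ! i) < K" using mK wf_tableD(5)[OF wfP c _ ne] i P by simp
    then have "t ! (s ! c) ! (m ! i) \<noteq> 16" using e[OF c i ne] wf_tableD(1)[OF wf] by simp
    with e[OF c i ne] occ s3[OF c] mK[OF i] show ?thesis by (auto simp: occurs_def)
  qed
  moreover have "inj_on (h \<circ> (\<lambda>i. m ! i)) {..<fst P}"
    using occ mK minj by (auto simp: occurs_def inj_on_def)
  ultimately show "occurs V (e \<circ> (\<lambda>c. s ! c)) (fst P) (snd P) (h \<circ> (\<lambda>i. m ! i))"
    using occ mK by (auto simp: occurs_def)
qed

lemma checks_member:
  "\<lbrakk>checks n S K t c v ws xs; w \<in> set ws\<rbrakk>
    \<Longrightarrow> \<exists>x\<in>set xs. check n S (if w = K then K + 1 else K) (link t c v w) x"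
proof (induction ws arbitrary: xs)
  case (Cons u ws)
  then show ?case by (cases xs) auto
qed simp

text \<open>Induction on the certificate with table and labelling left arbitrary, since a split
  extends both. The bound \<open>n \<le> 8\<close> reflects that only 16 labels exist.\<close>

lemma check_sound:
  fixes V :: "'a set"
  assumes inv: "invol_graph V e" and V: "card V = 2 * n" "n \<le> 8"
    and good: "\<And>m. m < n \<Longrightarrow> good TYPE('a) m"
    and "check n (solved TYPE('a) b n) K t x" "wf_table K t" "occurs V e K t h"
  shows "attains V e (target n) \<or> b \<and> exceptional V e"
  using assms(5-)
proof (induction x arbitrary: K t h)
  case (Close ps)
  then show ?case using closes_sound[OF _ _ _ inv V(1) good] by auto
next
  case (Split c v xs)
  from Split.prems have cv: "c < 3" "v < K" "t ! c ! v = 16"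
    and xs: "checks n (solved TYPE('a) b n) K t c v (candidates (2 * n) K (t ! c) v labels) xs"
    by auto
  obtain w h' where "w \<in> set (candidates (2 * n) K (t ! c) v labels)"
    and "wf_table (if w = K then K + 1 else K) (link t c v w)"
    and "occurs V e (if w = K then K + 1 else K) (link t c v w) h'"
    using split_cases[OF Split.prems(2,3) inv V cv] .
  with checks_member[OF xs] Split.IH show ?case by blast
next
  case (Ref P m s)
  then have P: "solved TYPE('a) b n P" and emb: "embeds P K t m s" by auto
  have \<sigma>: "bij_betw (\<lambda>c. s ! c) {..<3} {..<3}"
    and occ: "occurs V (e \<circ> (\<lambda>c. s ! c)) (fst P) (snd P) (h \<circ> (\<lambda>i. m ! i))"
    using embeds_sound[OF emb Ref.prems(2,3)] P by (auto simp: solved_def)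
  from solvedD[OF P good invol_graph_permute[OF \<sigma> inv] V(1) occ] show ?case
    using attains_permute[OF \<sigma>] exceptional_permute[OF \<sigma>] by blast
qed

text \<open>The test for cited patterns is instantiated with \<open>solved\<close> itself, so that a
  reference is discharged by an earlier theorem instead of a repeated search.\<close>

lemma solvedI:
  assumes "wf_table (fst P) (snd P)" and "n \<le> 8"
    and "check n (solved TYPE('a) b n) (fst P) (snd P) x"
  shows "solved TYPE('a) b n P"
  using assms check_sound[where 'a = 'a and b = b and x = x] unfolding solved_def[of _ b n P] by blast

section \<open>Evaluation of certificates and starting patterns\<close>

definition exceptional_pattern :: pattern where
  "exceptional_pattern = (16, exceptional_table)"

text \<open>Certificates are evaluated by the simplifier.  The congruence rules below keep it from
  descending into tables and certificates that are already in normal form, and \<open>bypass\<close> makes it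
  evaluate each look-up only once.\<close>

definition bypass :: "nat list list \<Rightarrow> (nat \<times> nat) list \<Rightarrow> nat \<Rightarrow> nat \<Rightarrow> nat \<Rightarrow> nat \<Rightarrow> nat" where
  "bypass t ps c x y w = (if w = x then follow t ps c y else if w = y then follow t ps c x else w)"

lemma follow_eval:
  "follow t [] c v = t ! c ! v"
  "follow t ((x, y) # ps) c v = bypass t ps c x y (follow t ps c v)"
  by (simp_all add: bypass_def)

lemma candidates_eval:
  "candidates N K r v [] = []"
  "candidates N K r v (w # ws) =
    (if w \<noteq> v \<and> w \<le> K \<and> w < N \<and> r ! w = 16 then w # candidates N K r v ws
     else candidates N K r v ws)"
  by (simp_all add: candidates_def)

lemma row_embeds_eval:
  "row_embeds m r [] [] \<longleftrightarrow> True"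
  "row_embeds m r (x # xs) (y # ys) \<longleftrightarrow> (y = 16 \<or> r ! x = m ! y) \<and> row_embeds m r xs ys"
  by (simp_all add: row_embeds_def)

lemma wf_row_eval:
  "wf_row K r [] [] \<longleftrightarrow> True"
  "wf_row K r (i # is) (x # xs) \<longleftrightarrow> (x = 16 \<or> i < K \<and> x < K \<and> r ! x = i) \<and> wf_row K r is xs"
  by (simp_all add: wf_row_def)

lemma list_eval:
  "length [] = 0" "length (x # xs) = 1 + length xs"
  "list_all p [] \<longleftrightarrow> True" "list_all p (x # xs) \<longleftrightarrow> p x \<and> list_all p xs"
  "take 0 xs = []" "take 1 (x # xs) = [x]"
  "take (numeral k) (x # xs) = x # take (pred_numeral k) xs"
  "[][i := y] = []" "(x # xs)[0 := y] = y # xs" "(x # xs)[1 := y] = x # xs[0 := y]"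
  "(x # xs)[numeral k := y] = x # xs[pred_numeral k := y]" for k :: num
  by (simp_all add: numeral_eq_Suc)

lemma nth3: "[x, y, z] ! 0 = x" "[x, y, z] ! 1 = y" "[x, y, z] ! 2 = z"
  by simp_all

lemma nth16:
  "[a, b, c, d, e, f, g, h, i, j, k, l, m, n, p, q] ! 0 = a"
  "[a, b, c, d, e, f, g, h, i, j, k, l, m, n, p, q] ! 1 = b"
  "[a, b, c, d, e, f, g, h, i, j, k, l, m, n, p, q] ! 2 = c"
  "[a, b, c, d, e, f, g, h, i, j, k, l, m, n, p, q] ! 3 = d"
  "[a, b, c, d, e, f, g, h, i, j, k, l, m, n, p, q] ! 4 = e"
  "[a, b, c, d, e, f, g, h, i, j, k, l, m, n, p, q] ! 5 = f"
  "[a, b, c, d, e, f, g, h, i, j, k, l, m, n, p, q] ! 6 = g"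
  "[a, b, c, d, e, f, g, h, i, j, k, l, m, n, p, q] ! 7 = h"
  "[a, b, c, d, e, f, g, h, i, j, k, l, m, n, p, q] ! 8 = i"
  "[a, b, c, d, e, f, g, h, i, j, k, l, m, n, p, q] ! 9 = j"
  "[a, b, c, d, e, f, g, h, i, j, k, l, m, n, p, q] ! 10 = k"
  "[a, b, c, d, e, f, g, h, i, j, k, l, m, n, p, q] ! 11 = l"
  "[a, b, c, d, e, f, g, h, i, j, k, l, m, n, p, q] ! 12 = m"
  "[a, b, c, d, e, f, g, h, i, j, k, l, m, n, p, q] ! 13 = n"
  "[a, b, c, d, e, f, g, h, i, j, k, l, m, n, p, q] ! 14 = p"
  "[a, b, c, d, e, f, g, h, i, j, k, l, m, n, p, q] ! 15 = q"
  by simp_all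

lemma diff_eval:
  "n - n = (0 :: nat)"
  "8 - 1 = (7 :: nat)" "8 - 2 = (6 :: nat)" "8 - 4 = (4 :: nat)" "8 - 6 = (2 :: nat)" "8 - 7 = (1 :: nat)"
  "6 - 1 = (5 :: nat)" "6 - 2 = (4 :: nat)" "6 - 4 = (2 :: nat)" "6 - 5 = (1 :: nat)"
  "4 - 1 = (3 :: nat)" "4 - 2 = (2 :: nat)" "4 - 3 = (1 :: nat)"
  by simp_all

text \<open>Besides the evaluation rules this collects the patterns and their \<open>solved\<close>
  facts, so that checking a \<open>Ref\<close> also looks up the result it cites.\<close>

named_theorems cert_simps

lemmas [cert_simps] =
  check.simps checks.simps closes_def embeds_def follow_eval bypass_def score.simps flat_simps
  link_def candidates_eval row_embeds_eval wf_table_def wf_row_eval labels_def target_eval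
  nth3 nth16 list_eval diff_eval exceptional_table_def exceptional_pattern_def
  fst_conv snd_conv list.distinct distinct.simps list.set insert_iff empty_iff
  if_True if_False simp_thms pred_numeral_simps BitM.simps numeral_One
  num.distinct num.inject numeral_eq_iff numeral_eq_one_iff one_eq_numeral_iff
  zero_neq_numeral numeral_neq_zero zero_neq_one one_neq_zero
  numeral_less_iff numeral_le_iff one_less_numeral_iff not_numeral_less_one not_numeral_less_zero
  zero_less_numeral zero_less_one numeral_le_one_iff one_le_numeral not_numeral_le_zero
  zero_le_numeral zero_le_one not_one_le_zero not_one_less_zero order_refl less_irrefl
  le_num_simps less_num_simps add_0 add_0_right add_numeral_special numeral_plus_numeral one_add_one
  add_num_simps mult_num_simps numeral_times_numeral

lemma cert_congs:
  "b = b' \<Longrightarrow> (if b then u else v) = (if b' then u else v)"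
  "c = c' \<Longrightarrow> i = i' \<Longrightarrow> follow t ps c i = follow t ps c' i'"
  "w = w' \<Longrightarrow> bypass t ps c x y w = bypass t ps c x y w'"
  "score t ps = score t ps"
  "N = N' \<Longrightarrow> r = r' \<Longrightarrow> ws = ws' \<Longrightarrow> candidates N K r i ws = candidates N' K r' i ws'"
  "K = K' \<Longrightarrow> t = t' \<Longrightarrow> check n S K t cert = check n S K' t' cert"
  "ws = ws' \<Longrightarrow> checks n S K t c i ws certs = checks n S K t c i ws' certs"
  "solved T flag n P = solved T flag n P"
  "r = r' \<Longrightarrow> ys = ys' \<Longrightarrow> row_embeds m r xs ys = row_embeds m r' xs ys'"
  "xs = ys \<Longrightarrow> is = js \<Longrightarrow> wf_row K r is xs = wf_row K r js ys"
  by simp_all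

text \<open>All 16 labels are used and all entries are known, so an occurrence is already an
  isomorphism up to colours; nothing is contracted.\<close>

lemma solved_exceptional_pattern [cert_simps]: "solved TYPE('a) True 8 exceptional_pattern"
proof -
  have wf: "wf_table 16 exceptional_table"
    by (simp only: cert_simps cong: cert_congs)
  have "exceptional V e"
    if "invol_graph (V :: 'a set) e" "card V = 16" "occurs V e 16 exceptional_table h" for V e h
  proof -
    have occ: "inj_on h {..<16}" "h ` {..<16} \<subseteq> V"
        "\<And>c i. c < 3 \<Longrightarrow> i < 16 \<Longrightarrow> exceptional_table ! c ! i \<noteq> 16 \<Longrightarrow>
          e c (h i) = h (exceptional_table ! c ! i)"
      using that(3) by (auto simp: occurs_def)
    have "finite V" using that(1) by (simp add: invol_graph_def)
    then have "h ` {..<16} = V" using occ(1,2) that(2) by (simp add: card_subset_eq card_image)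
    with occ(1) have "bij_betw h {..<16} V" by (simp add: bij_betw_def)
    moreover have "exceptional_table ! c ! i \<noteq> 16" if "c < 3" "i < 16" for c i
    proof -
      have "\<forall>c<3. \<forall>x\<in>set (exceptional_table ! c). x \<noteq> 16"
        by (simp add: less_3_cases exceptional_table_def)
      then show ?thesis using wf_tableD(3)[OF wf that(1)] that nth_mem by metis
    qed
    ultimately show ?thesis
      unfolding exceptional_def using occ(3) by (intro exI[of _ "\<lambda>c. c"] exI[of _ h]) (auto simp: bij_betw_def)
  qed
  with wf show ?thesis by (auto simp: solved_def exceptional_pattern_def)
qed

text \<open>No edge is known, so this pattern occurs at every vertex of every graph.\<close>

definition vertex_pattern :: pattern where [cert_simps]:
  "vertex_pattern = (1,
    [[16,16,16,16,16,16,16,16,16,16,16,16,16,16,16,16],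
     [16,16,16,16,16,16,16,16,16,16,16,16,16,16,16,16],
     [16,16,16,16,16,16,16,16,16,16,16,16,16,16,16,16]])"

definition hexagon_pattern :: pattern where [cert_simps]:
  "hexagon_pattern = (6,
    [[1,0,3,2,5,4,16,16,16,16,16,16,16,16,16,16],
     [5,2,1,4,3,0,16,16,16,16,16,16,16,16,16,16],
     [16,16,16,16,16,16,16,16,16,16,16,16,16,16,16,16]])"

definition octagon_pattern :: pattern where [cert_simps]:
  "octagon_pattern = (8,
    [[1,0,3,2,5,4,7,6,16,16,16,16,16,16,16,16],
     [7,2,1,4,3,6,5,0,16,16,16,16,16,16,16,16],
     [16,16,16,16,16,16,16,16,16,16,16,16,16,16,16,16]])"

section \<open>The certificates\<close>

definition vertex4_1 :: pattern where [cert_simps]: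
  "vertex4_1 = (8,
    [[1,0,3,2,5,4,7,6,16,16,16,16,16,16,16,16],
     [2,4,0,6,1,16,3,16,16,16,16,16,16,16,16,16],
     [3,16,16,0,16,16,16,16,16,16,16,16,16,16,16,16]])"

lemma solved_vertex4_1 [cert_simps]: "solved TYPE('a) False 4 vertex4_1"
  by (rule solvedI[where x = "Split 2 1 [Close [(2,3),(0,1)], Close [(1,4)], Close
  [(3,5),(2,4),(0,1)], Close [(3,6),(0,1)], Close [(3,6),(1,7),(0,2)]]"])
    (simp_all only: cert_simps cong: cert_congs)

text \<open>Colours 0 and 1 are followed in both directions from vertex 0. A double edge gains 2. A
  4-cycle gains 3: two opposite edges share a colour, and contracting a third edge doubles the
  fourth. A hexagon gains 4, which suffices here because \<open>target 1 = 3\<close>. There remains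
  a single 8-cycle in colours 0 and 1, treated by its colour-2 chord at 0.\<close>

lemma solved_vertex4 [cert_simps]: "solved TYPE('a) False 4 vertex_pattern"
  by (rule solvedI[where x = "Split 0 0 [Split 1 0 [Close [(0,1)], Split 0 2 [Split 1 1 [Close
  [(2,3),(0,1)], Split 0 4 [Split 1 3 [Close [(4,5),(2,3),(0,1)], Split 0 6 [Split 2 0 [Close [(0,1)], Close
  [(0,2)], Ref vertex4_1 labels [0,1,2], Split 1 5 [Ref vertex4_1 [4,5,1,0,7,6,2,3,16,16,16,16,16,16,16,16]
  [0,1,2]], Close [(1,4),(0,5)], Close [(2,3),(0,6)], Split 2 3 [Close [(1,3),(0,2)], Close [(2,3)], Close
  [(3,4),(1,6),(0,7)], Close [(3,5),(2,4),(0,1)], Close [(3,6)]]]]]]]]]]"])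
    (simp_all only: cert_simps cong: cert_congs)

section \<open>Hexagonal faces on 12 vertices\<close>

definition hex6_1 :: pattern where [cert_simps]:
  "hex6_1 = (12,
    [[1,0,3,2,5,4,7,6,9,8,11,10,16,16,16,16],
     [5,2,1,4,3,0,8,10,6,16,7,16,16,16,16,16],
     [2,6,0,16,16,16,1,16,16,16,16,16,16,16,16,16]])"

text \<open>The outer vertices form a second hexagon, since the missing colour-1 edge can only join
  9 and 11.\<close>

lemma solved_hex6_1 [cert_simps]: "solved TYPE('a) False 6 hex6_1"
  by (rule solvedI[where x = "Split 2 3 [Close [(3,4)], Close [(2,3),(0,5)], Close
  [(6,7),(4,5),(2,3),(0,1)], Close [(6,8),(4,5),(2,3),(0,1)], Split 2 5 [Close [(4,5)], Close
  [(6,7),(3,4),(2,5),(0,1)], Close [(6,8),(3,4),(2,5),(0,1)], Close [(5,10),(3,9),(2,8),(0,7),(1,6)], Close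
  [(7,10),(6,11),(3,4),(2,5),(0,1)]], Split 2 7 [Close [(7,10),(3,4)], Close [(6,7),(3,4),(2,5),(0,1)], Close
  [(8,10),(6,7),(4,5),(2,3),(0,1)], Close [(7,9),(6,8)], Close [(10,11),(6,7),(4,5),(2,3),(0,1)]], Close
  [(7,10),(6,11),(4,5),(2,3),(0,1)]]"])
    (simp_all only: cert_simps cong: cert_congs)

definition hex6_2 :: pattern where [cert_simps]:
  "hex6_2 = (6,
    [[1,0,3,2,5,4,16,16,16,16,16,16,16,16,16,16],
     [5,2,1,4,3,0,16,16,16,16,16,16,16,16,16,16],
     [2,16,0,16,16,16,16,16,16,16,16,16,16,16,16,16]])"

text \<open>Beside the chord 0-2, any chord at 1 produces a 4-cycle, so the colour-2 edge at 1
  leaves the hexagon.\<close>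

lemma solved_hex6_2 [cert_simps]: "solved TYPE('a) False 6 hex6_2"
  by (rule solvedI[where x = "Split 2 1 [Close [(2,3),(0,1)], Close [(1,4),(0,5)], Close
  [(2,5),(0,1)], Split 0 6 [Split 1 6 [Close [(6,7)], Split 0 8 [Split 1 7 [Close [(8,9),(6,7)], Split 0 10
  [Ref hex6_1 labels [0,1,2]]]]]]]"])
    (simp_all only: cert_simps cong: cert_congs)

text \<open>Two hexagons, with 0 and 1 attached to vertices at distance 2 along 6, 8, 9; at distance
  1 there would be a 4-cycle.\<close>

definition hex6_3 :: pattern where [cert_simps]:
  "hex6_3 = (12,
    [[1,0,3,2,5,4,7,6,9,8,11,10,16,16,16,16],
     [5,2,1,4,3,0,8,10,6,11,7,9,16,16,16,16],
     [6,9,16,16,16,16,0,16,16,1,16,16,16,16,16,16]])"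

lemma solved_hex6_3 [cert_simps]: "solved TYPE('a) False 6 hex6_3"
  by (rule solvedI[where x = "Split 2 7 [Close [(10,11),(7,9),(6,8),(1,2)], Close
  [(6,7),(4,5),(0,3),(1,2)], Close [(7,9),(6,8),(2,3),(1,4),(0,5)], Close [(6,7),(0,5)], Close
  [(10,11),(8,9),(6,7),(0,1)], Close [(7,10)], Close [(9,11),(8,10),(6,7),(0,1)]]"])
    (simp_all only: cert_simps cong: cert_congs)

text \<open>A chord of length 3 at 0 makes a 4-cycle, and one of length 2 is \<open>hex6_2\<close>.
  Otherwise 0 is attached outside, the outer vertices form a second hexagon, and the reflection
  exchanging 0 and 1 pairs up the cases for the edge at 1.\<close>

lemma solved_hexagon6 [cert_simps]: "solved TYPE('a) False 6 hexagon_pattern"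
  by (rule solvedI[where x = "Split 2 0 [Close [(0,1)], Ref hex6_2 labels [0,1,2], Close
  [(1,2),(0,3)], Ref hex6_2 [4,5,0,1,2,3,16,16,16,16,16,16,16,16,16,16] [0,1,2], Close [(0,5)], Split 0 6
  [Split 1 6 [Close [(6,7)], Split 0 8 [Split 1 7 [Close [(8,9),(6,7)], Split 0 10 [Split 1 9 [Split 2 1
  [Close [(1,2)], Ref hex6_2 [3,2,1,0,5,4,16,16,16,16,16,16,16,16,16,16] [0,1,2], Close [(1,4),(0,5)], Ref
  hex6_1 [1,0,5,4,3,2,6,7,8,9,10,11,16,16,16,16] [0,1,2], Close [(6,7),(0,1)], Close [(6,8),(0,1)], Ref hex6_3
  labels [0,1,2], Ref hex6_3 [1,0,5,4,3,2,10,11,7,6,9,8,16,16,16,16] [0,1,2], Close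
  [(8,9),(7,10),(6,11),(0,1)]]]]]]]]]"])
    (simp_all only: cert_simps cong: cert_congs)

section \<open>Graphs on 12 vertices\<close>

definition vertex6_1 :: pattern where [cert_simps]:
  "vertex6_1 = (8,
    [[1,0,3,2,5,4,7,6,16,16,16,16,16,16,16,16],
     [2,4,0,6,1,7,3,5,16,16,16,16,16,16,16,16],
     [3,16,16,0,16,16,16,16,16,16,16,16,16,16,16,16]])"

lemma solved_vertex6_1 [cert_simps]: "solved TYPE('a) False 6 vertex6_1"
  by (rule solvedI[where x = "Split 2 1 [Close [(2,3),(0,1)], Close [(1,4)], Close
  [(6,7),(3,5),(2,4),(0,1)], Close [(3,6),(0,1)], Close [(4,5),(1,7)], Split 0 8 [Split 1 8 [Close [(8,9)],
  Split 0 10 [Split 1 9 [Close [(10,11),(8,9)]]]]]]"])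
    (simp_all only: cert_simps cong: cert_congs)

definition vertex6_2 :: pattern where [cert_simps]:
  "vertex6_2 = (10,
    [[1,0,3,2,5,4,7,6,9,8,16,16,16,16,16,16],
     [2,4,0,6,1,8,3,9,5,7,16,16,16,16,16,16],
     [3,16,16,0,16,16,16,16,16,16,16,16,16,16,16,16]])"

lemma solved_vertex6_2 [cert_simps]: "solved TYPE('a) False 6 vertex6_2"
  by (rule solvedI[where x = "Split 2 1 [Close [(2,3),(0,1)], Close [(1,4)], Close
  [(8,9),(6,7),(3,5),(2,4),(0,1)], Close [(3,6),(0,1)], Close [(8,9),(4,5),(3,6),(1,7),(0,2)], Close
  [(4,5),(1,8)], Close [(6,7),(5,8),(3,9),(2,4),(0,1)], Split 0 10 [Split 1 10 [Close [(10,11)]]]]"])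
    (simp_all only: cert_simps cong: cert_congs)

definition vertex6_3 :: pattern where [cert_simps]:
  "vertex6_3 = (10,
    [[1,0,3,2,5,4,7,6,9,8,16,16,16,16,16,16],
     [2,4,0,6,1,8,3,9,5,7,16,16,16,16,16,16],
     [7,16,16,16,16,16,16,0,16,16,16,16,16,16,16,16]])"

lemma solved_vertex6_3 [cert_simps]: "solved TYPE('a) False 6 vertex6_3"
  by (rule solvedI[where x = "Split 2 1 [Close [(8,9),(4,5),(3,6),(2,7),(0,1)], Close
  [(1,3),(0,2)], Close [(1,4)], Close [(8,9),(5,7),(4,6),(2,3),(0,1)], Close [(6,7),(0,1)], Close
  [(4,5),(1,8)], Close [(7,9),(0,1)], Split 0 10 [Split 1 10 [Close [(10,11)]]]]"])
    (simp_all only: cert_simps cong: cert_congs)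

definition vertex6_4 :: pattern where [cert_simps]:
  "vertex6_4 = (12,
    [[1,0,3,2,5,4,7,6,9,8,11,10,16,16,16,16],
     [2,4,0,6,1,8,3,10,5,11,7,9,16,16,16,16],
     [3,5,16,0,6,1,4,16,16,16,16,16,16,16,16,16]])"

lemma solved_vertex6_4 [cert_simps]: "solved TYPE('a) False 6 vertex6_4"
  by (rule solvedI[where x = "Split 2 2 [Close [(3,6),(2,7)], Close [(5,8),(4,6),(2,3),(0,1)],
  Split 2 7 [Close [(8,9),(5,7),(4,6),(2,3),(0,1)], Close [(7,10)], Close [(9,11),(5,7),(4,6),(2,3),(0,1)]],
  Split 2 7 [Close [(8,10),(5,7),(4,6),(2,3),(0,1)], Close [(10,11),(7,9)], Close
  [(10,11),(5,7),(4,6),(2,3),(0,1)]], Close [(7,10),(5,11),(4,6),(2,3),(0,1)]]"])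
    (simp_all only: cert_simps cong: cert_congs)

definition vertex6_5 :: pattern where [cert_simps]:
  "vertex6_5 = (12,
    [[1,0,3,2,5,4,7,6,9,8,11,10,16,16,16,16],
     [2,4,0,6,1,8,3,10,5,11,7,9,16,16,16,16],
     [3,7,16,0,8,16,16,1,4,16,16,16,16,16,16,16]])"

lemma solved_vertex6_5 [cert_simps]: "solved TYPE('a) False 6 vertex6_5"
  by (rule solvedI[where x = "Split 2 10 [Split 2 5 [Close [(7,10),(6,8),(4,5),(2,3),(0,1)],
  Close [(8,9),(4,5)], Close [(8,9),(5,11)]], Close [(9,11),(8,10),(4,5),(1,7)], Ref vertex6_4
  [3,6,2,0,7,10,1,4,11,9,5,8,16,16,16,16] [1,0,2], Close [(8,9),(5,11),(4,10),(1,7)], Close [(10,11)]]"])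
    (simp_all only: cert_simps cong: cert_congs)

definition vertex6_6 :: pattern where [cert_simps]:
  "vertex6_6 = (12,
    [[1,0,3,2,5,4,7,6,9,8,11,10,16,16,16,16],
     [2,4,0,6,1,8,3,10,5,11,7,9,16,16,16,16],
     [3,7,16,0,16,16,16,1,16,16,16,16,16,16,16,16]])"

lemma solved_vertex6_6 [cert_simps]: "solved TYPE('a) False 6 vertex6_6"
  by (rule solvedI[where x = "Split 2 4 [Close [(2,4),(0,1)], Close [(4,5)], Close
  [(6,7),(1,4)], Ref vertex6_5 labels [0,1,2], Close [(5,8),(4,9)], Close [(7,10),(1,4)], Split 2 10 [Split 2
  5 [Close [(6,11),(7,10),(4,5),(2,3),(0,1)], Close [(5,8)], Close [(9,11),(4,5)]], Close [(10,11),(4,5)], Ref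
  vertex6_4 [3,6,2,0,7,10,1,4,11,9,5,8,16,16,16,16] [1,0,2], Close [(9,11),(8,10)], Close
  [(9,11),(5,8),(4,10),(1,7)]]]"])
    (simp_all only: cert_simps cong: cert_congs)

definition vertex6_7 :: pattern where [cert_simps]:
  "vertex6_7 = (12,
    [[1,0,3,2,5,4,7,6,9,8,11,10,16,16,16,16],
     [2,4,0,6,1,8,3,10,5,11,7,9,16,16,16,16],
     [3,9,16,0,16,16,16,16,16,1,16,16,16,16,16,16]])"

lemma solved_vertex6_7 [cert_simps]: "solved TYPE('a) False 6 vertex6_7"
  by (rule solvedI[where x = "Split 2 4 [Close [(2,4),(0,1)], Close [(4,5)], Ref vertex6_6
  [3,6,2,0,7,10,1,4,11,9,5,8,16,16,16,16] [1,0,2], Split 2 5 [Close [(7,9),(6,8),(3,5),(1,4),(0,2)], Close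
  [(6,7),(4,5)], Close [(5,8)], Close [(7,10),(4,5)], Close [(8,9),(5,11)]], Close [(8,9),(1,4)], Split 2 7
  [Close [(3,6),(2,7)], Close [(7,10),(4,5)], Close [(6,7)], Close [(8,9),(5,11),(1,7),(4,10)], Close
  [(9,11),(5,8),(1,7),(4,10)]], Close [(9,11),(1,4)]]"])
    (simp_all only: cert_simps cong: cert_congs)

definition vertex6_8 :: pattern where [cert_simps]:
  "vertex6_8 = (12,
    [[1,0,3,2,5,4,7,6,9,8,11,10,16,16,16,16],
     [2,4,0,6,1,8,3,10,5,11,7,9,16,16,16,16],
     [3,10,16,0,16,16,16,16,16,16,1,16,16,16,16,16]])"

lemma solved_vertex6_8 [cert_simps]: "solved TYPE('a) False 6 vertex6_8"
  by (rule solvedI[where x = "Split 2 4 [Close [(2,4),(0,1)], Close [(4,5)], Ref vertex6_6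
  [3,6,2,0,7,10,1,4,11,9,5,8,16,16,16,16] [1,0,2], Close [(7,10),(1,4)], Split 2 2 [Close
  [(6,7),(5,8),(3,10),(2,4),(0,1)], Close [(3,6),(0,2)], Close [(3,6),(2,7)], Close
  [(8,9),(6,7),(3,10),(2,4),(0,1)], Close [(6,7),(3,10),(2,11),(0,1)]], Close [(5,8),(4,9)], Close
  [(10,11),(1,4)]]"])
    (simp_all only: cert_simps cong: cert_congs)

definition vertex6_9 :: pattern where [cert_simps]:
  "vertex6_9 = (12,
    [[1,0,3,2,5,4,7,6,9,8,11,10,16,16,16,16],
     [2,4,0,6,1,8,3,10,5,11,7,9,16,16,16,16],
     [3,11,16,0,16,16,16,16,16,16,16,1,16,16,16,16]])"

lemma solved_vertex6_9 [cert_simps]: "solved TYPE('a) False 6 vertex6_9"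
  by (rule solvedI[where x = "Split 2 4 [Close [(2,4),(0,1)], Close [(4,5)], Ref vertex6_6
  [3,6,2,0,7,10,1,4,11,9,5,8,16,16,16,16] [1,0,2], Split 2 5 [Close [(4,5),(3,6),(2,7),(0,10),(1,11)], Close
  [(6,7),(4,5)], Close [(5,8)], Ref vertex6_6 [9,11,8,5,10,7,4,1,6,3,0,2,16,16,16,16] [1,0,2], Close
  [(7,10),(4,5)]], Ref vertex6_5 [4,1,5,8,0,2,9,11,3,6,10,7,16,16,16,16] [1,0,2], Close [(9,11),(1,4)], Close
  [(10,11),(1,4)]]"])
    (simp_all only: cert_simps cong: cert_congs)

text \<open>The 12-cycle in colours 0 and 1 with a chord of length 2; \<open>vertex6_4\<close> to
  \<open>vertex6_9\<close> add a chord at 1. The patterns \<open>vertex6_13\<close> and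
  \<open>vertex6_14\<close> have a chord of length 4 and 5 at 0 instead.\<close>

definition vertex6_10 :: pattern where [cert_simps]:
  "vertex6_10 = (12,
    [[1,0,3,2,5,4,7,6,9,8,11,10,16,16,16,16],
     [2,4,0,6,1,8,3,10,5,11,7,9,16,16,16,16],
     [3,16,16,0,16,16,16,16,16,16,16,16,16,16,16,16]])"

lemma solved_vertex6_10 [cert_simps]: "solved TYPE('a) False 6 vertex6_10"
  by (rule solvedI[where x = "Split 2 1 [Close [(2,3),(0,1)], Close [(1,4)], Split 2 6 [Close
  [(3,6),(0,2)], Ref vertex6_4 labels [0,1,2], Close [(6,7)], Close [(6,8),(3,5),(2,4),(0,1)], Split 2 8 [Ref
  vertex6_4 [1,0,4,5,2,3,8,9,6,7,11,10,16,16,16,16] [0,1,2], Close [(5,8),(1,4)], Close [(8,9),(6,7)], Close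
  [(9,11),(8,10)], Close [(9,11),(6,8),(3,5),(2,4),(0,1)]], Split 2 8 [Ref vertex6_4
  [1,0,4,5,2,3,8,9,6,7,11,10,16,16,16,16] [0,1,2], Close [(5,8),(1,4)], Close
  [(8,10),(6,7),(3,5),(2,4),(0,1)], Close [(8,9)], Close [(10,11),(6,8),(3,5),(2,4),(0,1)]], Close
  [(7,10),(6,11)]], Close [(3,6),(0,1)], Ref vertex6_6 labels [0,1,2], Close [(4,5),(1,8)], Ref vertex6_7
  labels [0,1,2], Ref vertex6_8 labels [0,1,2], Ref vertex6_9 labels [0,1,2]]"])
    (simp_all only: cert_simps cong: cert_congs)

definition vertex6_11 :: pattern where [cert_simps]:
  "vertex6_11 = (12,
    [[1,0,3,2,5,4,7,6,9,8,11,10,16,16,16,16],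
     [2,4,0,6,1,8,3,10,5,11,7,9,16,16,16,16],
     [7,9,16,16,16,16,16,0,16,1,16,16,16,16,16,16]])"

lemma solved_vertex6_11 [cert_simps]: "solved TYPE('a) False 6 vertex6_11"
  by (rule solvedI[where x = "Split 2 6 [Close [(6,7),(0,2)], Close [(3,6)], Close
  [(7,9),(5,8),(4,6),(2,3),(0,1)], Split 2 2 [Close [(2,3)], Close [(2,4),(0,1)], Close
  [(6,7),(2,8),(0,5),(1,4)], Close [(7,10),(0,2)], Close [(3,10),(6,7),(2,11),(0,5),(1,4)]], Close
  [(10,11),(7,9),(6,8),(0,1)], Ref vertex6_10 [10,11,7,6,9,8,3,2,5,4,0,1,16,16,16,16] [0,1,2], Close
  [(7,10),(6,11)]]"])
    (simp_all only: cert_simps cong: cert_congs)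

definition vertex6_12 :: pattern where [cert_simps]:
  "vertex6_12 = (12,
    [[1,0,3,2,5,4,7,6,9,8,11,10,16,16,16,16],
     [2,4,0,6,1,8,3,10,5,11,7,9,16,16,16,16],
     [7,11,16,16,16,16,16,0,16,16,16,1,16,16,16,16]])"

lemma solved_vertex6_12 [cert_simps]: "solved TYPE('a) False 6 vertex6_12"
  by (rule solvedI[where x = "Split 2 10 [Close [(7,10),(0,2)], Close [(6,7),(3,10)], Close
  [(10,11),(1,4)], Ref vertex6_11 [7,10,6,3,11,9,2,0,8,5,1,4,16,16,16,16] [1,0,2], Close
  [(6,10),(2,3),(1,11),(0,7)], Close [(9,11),(8,10)], Ref vertex6_7 [10,7,11,9,6,3,8,5,2,0,4,1,16,16,16,16]
  [1,0,2]]"])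
    (simp_all only: cert_simps cong: cert_congs)

definition vertex6_13 :: pattern where [cert_simps]:
  "vertex6_13 = (12,
    [[1,0,3,2,5,4,7,6,9,8,11,10,16,16,16,16],
     [2,4,0,6,1,8,3,10,5,11,7,9,16,16,16,16],
     [7,16,16,16,16,16,16,0,16,16,16,16,16,16,16,16]])"

lemma solved_vertex6_13 [cert_simps]: "solved TYPE('a) False 6 vertex6_13"
  by (rule solvedI[where x = "Split 2 1 [Ref vertex6_10 [2,3,0,1,6,7,4,5,10,11,8,9,16,16,16,16]
  [0,1,2], Close [(1,3),(0,2)], Close [(1,4)], Ref vertex6_7 [1,0,4,5,2,3,8,9,6,7,11,10,16,16,16,16] [0,1,2],
  Close [(6,7),(0,1)], Close [(4,5),(1,8)], Ref vertex6_11 labels [0,1,2], Close [(7,10),(0,1)], Ref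
  vertex6_12 labels [0,1,2]]"])
    (simp_all only: cert_simps cong: cert_congs)

definition vertex6_14 :: pattern where [cert_simps]:
  "vertex6_14 = (12,
    [[1,0,3,2,5,4,7,6,9,8,11,10,16,16,16,16],
     [2,4,0,6,1,8,3,10,5,11,7,9,16,16,16,16],
     [9,16,16,16,16,16,16,16,16,0,16,16,16,16,16,16]])"

lemma solved_vertex6_14 [cert_simps]: "solved TYPE('a) False 6 vertex6_14"
  by (rule solvedI[where x = "Split 2 2 [Ref vertex6_10 [2,3,0,1,6,7,4,5,10,11,8,9,16,16,16,16]
  [0,1,2], Close [(2,3)], Close [(2,4),(0,1)], Ref vertex6_13 [2,3,0,1,6,7,4,5,10,11,8,9,16,16,16,16] [0,1,2],
  Ref vertex6_9 [2,0,3,6,1,4,7,10,5,8,11,9,16,16,16,16] [1,0,2], Close [(3,6),(2,7)], Close [(8,9),(0,2)], Ref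
  vertex6_12 [2,0,3,6,1,4,7,10,5,8,11,9,16,16,16,16] [1,0,2], Close [(9,11),(0,2)]]"])
    (simp_all only: cert_simps cong: cert_congs)

text \<open>The cases are the lengths of the face in colours 0 and 1 through vertex 0. Length 6 is
  the hexagon result. Lengths 8 and 10 leave so few vertices that a colour-2 edge out of the face
  leads to a face of length 2 or 4. Length 12 is searched by the chord at 0.\<close>

lemma solved_vertex6 [cert_simps]: "solved TYPE('a) False 6 vertex_pattern"
  by (rule solvedI[where x = "Split 0 0 [Split 1 0 [Close [(0,1)], Split 0 2 [Split 1 1 [Close
  [(2,3),(0,1)], Split 0 4 [Split 1 3 [Ref hexagon_pattern [0,1,4,5,3,2,16,16,16,16,16,16,16,16,16,16]
  [0,1,2], Split 0 6 [Split 1 5 [Split 2 0 [Close [(0,1)], Close [(0,2)], Ref vertex6_1 labels [0,1,2], Ref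
  vertex6_1 [4,5,1,0,7,6,2,3,16,16,16,16,16,16,16,16] [0,1,2], Close [(1,4),(0,5)], Close [(2,3),(0,6)], Split
  2 1 [Close [(4,5),(3,6),(2,7),(0,1)], Close [(1,3),(0,2)], Close [(1,4)], Close [(5,7),(0,1)], Close
  [(6,7),(0,1)], Split 0 8 [Split 1 8 [Close [(8,9)], Split 0 10 [Split 1 9 [Close [(10,11),(8,9)]]]]]], Split
  0 8 [Split 1 8 [Close [(8,9)], Split 0 10 [Split 1 9 [Close [(10,11),(8,9)]]]]]], Split 0 8 [Split 1 7
  [Split 2 0 [Close [(0,1)], Close [(0,2)], Ref vertex6_2 labels [0,1,2], Ref vertex6_2
  [4,5,1,0,8,9,2,3,7,6,16,16,16,16,16,16] [0,1,2], Close [(1,4),(0,5)], Close [(2,3),(0,6)], Ref vertex6_3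
  labels [0,1,2], Ref vertex6_3 [8,9,5,4,7,6,1,0,3,2,16,16,16,16,16,16] [0,1,2], Close
  [(6,7),(4,5),(2,3),(1,8),(0,9)], Split 0 10 [Split 1 10 [Close [(10,11)]]]], Split 0 10 [Split 1 9 [Split 2
  0 [Close [(0,1)], Close [(0,2)], Ref vertex6_10 labels [0,1,2], Ref vertex6_10
  [4,5,1,0,8,9,2,3,11,10,6,7,16,16,16,16] [0,1,2], Close [(1,4),(0,5)], Close [(2,3),(0,6)], Ref vertex6_13
  labels [0,1,2], Ref vertex6_13 [8,9,5,4,11,10,1,0,7,6,2,3,16,16,16,16] [0,1,2], Ref vertex6_14 labels
  [0,1,2], Ref vertex6_14 [0,2,1,4,3,6,5,8,7,10,9,11,16,16,16,16] [1,0,2], Split 2 1 [Ref vertex6_10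
  [2,3,0,1,6,7,4,5,10,11,8,9,16,16,16,16] [0,1,2], Close [(1,3),(0,2)], Close [(1,4)], Ref vertex6_8
  [1,0,4,5,2,3,8,9,6,7,11,10,16,16,16,16] [0,1,2], Ref vertex6_13 [6,7,3,2,10,11,0,1,9,8,4,5,16,16,16,16]
  [0,1,2], Ref vertex6_14 [1,0,4,5,2,3,8,9,6,7,11,10,16,16,16,16] [0,1,2], Close [(4,5),(1,8)], Close
  [(9,11),(0,1)], Close [(10,11),(0,1)]]]]]]]]]]]]]]]"])
    (simp_all only: cert_simps cong: cert_congs)

section \<open>Hexagonal faces on 16 vertices\<close>

definition hex8_1 :: pattern where [cert_simps]:
  "hex8_1 = (12,
    [[1,0,3,2,5,4,7,6,9,8,11,10,16,16,16,16],
     [5,2,1,4,3,0,8,10,6,11,7,9,16,16,16,16],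
     [2,6,0,16,16,16,1,16,16,16,16,16,16,16,16,16]])"

text \<open>An edge that leaves both hexagons ends among four vertices, whose faces in colours 0 and
  1 have length 2 or 4.\<close>

lemma solved_hex8_1 [cert_simps]: "solved TYPE('a) False 8 hex8_1"
  by (rule solvedI[where x = "Split 2 3 [Close [(3,4)], Close [(2,3),(0,5)], Close
  [(6,7),(4,5),(2,3),(0,1)], Close [(6,8),(4,5),(2,3),(0,1)], Split 2 5 [Close [(4,5)], Close
  [(6,7),(3,4),(2,5),(0,1)], Close [(6,8),(3,4),(2,5),(0,1)], Close [(5,10),(4,11),(3,9),(2,8),(0,7),(1,6)],
  Close [(9,11),(2,3),(1,4),(0,5)], Split 0 12 [Split 1 12 [Close [(12,13)], Split 0 14 [Split 1 13 [Close
  [(14,15),(12,13)]]]]]], Split 2 7 [Close [(7,10),(3,4)], Close [(6,7),(3,4),(2,5),(0,1)], Close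
  [(9,11),(8,10),(6,7),(4,5),(2,3),(0,1)], Close [(7,9),(6,8)], Close [(10,11),(8,9),(6,7),(4,5),(2,3),(0,1)],
  Split 0 12 [Split 1 12 [Close [(12,13)], Split 0 14 [Split 1 13 [Close [(14,15),(12,13)]]]]]], Close
  [(8,9),(7,10),(6,11),(4,5),(2,3),(0,1)], Split 0 12 [Split 1 12 [Close [(12,13)], Split 0 14 [Split 1 13
  [Close [(14,15),(12,13)]]]]]]"])
    (simp_all only: cert_simps cong: cert_congs)

definition hex8_2 :: pattern where [cert_simps]:
  "hex8_2 = (14,
    [[1,0,3,2,5,4,7,6,9,8,11,10,13,12,16,16],
     [5,2,1,4,3,0,8,10,6,12,7,13,9,11,16,16],
     [2,6,0,10,16,16,1,16,16,16,3,16,16,16,16,16]])"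

lemma solved_hex8_2 [cert_simps]: "solved TYPE('a) False 8 hex8_2"
  by (rule solvedI[where x = "Split 2 7 [Close [(7,10),(3,4)], Close [(6,7),(3,4),(2,5),(0,1)],
  Close [(12,13),(9,11),(8,10),(6,7),(4,5),(2,3),(0,1)], Close [(7,9),(6,8)], Close
  [(12,13),(10,11),(8,9),(6,7),(4,5),(2,3),(0,1)], Close [(11,13),(10,12),(8,9),(6,7),(4,5),(2,3),(0,1)],
  Close [(10,11),(7,13)], Split 0 14 [Split 1 14 [Close [(14,15)]]]]"])
    (simp_all only: cert_simps cong: cert_congs)

definition hex8_3 :: pattern where [cert_simps]:
  "hex8_3 = (14,
    [[1,0,3,2,5,4,7,6,9,8,11,10,13,12,16,16],
     [5,2,1,4,3,0,8,10,6,12,7,13,9,11,16,16],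
     [2,6,0,16,16,16,1,16,16,16,16,16,16,16,16,16]])"

text \<open>Beyond the hexagon and the outer octagon only two vertices are left, and reaching them
  exposes a double edge.\<close>

lemma solved_hex8_3 [cert_simps]: "solved TYPE('a) False 8 hex8_3"
  by (rule solvedI[where x = "Split 2 3 [Close [(3,4)], Close [(2,3),(0,5)], Close
  [(6,7),(4,5),(2,3),(0,1)], Close [(6,8),(4,5),(2,3),(0,1)], Split 2 5 [Close [(4,5)], Close
  [(6,7),(3,4),(2,5),(0,1)], Close [(6,8),(3,4),(2,5),(0,1)], Close
  [(11,13),(5,10),(4,12),(3,9),(2,8),(0,7),(1,6)], Close [(12,13),(8,9),(7,10),(6,11),(3,4),(2,5),(0,1)],
  Close [(9,12),(2,3),(1,4),(0,5)], Close [(10,11),(5,13),(4,12),(3,9),(2,8),(0,7),(1,6)], Split 0 14 [Split 1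
  14 [Close [(14,15)]]]], Ref hex8_2 labels [0,1,2], Close [(12,13),(8,9),(7,10),(6,11),(4,5),(2,3),(0,1)],
  Close [(10,11),(8,9),(7,13),(6,12),(4,5),(2,3),(0,1)], Split 2 5 [Close [(4,5)], Close
  [(6,7),(3,4),(2,5),(0,1)], Close [(6,8),(3,4),(2,5),(0,1)], Ref hex8_2
  [2,1,0,5,4,3,6,8,7,10,9,12,11,13,16,16] [1,0,2], Close [(9,12),(4,11),(3,13),(5,10),(2,8),(0,7),(1,6)],
  Close [(11,13),(2,3),(1,4),(0,5)], Close [(12,13),(2,3),(1,4),(0,5)], Split 0 14 [Split 1 14 [Close
  [(14,15)]]]], Split 0 14 [Split 1 14 [Close [(14,15)]]]]"])
    (simp_all only: cert_simps cong: cert_congs)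

text \<open>The patterns \<open>hex8_4\<close> to \<open>hex8_15\<close> are subcases of
  \<open>hex8_16\<close>, arranged by the colour-2 neighbour of 7, which is 8, 11, 12 or 13.\<close>

definition hex8_4 :: pattern where [cert_simps]:
  "hex8_4 = (16,
    [[1,0,3,2,5,4,7,6,9,8,11,10,13,12,15,14],
     [5,2,1,4,3,0,8,10,6,12,7,14,9,15,11,13],
     [2,6,0,10,9,16,1,8,7,4,3,12,11,16,16,16]])"

lemma solved_hex8_4 [cert_simps]: "solved TYPE('a) False 8 hex8_4"
  by (rule solvedI[where x = "Split 2 5 [Close [(12,13),(9,11),(8,10),(6,7),(4,5),(2,3),(0,1)],
  Close [(12,14),(9,11),(8,10),(6,7),(4,5),(2,3),(0,1)], Close
  [(11,14),(9,15),(8,10),(6,7),(4,5),(2,3),(0,1)]]"])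
    (simp_all only: cert_simps cong: cert_congs)

definition hex8_5 :: pattern where [cert_simps]:
  "hex8_5 = (16,
    [[1,0,3,2,5,4,7,6,9,8,11,10,13,12,15,14],
     [5,2,1,4,3,0,8,10,6,12,7,14,9,15,11,13],
     [2,6,0,16,9,16,1,8,7,4,16,16,16,16,16,16]])"

lemma solved_hex8_5 [cert_simps]: "solved TYPE('a) False 8 hex8_5"
  by (rule solvedI[where x = "Split 2 12 [Close [(9,12),(3,4)], Close [(9,12),(4,5)], Close
  [(10,12),(8,9),(6,7),(2,3),(1,4),(0,5)], Split 2 10 [Ref hex8_4 labels [0,1,2], Close
  [(5,10),(2,8),(0,7),(1,6)], Close [(12,13),(10,11)], Close [(12,14),(10,11),(8,9),(6,7),(2,3),(1,4),(0,5)],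
  Close [(11,14),(10,15)]], Close [(12,13)], Close [(13,15),(12,14)], Split 2 10 [Split 2 5 [Close
  [(10,11),(2,3),(1,4),(0,5)], Close [(13,15),(9,12),(8,10),(6,7),(4,5),(2,3),(0,1)], Close
  [(14,15),(9,12),(8,10),(6,7),(4,5),(2,3),(0,1)]], Close [(5,10),(2,8),(0,7),(1,6)], Close [(10,11)], Close
  [(13,15),(10,12),(8,9),(6,7),(2,3),(1,4),(0,5)], Close [(14,15),(10,12),(8,9),(6,7),(2,3),(1,4),(0,5)]]]"])
    (simp_all only: cert_simps cong: cert_congs)

definition hex8_6 :: pattern where [cert_simps]:
  "hex8_6 = (16,
    [[1,0,3,2,5,4,7,6,9,8,11,10,13,12,15,14],
     [5,2,1,4,3,0,8,10,6,12,7,14,9,15,11,13],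
     [2,6,0,16,16,9,1,8,7,5,16,16,16,16,16,16]])"

lemma solved_hex8_6 [cert_simps]: "solved TYPE('a) False 8 hex8_6"
  by (rule solvedI[where x = "Split 2 12 [Close [(9,12),(2,3),(1,4),(0,5)], Close
  [(9,12),(4,5)], Close [(10,12),(8,9),(6,7),(3,4),(2,5),(0,1)], Split 2 10 [Split 2 4 [Close
  [(12,13),(9,11),(8,10),(6,7),(4,5),(2,3),(0,1)], Close [(12,14),(9,11),(8,10),(6,7),(4,5),(2,3),(0,1)],
  Close [(11,14),(9,15),(8,10),(6,7),(4,5),(2,3),(0,1)]], Ref hex8_4 [2,1,0,5,4,3,6,8,7,10,9,12,11,14,13,15]
  [1,0,2], Close [(12,13),(10,11)], Close [(12,14),(10,11),(8,9),(6,7),(3,4),(2,5),(0,1)], Close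
  [(11,14),(10,15)]], Close [(12,13)], Close [(13,15),(12,14)], Split 2 10 [Split 2 4 [Close [(10,11),(3,4)],
  Close [(13,15),(9,12),(8,10),(6,7),(4,5),(2,3),(0,1)], Close
  [(14,15),(9,12),(8,10),(6,7),(4,5),(2,3),(0,1)]], Ref hex8_5 [2,1,0,5,4,3,6,8,7,10,9,12,11,14,13,15]
  [1,0,2], Close [(10,11)], Close [(13,15),(10,12),(8,9),(6,7),(3,4),(2,5),(0,1)], Close
  [(14,15),(10,12),(8,9),(6,7),(3,4),(2,5),(0,1)]]]"])
    (simp_all only: cert_simps cong: cert_congs)

definition hex8_7 :: pattern where [cert_simps]:
  "hex8_7 = (16,
    [[1,0,3,2,5,4,7,6,9,8,11,10,13,12,15,14],
     [5,2,1,4,3,0,8,10,6,12,7,14,9,15,11,13],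
     [2,6,0,16,16,16,1,8,7,11,13,9,16,10,16,16]])"

lemma solved_hex8_7 [cert_simps]: "solved TYPE('a) False 8 hex8_7"
  by (rule solvedI[where x = "Split 2 3 [Close [(3,4)], Close [(2,3),(0,5)], Close
  [(12,13),(9,11),(8,10),(6,7),(4,5),(2,3),(0,1)], Split 2 4 [Close [(4,5)], Close
  [(13,15),(12,14),(9,11),(3,4)], Close [(14,15),(3,4)]], Close
  [(13,15),(9,11),(8,10),(6,7),(4,5),(2,3),(0,1)]]"])
    (simp_all only: cert_simps cong: cert_congs)

definition hex8_8 :: pattern where [cert_simps]:
  "hex8_8 = (16,
    [[1,0,3,2,5,4,7,6,9,8,11,10,13,12,15,14],
     [5,2,1,4,3,0,8,10,6,12,7,14,9,15,11,13],
     [2,6,0,16,16,16,1,8,7,11,14,9,16,16,10,16]])"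

lemma solved_hex8_8 [cert_simps]: "solved TYPE('a) False 8 hex8_8"
  by (rule solvedI[where x = "Split 2 3 [Close [(3,4)], Close [(2,3),(0,5)], Close
  [(12,14),(9,11),(8,10),(6,7),(4,5),(2,3),(0,1)], Split 2 4 [Close [(4,5)], Close [(12,13),(3,4)], Close
  [(13,15),(3,4)]], Close [(14,15),(9,11),(8,10),(6,7),(4,5),(2,3),(0,1)]]"])
    (simp_all only: cert_simps cong: cert_congs)

definition hex8_9 :: pattern where [cert_simps]:
  "hex8_9 = (16,
    [[1,0,3,2,5,4,7,6,9,8,11,10,13,12,15,14],
     [5,2,1,4,3,0,8,10,6,12,7,14,9,15,11,13],
     [2,6,0,15,16,16,1,11,12,16,16,7,8,16,16,3]])"

lemma solved_hex8_9 [cert_simps]: "solved TYPE('a) False 8 hex8_9"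
  by (rule solvedI[where x = "Split 2 4 [Close [(4,5)], Split 2 5 [Close
  [(8,14),(10,11),(9,15),(6,7),(3,4),(2,5),(0,1)], Close [(13,15),(2,3),(1,4),(0,5)], Close
  [(14,15),(2,3),(1,4),(0,5)]], Split 2 5 [Close [(10,15),(7,13),(9,12),(6,8),(3,4),(2,5),(0,1)], Close
  [(13,15),(2,3),(1,4),(0,5)], Close [(14,15),(2,3),(1,4),(0,5)]], Close [(13,15),(3,4)], Close
  [(14,15),(3,4)]]"])
    (simp_all only: cert_simps cong: cert_congs)

definition hex8_10 :: pattern where [cert_simps]:
  "hex8_10 = (16,
    [[1,0,3,2,5,4,7,6,9,8,11,10,13,12,15,14],
     [5,2,1,4,3,0,8,10,6,12,7,14,9,15,11,13],
     [2,6,0,16,16,16,1,11,14,16,16,7,16,16,8,16]])"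

lemma solved_hex8_10 [cert_simps]: "solved TYPE('a) False 8 hex8_10"
  by (rule solvedI[where x = "Split 2 10 [Close [(10,11),(8,14),(6,7),(4,5),(2,3),(0,1)], Close
  [(10,11),(8,14),(6,7),(2,3),(1,4),(0,5)], Close [(10,11),(8,14),(6,7),(3,4),(2,5),(0,1)], Split 2 3 [Close
  [(3,4)], Close [(2,3),(0,5)], Close [(9,12),(10,11),(8,14),(6,7),(4,5),(2,3),(0,1)], Split 2 4 [Close
  [(4,5)], Close [(12,13),(3,4)], Close [(13,15),(3,4)]], Close
  [(9,15),(10,11),(8,14),(6,7),(4,5),(2,3),(0,1)]], Split 2 3 [Close [(3,4)], Close [(2,3),(0,5)], Close
  [(11,14),(10,12),(8,9),(6,7),(4,5),(2,3),(0,1)], Close [(11,13),(10,12),(8,9),(6,7),(4,5),(2,3),(0,1)],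
  Close [(14,15),(10,12),(7,9),(6,8),(4,5),(2,3),(0,1)]], Split 2 3 [Close [(3,4)], Close [(2,3),(0,5)], Split
  2 4 [Close [(4,5)], Close [(9,12),(3,4)], Close [(12,13),(9,15),(8,14),(3,4)]], Close
  [(12,13),(10,11),(8,14),(6,7),(4,5),(2,3),(0,1)], Close [(13,15),(10,11),(8,14),(6,7),(4,5),(2,3),(0,1)]],
  Close [(11,14),(10,15)]]"])
    (simp_all only: cert_simps cong: cert_congs)

definition hex8_11 :: pattern where [cert_simps]:
  "hex8_11 = (16,
    [[1,0,3,2,5,4,7,6,9,8,11,10,13,12,15,14],
     [5,2,1,4,3,0,8,10,6,12,7,14,9,15,11,13],
     [2,6,0,16,16,16,1,11,15,16,16,7,16,16,16,8]])"

lemma solved_hex8_11 [cert_simps]: "solved TYPE('a) False 8 hex8_11"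
  by (rule solvedI[where x = "Split 2 12 [Split 2 9 [Close [(9,12),(3,4)], Close
  [(9,12),(2,3),(1,4),(0,5)], Close [(10,15),(8,9),(7,13),(6,12),(4,5),(2,3),(0,1)], Close [(13,15),(8,9)],
  Close [(14,15),(8,9)]], Split 2 9 [Close [(9,12),(3,4)], Close [(9,12),(4,5)], Close
  [(10,15),(8,9),(7,13),(6,12),(2,3),(1,4),(0,5)], Close [(13,15),(8,9)], Close [(14,15),(8,9)]], Split 2 9
  [Close [(9,12),(2,3),(1,4),(0,5)], Close [(9,12),(4,5)], Close
  [(10,15),(8,9),(7,13),(6,12),(3,4),(2,5),(0,1)], Close [(13,15),(8,9)], Close [(14,15),(8,9)]], Close
  [(9,12)], Split 2 3 [Close [(3,4)], Close [(2,3),(0,5)], Split 2 4 [Close [(4,5)], Close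
  [(13,15),(11,14),(10,12),(8,9),(6,7),(3,4)], Close [(14,15),(11,13),(10,12),(8,9),(6,7),(3,4)]], Close
  [(11,13),(10,12),(8,9),(6,7),(4,5),(2,3),(0,1)], Close [(11,14),(10,12),(8,9),(6,7),(4,5),(2,3),(0,1)]],
  Close [(12,13)], Close [(13,15),(12,14)]]"])
    (simp_all only: cert_simps cong: cert_congs)

definition hex8_12 :: pattern where [cert_simps]:
  "hex8_12 = (16,
    [[1,0,3,2,5,4,7,6,9,8,11,10,13,12,15,14],
     [5,2,1,4,3,0,8,10,6,12,7,14,9,15,11,13],
     [2,6,0,16,16,16,1,11,16,16,16,7,16,16,16,16]])"

lemma solved_hex8_12 [cert_simps]: "solved TYPE('a) False 8 hex8_12"
  by (rule solvedI[where x = "Split 2 8 [Close [(6,8),(4,5),(2,3),(0,1)], Close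
  [(6,8),(2,3),(1,4),(0,5)], Close [(6,8),(3,4),(2,5),(0,1)], Close [(8,9)], Close [(8,10),(6,7)], Split 2 15
  [Ref hex8_9 labels [0,1,2], Split 2 3 [Close [(2,3),(0,5)], Split 2 5 [Close
  [(10,15),(7,13),(9,12),(6,8),(4,5),(2,3),(0,1)], Close [(13,15),(4,5)], Close [(14,15),(4,5)]], Split 2 5
  [Close [(8,14),(10,11),(9,15),(6,7),(4,5),(2,3),(0,1)], Close [(13,15),(4,5)], Close [(14,15),(4,5)]], Close
  [(13,15),(3,4)], Close [(14,15),(3,4)]], Ref hex8_9 [2,1,0,5,4,3,6,8,7,10,9,12,11,14,13,15] [1,0,2], Close
  [(12,13),(9,15)], Close [(11,14),(10,15)], Close [(13,15)], Close [(14,15)]], Close [(9,12),(8,13)], Ref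
  hex8_10 labels [0,1,2], Ref hex8_11 labels [0,1,2]]"])
    (simp_all only: cert_simps cong: cert_congs)

definition hex8_13 :: pattern where [cert_simps]:
  "hex8_13 = (16,
    [[1,0,3,2,5,4,7,6,9,8,11,10,13,12,15,14],
     [5,2,1,4,3,0,8,10,6,12,7,14,9,15,11,13],
     [2,6,0,16,16,16,1,12,14,16,16,16,7,16,8,16]])"

lemma solved_hex8_13 [cert_simps]: "solved TYPE('a) False 8 hex8_13"
  by (rule solvedI[where x = "Split 2 9 [Close [(10,11),(9,12),(8,14),(6,7),(4,5),(2,3),(0,1)],
  Close [(10,11),(9,12),(8,14),(6,7),(2,3),(1,4),(0,5)], Close
  [(10,11),(9,12),(8,14),(6,7),(3,4),(2,5),(0,1)], Close [(9,12),(7,10)], Close [(11,14),(8,9)], Split 2 3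
  [Close [(3,4)], Close [(2,3),(0,5)], Split 2 4 [Close [(4,5)], Close [(10,11),(3,4)], Close
  [(11,14),(10,15),(12,13),(7,9),(6,8),(3,4)]], Close [(8,14),(7,10),(6,11),(4,5),(2,3),(0,1)], Close
  [(8,14),(13,15),(9,12),(6,7),(4,5),(2,3),(0,1)]], Close [(14,15),(8,9)]]"])
    (simp_all only: cert_simps cong: cert_congs)

definition hex8_14 :: pattern where [cert_simps]:
  "hex8_14 = (16,
    [[1,0,3,2,5,4,7,6,9,8,11,10,13,12,15,14],
     [5,2,1,4,3,0,8,10,6,12,7,14,9,15,11,13],
     [2,6,0,16,16,16,1,12,15,16,16,16,7,16,16,8]])"

lemma solved_hex8_14 [cert_simps]: "solved TYPE('a) False 8 hex8_14"
  by (rule solvedI[where x = "Split 2 13 [Close [(8,15),(7,12),(6,13),(4,5),(2,3),(0,1)], Close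
  [(8,15),(7,12),(6,13),(2,3),(1,4),(0,5)], Close [(8,15),(7,12),(6,13),(3,4),(2,5),(0,1)], Close
  [(13,15),(8,9)], Close [(12,13),(7,10)], Close [(14,15),(11,13)], Split 2 3 [Close [(3,4)], Close
  [(2,3),(0,5)], Close [(13,14),(9,12),(8,15),(6,7),(4,5),(2,3),(0,1)], Split 2 4 [Close [(4,5)], Close
  [(14,15),(8,13),(9,12),(6,11),(7,10),(3,4)], Close [(10,11),(3,4)]], Close
  [(13,15),(8,14),(7,10),(6,11),(4,5),(2,3),(0,1)]]]"])
    (simp_all only: cert_simps cong: cert_congs)

definition hex8_15 :: pattern where [cert_simps]:
  "hex8_15 = (16,
    [[1,0,3,2,5,4,7,6,9,8,11,10,13,12,15,14],
     [5,2,1,4,3,0,8,10,6,12,7,14,9,15,11,13],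
     [2,6,0,16,16,16,1,13,16,16,16,16,16,7,16,16]])"

lemma solved_hex8_15 [cert_simps]: "solved TYPE('a) False 8 hex8_15"
  by (rule solvedI[where x = "Split 2 12 [Close [(8,9),(7,13),(6,12),(4,5),(2,3),(0,1)], Close
  [(8,9),(7,13),(6,12),(2,3),(1,4),(0,5)], Close [(8,9),(7,13),(6,12),(3,4),(2,5),(0,1)], Ref hex8_10
  [2,1,0,5,4,3,6,8,7,10,9,12,11,14,13,15] [1,0,2], Close [(9,12)], Close [(12,13),(7,10)], Split 2 10 [Close
  [(10,11),(8,9),(6,12),(7,13),(4,5),(2,3),(0,1)], Close [(10,11),(8,9),(6,12),(7,13),(2,3),(1,4),(0,5)],
  Close [(10,11),(8,9),(6,12),(7,13),(3,4),(2,5),(0,1)], Close [(8,10),(6,7)], Close [(10,11),(9,12)], Split 2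
  3 [Close [(3,4)], Close [(2,3),(0,5)], Close [(6,8),(4,5),(2,3),(0,1)], Split 2 4 [Close [(4,5)], Close
  [(8,9),(3,4)], Close [(12,14),(10,11),(13,15),(7,9),(6,8),(3,4)]], Close
  [(12,14),(13,15),(10,11),(6,7),(4,5),(2,3),(0,1)]], Close [(13,15),(7,10)]], Close [(13,15),(12,14)], Split
  2 8 [Close [(6,8),(4,5),(2,3),(0,1)], Close [(6,8),(2,3),(1,4),(0,5)], Close [(6,8),(3,4),(2,5),(0,1)],
  Close [(8,9)], Close [(8,10),(6,7)], Ref hex8_13 [2,1,0,5,4,3,6,8,7,10,9,12,11,14,13,15] [1,0,2], Split 2 3
  [Close [(3,4)], Close [(2,3),(0,5)], Close [(8,14),(13,15),(9,12),(6,7),(4,5),(2,3),(0,1)], Close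
  [(10,15),(8,9),(6,12),(7,13),(4,5),(2,3),(0,1)], Close [(8,14),(7,10),(6,11),(4,5),(2,3),(0,1)]]]]"])
    (simp_all only: cert_simps cong: cert_congs)

text \<open>The outer ten vertices form one face, on which 7 and 8 are the neighbours of 6. The
  reflection exchanging 7 and 8 also swaps colours 0 and 1; it is the renaming
  \<open>[1,0,2]\<close> of many references.\<close>

definition hex8_16 :: pattern where [cert_simps]:
  "hex8_16 = (16,
    [[1,0,3,2,5,4,7,6,9,8,11,10,13,12,15,14],
     [5,2,1,4,3,0,8,10,6,12,7,14,9,15,11,13],
     [2,6,0,16,16,16,1,16,16,16,16,16,16,16,16,16]])"

lemma solved_hex8_16 [cert_simps]: "solved TYPE('a) False 8 hex8_16"
  by (rule solvedI[where x = "Split 2 7 [Close [(6,7),(4,5),(2,3),(0,1)], Close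
  [(6,7),(2,3),(1,4),(0,5)], Close [(6,7),(3,4),(2,5),(0,1)], Split 2 9 [Close [(3,9),(2,8),(0,7),(1,6)], Ref
  hex8_5 labels [0,1,2], Ref hex8_6 labels [0,1,2], Close [(8,9),(7,10)], Split 2 10 [Close
  [(9,11),(8,10),(6,7),(4,5),(2,3),(0,1)], Close [(9,11),(8,10),(6,7),(2,3),(1,4),(0,5)], Close
  [(5,10),(2,8),(0,7),(1,6)], Close [(10,11),(9,12)], Ref hex8_7 labels [0,1,2], Ref hex8_8 labels [0,1,2],
  Close [(11,14),(10,15)]], Close [(9,12)], Split 2 10 [Ref hex8_6 [2,1,0,5,4,3,6,8,7,10,9,12,11,14,13,15]
  [1,0,2], Ref hex8_5 [2,1,0,5,4,3,6,8,7,10,9,12,11,14,13,15] [1,0,2], Close [(5,10),(2,8),(0,7),(1,6)], Close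
  [(10,11)], Ref hex8_8 [2,1,0,5,4,3,6,8,7,10,9,12,11,14,13,15] [1,0,2], Split 2 3 [Close [(3,4)], Close
  [(2,3),(0,5)], Close [(8,14),(7,10),(6,11),(4,5),(2,3),(0,1)], Close
  [(8,9),(7,13),(6,12),(4,5),(2,3),(0,1)], Split 2 4 [Close [(4,5)], Close
  [(8,14),(7,10),(6,11),(2,3),(1,4),(0,5)], Close [(8,9),(7,13),(6,12),(2,3),(1,4),(0,5)]]], Close
  [(11,14),(10,15)]], Split 2 12 [Close [(10,11),(7,14),(8,9),(6,12),(4,5),(2,3),(0,1)], Close
  [(10,11),(7,14),(8,9),(6,12),(2,3),(1,4),(0,5)], Close [(10,11),(7,14),(8,9),(6,12),(3,4),(2,5),(0,1)], Ref
  hex8_7 [2,1,0,5,4,3,6,8,7,10,9,12,11,14,13,15] [1,0,2], Close [(11,14),(9,12)], Close [(12,13)], Close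
  [(14,15),(9,12)]], Close [(12,13),(9,15)]], Close [(7,9),(6,8)], Close [(7,10)], Ref hex8_12 labels [0,1,2],
  Split 2 8 [Close [(6,8),(4,5),(2,3),(0,1)], Close [(6,8),(2,3),(1,4),(0,5)], Close
  [(6,8),(3,4),(2,5),(0,1)], Close [(8,9)], Close [(8,10),(6,7)], Split 2 13 [Close
  [(9,10),(8,11),(7,12),(6,13),(4,5),(2,3),(0,1)], Close [(9,10),(8,11),(7,12),(6,13),(2,3),(1,4),(0,5)],
  Close [(9,10),(8,11),(7,12),(6,13),(3,4),(2,5),(0,1)], Split 2 3 [Close [(3,4)], Close [(2,3),(0,5)], Close
  [(11,13),(10,12),(8,9),(6,7),(4,5),(2,3),(0,1)], Close [(12,13),(11,14),(7,9),(6,8),(4,5),(2,3),(0,1)],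
  Split 2 4 [Close [(4,5)], Close [(11,14),(10,15),(12,13),(7,9),(6,8),(3,4)], Close [(14,15),(3,4)]]], Close
  [(12,13),(7,10)], Split 2 3 [Close [(3,4)], Close [(2,3),(0,5)], Close
  [(11,14),(8,13),(9,12),(6,7),(4,5),(2,3),(0,1)], Close [(12,13),(7,14),(10,11),(6,8),(4,5),(2,3),(0,1)],
  Close [(12,13),(10,11),(7,14),(6,15),(4,5),(2,3),(0,1)]], Close [(13,15)]], Close [(9,12),(8,13)], Ref
  hex8_13 labels [0,1,2], Ref hex8_14 labels [0,1,2]], Ref hex8_15 labels [0,1,2], Close [(10,11),(7,14)],
  Split 2 8 [Close [(6,8),(4,5),(2,3),(0,1)], Close [(6,8),(2,3),(1,4),(0,5)], Close
  [(6,8),(3,4),(2,5),(0,1)], Close [(8,9)], Close [(8,10),(6,7)], Ref hex8_14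
  [2,1,0,5,4,3,6,8,7,10,9,12,11,14,13,15] [1,0,2], Ref hex8_11 [2,1,0,5,4,3,6,8,7,10,9,12,11,14,13,15]
  [1,0,2], Close [(9,12),(8,13)], Ref hex8_15 [2,1,0,5,4,3,6,8,7,10,9,12,11,14,13,15] [1,0,2]]]"])
    (simp_all only: cert_simps cong: cert_congs)

text \<open>The outer face through 6 has length 2, 4, 6, 8 or 10; the last three are
  \<open>hex8_1\<close>, \<open>hex8_3\<close> and \<open>hex8_16\<close>.\<close>

definition hex8_17 :: pattern where [cert_simps]:
  "hex8_17 = (8,
    [[1,0,3,2,5,4,7,6,16,16,16,16,16,16,16,16],
     [5,2,1,4,3,0,16,16,16,16,16,16,16,16,16,16],
     [2,6,0,16,16,16,1,16,16,16,16,16,16,16,16,16]])"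

lemma solved_hex8_17 [cert_simps]: "solved TYPE('a) False 8 hex8_17"
  by (rule solvedI[where x = "Split 1 6 [Close [(6,7)], Split 0 8 [Split 1 7 [Close
  [(8,9),(6,7)], Split 0 10 [Split 1 9 [Ref hex8_1 labels [0,1,2], Split 0 12 [Split 1 11 [Ref hex8_3 labels
  [0,1,2], Split 0 14 [Split 1 13 [Ref hex8_16 labels [0,1,2]]]]]]]]]]"])
    (simp_all only: cert_simps cong: cert_congs)

definition hex8_18 :: pattern where [cert_simps]:
  "hex8_18 = (6,
    [[1,0,3,2,5,4,16,16,16,16,16,16,16,16,16,16],
     [5,2,1,4,3,0,16,16,16,16,16,16,16,16,16,16],
     [2,16,0,16,16,16,16,16,16,16,16,16,16,16,16,16]])"

text \<open>As for 12 vertices, a second chord at 1 would produce a 4-cycle.\<close>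

lemma solved_hex8_18 [cert_simps]: "solved TYPE('a) False 8 hex8_18"
  by (rule solvedI[where x = "Split 2 1 [Close [(2,3),(0,1)], Close [(1,4),(0,5)], Close
  [(2,5),(0,1)], Split 0 6 [Ref hex8_17 labels [0,1,2]]]"])
    (simp_all only: cert_simps cong: cert_congs)

text \<open>Here, in \<open>hex8_20\<close> and in \<open>hex8_24\<close>, the vertices 0 and 1 are
  attached at distance 2 on an outer face, of length 6, 8 and 10 respectively.\<close>

definition hex8_19 :: pattern where [cert_simps]:
  "hex8_19 = (12,
    [[1,0,3,2,5,4,7,6,9,8,11,10,16,16,16,16],
     [5,2,1,4,3,0,8,10,6,11,7,9,16,16,16,16],
     [6,9,16,16,16,16,0,16,16,1,16,16,16,16,16,16]])"

lemma solved_hex8_19 [cert_simps]: "solved TYPE('a) False 8 hex8_19"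
  by (rule solvedI[where x = "Split 2 7 [Close [(10,11),(7,9),(6,8),(1,2)], Close
  [(6,7),(4,5),(0,3),(1,2)], Close [(10,11),(7,9),(6,8),(2,3),(1,4),(0,5)], Close [(6,7),(0,5)], Close
  [(10,11),(8,9),(6,7),(0,1)], Close [(7,10)], Close [(9,11),(8,10),(6,7),(0,1)], Split 0 12 [Split 1 12
  [Close [(12,13)], Split 0 14 [Split 1 13 [Close [(14,15),(12,13)]]]]]]"])
    (simp_all only: cert_simps cong: cert_congs)

definition hex8_20 :: pattern where [cert_simps]:
  "hex8_20 = (14,
    [[1,0,3,2,5,4,7,6,9,8,11,10,13,12,16,16],
     [5,2,1,4,3,0,8,10,6,12,7,13,9,11,16,16],
     [6,9,16,16,16,16,0,16,16,1,16,16,16,16,16,16]])"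

lemma solved_hex8_20 [cert_simps]: "solved TYPE('a) False 8 hex8_20"
  by (rule solvedI[where x = "Split 2 7 [Close [(12,13),(10,11),(7,9),(6,8),(3,4),(1,2),(0,5)],
  Close [(6,7),(4,5),(0,3),(1,2)], Close [(12,13),(10,11),(7,9),(6,8),(2,3),(1,4),(0,5)], Close [(6,7),(0,5)],
  Close [(12,13),(10,11),(8,9),(6,7),(4,5),(2,3),(0,1)], Close [(7,10)], Close
  [(12,13),(9,11),(8,10),(6,7),(4,5),(2,3),(0,1)], Close [(11,13),(9,12),(8,10),(6,7),(4,5),(2,3),(0,1)],
  Close [(10,11),(7,13)], Split 0 14 [Split 1 14 [Close [(14,15)]]]]"])
    (simp_all only: cert_simps cong: cert_congs)

definition hex8_21 :: pattern where [cert_simps]: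
  "hex8_21 = (16,
    [[1,0,3,2,5,4,7,6,9,8,11,10,13,12,15,14],
     [5,2,1,4,3,0,8,10,6,12,7,14,9,15,11,13],
     [6,9,14,10,16,16,0,16,11,1,3,8,16,16,2,16]])"

lemma solved_hex8_21 [cert_simps]: "solved TYPE('a) False 8 hex8_21"
  by (rule solvedI[where x = "Split 2 4 [Close [(4,5)], Close [(7,10),(3,4)], Close
  [(9,12),(2,3),(1,4),(0,5)], Close [(8,9),(4,13),(3,15),(7,10),(1,11),(2,14),(0,6)], Close
  [(11,14),(10,15),(8,9),(3,4),(1,2),(0,5)]]"])
    (simp_all only: cert_simps cong: cert_congs)

definition hex8_22 :: pattern where [cert_simps]:
  "hex8_22 = (16,
    [[1,0,3,2,5,4,7,6,9,8,11,10,13,12,15,14],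
     [5,2,1,4,3,0,8,10,6,12,7,14,9,15,11,13],
     [6,9,16,16,16,16,0,16,11,1,16,8,16,16,16,16]])"

lemma solved_hex8_22 [cert_simps]: "solved TYPE('a) False 8 hex8_22"
  by (rule solvedI[where x = "Split 2 2 [Close [(2,3)], Ref hex8_18
  [2,3,4,5,0,1,16,16,16,16,16,16,16,16,16,16] [0,1,2], Close [(2,5),(0,1)], Split 2 3 [Close [(3,4)], Close
  [(6,7),(2,3),(1,4),(0,5)], Close [(7,10),(2,3)], Split 2 10 [Close [(9,10),(8,11),(7,12),(2,3),(1,4),(0,5)],
  Close [(7,10),(3,4),(2,5),(0,1)], Close [(11,13),(9,12),(8,10),(6,7),(4,5),(2,3),(0,1)], Close
  [(11,14),(9,12),(8,10),(6,7),(4,5),(2,3),(0,1)], Close [(11,14),(10,15)]], Close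
  [(11,13),(10,12),(7,9),(6,8),(4,5),(0,3),(1,2)], Close [(11,14),(7,9),(6,8),(4,5),(0,3),(1,2)], Split 2 4
  [Close [(4,5)], Close [(9,10),(8,11),(6,14),(7,15),(2,3),(1,4),(0,5)], Close [(9,12),(2,3),(1,4),(0,5)],
  Close [(13,15),(3,4)], Close [(14,15),(3,4)]]], Split 2 3 [Close [(3,4)], Ref hex8_18
  [5,4,3,2,1,0,16,16,16,16,16,16,16,16,16,16] [0,1,2], Close [(7,10),(2,3)], Close
  [(10,11),(8,9),(6,12),(4,5),(0,3),(1,2)], Close [(8,11),(9,10),(7,12),(6,13),(4,5),(0,3),(1,2)], Close
  [(9,10),(8,11),(6,14),(4,5),(0,3),(1,2)], Close [(8,9),(10,11),(7,14),(6,15),(4,5),(0,3),(1,2)]], Close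
  [(9,12),(1,2)], Split 2 12 [Close [(12,13),(2,3)], Close [(9,12),(2,3),(1,4),(0,5)], Close
  [(12,13),(3,4),(2,5),(0,1)], Split 2 3 [Close [(3,4)], Close
  [(9,10),(8,11),(7,12),(6,13),(2,3),(1,4),(0,5)], Close [(11,13),(9,12),(8,10),(6,7),(4,5),(2,3),(0,1)],
  Close [(11,14),(8,13),(9,12),(6,7),(4,5),(2,3),(0,1)], Close [(13,15),(2,3)]], Close
  [(14,15),(11,13),(10,12),(8,9),(6,7),(1,2)], Close [(13,15),(12,14)], Ref hex8_17
  [13,15,12,9,1,2,14,11,16,16,16,16,16,16,16,16] [1,2,0]], Split 2 3 [Close [(3,4)], Ref hex8_18
  [5,4,3,2,1,0,16,16,16,16,16,16,16,16,16,16] [0,1,2], Close [(6,7),(4,5),(0,3),(1,2)], Ref hex8_21 labels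
  [0,1,2], Close [(11,14),(8,9),(6,12),(4,5),(0,3),(1,2)], Split 2 7 [Close
  [(11,14),(8,9),(6,12),(7,13),(3,4),(1,2),(0,5)], Close [(6,7),(0,5)], Close [(7,10)], Close
  [(11,14),(8,13),(9,12),(6,7),(4,5),(2,3),(0,1)], Close [(13,15),(11,14),(8,9),(6,7),(4,5),(0,3),(1,2)]],
  Close [(14,15),(2,3)]], Split 2 3 [Close [(3,4)], Ref hex8_18 [5,4,3,2,1,0,16,16,16,16,16,16,16,16,16,16]
  [0,1,2], Close [(6,7),(4,5),(0,3),(1,2)], Close [(7,14),(10,11),(9,15),(6,8),(4,5),(0,3),(1,2)], Split 2 5
  [Close [(4,5)], Close [(6,7),(0,5)], Close [(7,14),(10,11),(9,15),(6,8),(3,4),(1,2),(0,5)], Close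
  [(13,15),(3,4),(2,5),(0,1)], Close [(14,15),(3,4),(2,5),(0,1)]], Close [(13,15),(2,3)], Close
  [(14,15),(2,3)]]]"])
    (simp_all only: cert_simps cong: cert_congs)

definition hex8_23 :: pattern where [cert_simps]:
  "hex8_23 = (16,
    [[1,0,3,2,5,4,7,6,9,8,11,10,13,12,15,14],
     [5,2,1,4,3,0,8,10,6,12,7,14,9,15,11,13],
     [6,9,16,16,16,16,0,16,12,1,16,16,8,16,16,16]])"

lemma solved_hex8_23 [cert_simps]: "solved TYPE('a) False 8 hex8_23"
  by (rule solvedI[where x = "Split 2 3 [Close [(2,3)], Close [(3,4)], Ref hex8_18
  [5,4,3,2,1,0,16,16,16,16,16,16,16,16,16,16] [0,1,2], Close [(6,7),(4,5),(0,3),(1,2)], Split 2 2 [Ref hex8_16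
  [2,3,4,5,0,1,10,11,7,6,14,15,8,9,13,12] [0,1,2], Close [(2,5),(0,1)], Close [(7,10),(2,3)], Close
  [(10,11),(2,3)], Split 2 7 [Close [(7,10),(3,4)], Close [(6,7),(0,5)], Close
  [(12,13),(9,11),(8,10),(6,7),(4,5),(2,3),(0,1)], Close [(10,11),(7,14)], Close
  [(9,15),(12,13),(8,10),(6,7),(4,5),(2,3),(0,1)]], Split 2 7 [Close [(7,10),(3,4)], Close [(6,7),(0,5)],
  Close [(12,14),(9,11),(8,10),(6,7),(4,5),(2,3),(0,1)], Close [(9,12),(7,13),(6,8),(0,1)], Close
  [(14,15),(9,12),(7,10),(6,8),(4,5),(2,3),(0,1)]], Close [(10,15),(7,13),(9,12),(6,8),(4,5),(2,3),(0,1)]],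
  Split 2 2 [Ref hex8_16 [2,3,4,5,0,1,11,10,14,15,7,6,13,12,8,9] [0,1,2], Close [(2,5),(0,1)], Split 2 10
  [Close [(10,11),(3,4)], Close [(7,10),(3,4),(2,5),(0,1)], Close
  [(12,13),(9,11),(8,10),(6,7),(4,5),(2,3),(0,1)], Close [(12,14),(9,11),(8,10),(6,7),(4,5),(2,3),(0,1)],
  Close [(11,14),(10,15)]], Close [(10,11),(2,3)], Close [(11,13),(9,12),(7,10),(6,8),(4,5),(2,3),(0,1)],
  Close [(11,14),(2,3)], Close [(9,15),(8,14),(7,10),(6,11),(4,5),(0,3),(1,2)]], Split 2 2 [Ref hex8_12
  [2,3,4,5,0,1,13,12,15,14,9,8,11,10,6,7] [0,1,2], Close [(2,5),(0,1)], Close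
  [(9,12),(7,13),(6,8),(4,5),(2,3),(0,1)], Split 2 5 [Close [(4,5)], Close [(6,7),(0,5)], Close
  [(10,11),(3,4),(2,5),(0,1)], Close [(8,10),(0,11),(5,14),(4,15),(3,13),(2,12),(1,9)], Close
  [(10,15),(7,13),(9,12),(6,8),(3,4),(2,5),(0,1)]], Close [(11,13),(9,12),(7,10),(6,8),(4,5),(2,3),(0,1)],
  Split 2 7 [Close [(9,12),(7,13),(6,8),(3,4),(2,5),(0,1)], Close [(6,7),(0,5)], Close [(7,10)], Close
  [(11,14),(7,13),(9,12),(6,8),(4,5),(2,3),(0,1)], Close [(8,14),(12,13),(9,15),(6,7),(4,5),(2,3),(0,1)]],
  Close [(13,15),(2,3)]], Split 2 2 [Ref hex8_16 [2,3,4,5,0,1,14,15,11,10,13,12,7,6,9,8] [0,1,2], Close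
  [(2,5),(0,1)], Close [(10,11),(9,12),(7,14),(6,8),(4,5),(2,3),(0,1)], Split 2 7 [Close
  [(10,11),(9,12),(7,14),(6,8),(3,4),(2,5),(0,1)], Close [(6,7),(0,5)], Close
  [(12,14),(9,11),(8,10),(6,7),(4,5),(2,3),(0,1)], Close [(9,12),(7,13),(6,8),(0,1)], Close
  [(14,15),(9,12),(7,10),(6,8),(4,5),(2,3),(0,1)]], Close [(11,14),(2,3)], Split 2 7 [Close
  [(10,11),(9,12),(7,14),(6,8),(3,4),(2,5),(0,1)], Close [(6,7),(0,5)], Close [(7,10)], Close
  [(11,14),(7,13),(9,12),(6,8),(4,5),(2,3),(0,1)], Close [(8,14),(12,13),(9,15),(6,7),(4,5),(2,3),(0,1)]],
  Close [(14,15),(2,3)]], Split 2 2 [Ref hex8_16 [2,3,4,5,0,1,15,14,13,12,11,10,9,8,7,6] [0,1,2], Close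
  [(2,5),(0,1)], Split 2 10 [Close [(10,15),(7,13),(9,12),(6,8),(3,4),(2,5),(0,1)], Close
  [(7,10),(3,4),(2,5),(0,1)], Close [(10,11)], Close [(9,15),(12,13),(8,10),(6,7),(4,5),(2,3),(0,1)], Close
  [(14,15),(9,12),(7,10),(6,8),(4,5),(2,3),(0,1)]], Close [(10,15),(7,13),(9,12),(6,8),(4,5),(2,3),(0,1)],
  Split 2 5 [Close [(4,5)], Close [(6,7),(0,5)], Close [(10,11),(3,4),(2,5),(0,1)], Close
  [(11,13),(9,12),(7,10),(6,8),(3,4),(2,5),(0,1)], Close [(11,14),(3,4),(2,5),(0,1)]], Close [(13,15),(2,3)],
  Close [(14,15),(2,3)]]]"])
    (simp_all only: cert_simps cong: cert_congs)

definition hex8_24 :: pattern where [cert_simps]: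
  "hex8_24 = (16,
    [[1,0,3,2,5,4,7,6,9,8,11,10,13,12,15,14],
     [5,2,1,4,3,0,8,10,6,12,7,14,9,15,11,13],
     [6,9,16,16,16,16,0,16,16,1,16,16,16,16,16,16]])"

lemma solved_hex8_24 [cert_simps]: "solved TYPE('a) False 8 hex8_24"
  by (rule solvedI[where x = "Split 2 8 [Close [(8,9),(1,2)], Close [(6,8),(4,5),(0,3),(1,2)],
  Close [(8,9),(2,3),(1,4),(0,5)], Close [(6,8),(0,5)], Ref hex8_17
  [6,7,8,9,1,0,10,11,16,16,16,16,16,16,16,16] [0,2,1], Close [(8,10),(6,7)], Ref hex8_22 labels [0,1,2], Ref
  hex8_23 labels [0,1,2], Close [(9,12),(8,13)], Split 2 11 [Split 2 3 [Close [(3,4)], Close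
  [(8,14),(7,10),(6,11),(2,3),(1,4),(0,5)], Close [(6,7),(4,5),(0,3),(1,2)], Close [(10,11),(2,3)], Close
  [(11,14),(8,9),(6,12),(4,5),(0,3),(1,2)], Split 2 5 [Close [(4,5)], Close [(6,7),(0,5)], Close
  [(10,11),(3,4),(2,5),(0,1)], Close [(11,14),(8,9),(6,12),(3,4),(1,2),(0,5)], Close
  [(14,15),(11,13),(6,8),(2,3),(1,4),(0,5)]], Close [(9,15),(8,14),(6,11),(7,10),(4,5),(2,3),(0,1)]], Close
  [(8,14),(7,10),(6,11),(4,5),(0,3),(1,2)], Split 2 3 [Close [(2,3)], Close
  [(8,14),(7,10),(6,11),(3,4),(1,2),(0,5)], Close [(6,7),(4,5),(0,3),(1,2)], Close [(10,11),(3,4)], Close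
  [(9,12),(8,14),(6,11),(7,10),(3,4),(2,5),(0,1)], Split 2 5 [Close [(2,5),(0,1)], Close [(6,7),(0,5)], Close
  [(10,11),(4,5)], Close [(11,14),(8,9),(6,12),(2,3),(1,4),(0,5)], Close
  [(14,15),(11,13),(6,8),(3,4),(1,2),(0,5)]], Close [(9,15),(8,14),(6,11),(7,10),(3,4),(2,5),(0,1)]], Close
  [(8,14),(7,10),(6,11),(0,5)], Split 2 2 [Close [(2,3)], Ref hex8_18
  [2,3,4,5,0,1,16,16,16,16,16,16,16,16,16,16] [0,1,2], Close [(2,5),(0,1)], Split 2 4 [Close [(3,4)], Close
  [(4,5)], Close [(9,12),(2,3),(1,4),(0,5)], Close [(8,9),(11,14),(3,15),(4,13),(2,10),(1,7),(0,6)], Close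
  [(12,13),(9,15),(8,14),(2,3),(1,4),(0,5)]], Close [(9,12),(1,2)], Split 2 3 [Close [(3,4)], Ref hex8_18
  [5,4,3,2,1,0,16,16,16,16,16,16,16,16,16,16] [0,1,2], Close [(10,11),(8,14),(6,7),(4,5),(0,3),(1,2)], Close
  [(12,13),(2,3)], Close [(13,15),(2,3)]], Close [(12,13),(9,15),(8,14),(1,2)]], Close [(10,11)], Close
  [(13,15),(9,12),(8,14),(6,11),(7,10),(0,1)], Close [(14,15),(11,13)], Close
  [(12,13),(9,15),(8,14),(6,11),(7,10),(0,1)]], Split 2 5 [Close [(2,5),(0,1)], Ref hex8_18
  [5,4,3,2,1,0,16,16,16,16,16,16,16,16,16,16] [0,1,2], Close [(4,5)], Close [(6,7),(0,5)], Split 2 7 [Close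
  [(7,10),(3,4),(2,5),(0,1)], Close [(6,7),(4,5),(0,3),(1,2)], Close [(7,10),(4,5)], Ref hex8_23
  [0,5,4,3,2,1,6,8,7,10,9,12,11,14,13,15] [1,0,2], Ref hex8_22 [0,5,4,3,2,1,6,8,7,10,9,12,11,14,13,15]
  [1,0,2], Close [(11,14),(10,15),(9,12),(7,13),(6,8),(0,5)], Close [(10,11),(7,14)]], Split 2 2 [Close
  [(2,3)], Ref hex8_18 [2,3,4,5,0,1,16,16,16,16,16,16,16,16,16,16] [0,1,2], Split 2 4 [Close [(3,4)], Close
  [(10,11),(4,5)], Close [(9,12),(2,3),(1,4),(0,5)], Close [(13,15),(8,9),(7,10),(6,11),(2,3),(1,4),(0,5)],
  Close [(11,14),(4,5)]], Close [(10,11),(3,4),(2,5),(0,1)], Close [(9,12),(1,2)], Close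
  [(13,15),(8,9),(7,10),(6,11),(3,4),(1,2),(0,5)], Close [(11,14),(3,4),(2,5),(0,1)]], Split 2 2 [Close
  [(2,3)], Close [(9,12),(4,5),(0,3),(1,2)], Split 2 10 [Close [(7,10),(2,3)], Close
  [(10,12),(7,9),(6,8),(4,5),(0,3),(1,2)], Close [(10,11)], Close
  [(13,15),(9,12),(8,10),(6,7),(3,4),(2,5),(0,1)], Close [(14,15),(9,12),(8,10),(6,7),(3,4),(2,5),(0,1)]],
  Close [(10,15),(8,9),(7,13),(6,12),(3,4),(1,2),(0,5)], Split 2 3 [Close [(3,4)], Close
  [(6,7),(4,5),(0,3),(1,2)], Close [(10,11),(2,3)], Close [(11,13),(8,9),(7,10),(6,12),(2,3),(1,4),(0,5)],
  Close [(11,14),(2,3)]], Close [(12,13),(3,4),(2,5),(0,1)], Close [(14,15),(8,9),(6,12),(3,4),(1,2),(0,5)]],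
  Split 2 2 [Close [(2,3)], Ref hex8_18 [2,3,4,5,0,1,16,16,16,16,16,16,16,16,16,16] [0,1,2], Close
  [(13,15),(7,9),(6,8),(3,4),(1,2),(0,5)], Close [(9,10),(8,15),(7,12),(6,13),(3,4),(1,2),(0,5)], Close
  [(13,15),(9,11),(7,10),(6,8),(3,4),(1,2),(0,5)], Close [(9,12),(1,2)], Close
  [(9,14),(8,15),(6,13),(3,4),(1,2),(0,5)]], Split 2 4 [Ref hex8_18
  [2,3,4,5,0,1,16,16,16,16,16,16,16,16,16,16] [0,1,2], Close [(3,4)], Close
  [(14,15),(7,9),(6,8),(2,3),(1,4),(0,5)], Split 2 3 [Close [(2,3)], Close [(7,10),(3,4)], Close
  [(10,11),(3,4)], Close [(14,15),(10,12),(7,9),(6,8),(3,4),(1,2),(0,5)], Close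
  [(8,10),(0,11),(5,14),(4,15),(3,13),(2,12),(1,9)]], Close [(11,14),(4,5)], Close [(9,12),(2,3),(1,4),(0,5)],
  Ref hex8_21 [4,5,0,1,2,3,13,12,15,14,9,8,11,10,6,7] [0,1,2]]]]"])
    (simp_all only: cert_simps cong: cert_congs)

definition hex8_25 :: pattern where [cert_simps]:
  "hex8_25 = (16,
    [[1,0,3,2,5,4,7,6,9,8,11,10,13,12,15,14],
     [5,2,1,4,3,0,8,10,6,12,7,14,9,15,11,13],
     [6,11,8,16,16,12,0,16,2,16,16,1,5,16,16,16]])"

lemma solved_hex8_25 [cert_simps]: "solved TYPE('a) False 8 hex8_25"
  by (rule solvedI[where x = "Split 2 9 [Close [(8,9),(2,3)], Close [(9,12),(4,5)], Close
  [(7,9),(6,8)], Close [(10,11),(8,9),(6,12),(3,4),(1,2),(0,5)], Close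
  [(12,13),(8,9),(7,10),(6,11),(3,4),(2,5),(0,1)], Close [(11,14),(8,9),(6,12),(3,4),(1,2),(0,5)], Close
  [(12,13),(9,15)]]"])
    (simp_all only: cert_simps cong: cert_congs)

definition hex8_26 :: pattern where [cert_simps]:
  "hex8_26 = (16,
    [[1,0,3,2,5,4,7,6,9,8,11,10,13,12,15,14],
     [5,2,1,4,3,0,8,10,6,12,7,14,9,15,11,13],
     [6,11,8,16,16,15,0,16,2,16,16,1,16,16,16,5]])"

lemma solved_hex8_26 [cert_simps]: "solved TYPE('a) False 8 hex8_26"
  by (rule solvedI[where x = "Split 2 9 [Close [(8,9),(2,3)], Close
  [(9,15),(8,14),(7,10),(6,11),(4,5),(2,3),(0,1)], Close [(7,9),(6,8)], Close
  [(8,9),(10,11),(7,14),(6,15),(3,4),(1,2),(0,5)], Close [(9,12)], Close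
  [(13,15),(8,9),(7,10),(6,11),(3,4),(2,5),(0,1)], Close [(14,15),(8,9),(7,10),(6,11),(3,4),(2,5),(0,1)]]"])
    (simp_all only: cert_simps cong: cert_congs)

text \<open>The attachments of 0 and 1 have distance 3 on the outer 10-cycle, along 6, 7, 10, 11,
  and 2 is attached at 8; in \<open>hex8_29\<close> and \<open>hex8_30\<close> it is attached at 9
  and 12.\<close>

definition hex8_27 :: pattern where [cert_simps]:
  "hex8_27 = (16,
    [[1,0,3,2,5,4,7,6,9,8,11,10,13,12,15,14],
     [5,2,1,4,3,0,8,10,6,12,7,14,9,15,11,13],
     [6,11,8,16,16,16,0,16,2,16,16,1,16,16,16,16]])"

lemma solved_hex8_27 [cert_simps]: "solved TYPE('a) False 8 hex8_27"
  by (rule solvedI[where x = "Split 2 5 [Close [(6,8),(2,3),(1,4),(0,5)], Close [(4,5)], Close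
  [(6,7),(0,5)], Close [(8,9),(3,4),(2,5),(0,1)], Ref hex8_24 [0,5,4,3,2,1,6,8,7,10,9,12,11,14,13,15] [1,0,2],
  Ref hex8_25 labels [0,1,2], Close [(9,12),(8,13),(7,10),(6,11),(3,4),(2,5),(0,1)], Close
  [(8,14),(7,10),(6,11),(3,4),(2,5),(0,1)], Ref hex8_26 labels [0,1,2]]"])
    (simp_all only: cert_simps cong: cert_congs)

definition hex8_28 :: pattern where [cert_simps]:
  "hex8_28 = (16,
    [[1,0,3,2,5,4,7,6,9,8,11,10,13,12,15,14],
     [5,2,1,4,3,0,8,10,6,12,7,14,9,15,11,13],
     [6,11,9,16,16,13,0,16,16,2,16,1,16,5,16,16]])"

lemma solved_hex8_28 [cert_simps]: "solved TYPE('a) False 8 hex8_28"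
  by (rule solvedI[where x = "Split 2 15 [Close [(9,15),(8,14),(7,10),(6,11),(4,5),(2,3),(0,1)],
  Close [(13,15),(4,5)], Close [(13,15),(9,11),(8,10),(6,7),(3,4),(1,2),(0,5)], Close
  [(13,15),(8,9),(7,10),(6,11),(3,4),(2,5),(0,1)], Close [(11,14),(10,15)], Close
  [(13,15),(9,12),(7,10),(6,11),(3,4),(2,5),(0,1)], Close [(14,15)]]"])
    (simp_all only: cert_simps cong: cert_congs)

definition hex8_29 :: pattern where [cert_simps]:
  "hex8_29 = (16,
    [[1,0,3,2,5,4,7,6,9,8,11,10,13,12,15,14],
     [5,2,1,4,3,0,8,10,6,12,7,14,9,15,11,13],
     [6,11,9,16,16,16,0,16,16,2,16,1,16,16,16,16]])"

lemma solved_hex8_29 [cert_simps]: "solved TYPE('a) False 8 hex8_29"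
  by (rule solvedI[where x = "Split 2 5 [Ref hex8_18 [5,4,3,2,1,0,16,16,16,16,16,16,16,16,16,16]
  [0,1,2], Close [(4,5)], Close [(6,7),(0,5)], Close [(6,8),(0,5)], Ref hex8_24
  [0,5,4,3,2,1,6,8,7,10,9,12,11,14,13,15] [1,0,2], Close [(9,12),(3,4),(2,5),(0,1)], Ref hex8_28 labels
  [0,1,2], Ref hex8_26 [1,0,5,4,3,2,11,10,14,15,7,6,13,12,8,9] [0,1,2], Close
  [(9,15),(8,14),(7,10),(6,11),(3,4),(2,5),(0,1)]]"])
    (simp_all only: cert_simps cong: cert_congs)

definition hex8_30 :: pattern where [cert_simps]:
  "hex8_30 = (16,
    [[1,0,3,2,5,4,7,6,9,8,11,10,13,12,15,14],
     [5,2,1,4,3,0,8,10,6,12,7,14,9,15,11,13],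
     [6,11,12,16,16,16,0,16,16,16,16,1,2,16,16,16]])"

lemma solved_hex8_30 [cert_simps]: "solved TYPE('a) False 8 hex8_30"
  by (rule solvedI[where x = "Split 2 5 [Ref hex8_18 [5,4,3,2,1,0,16,16,16,16,16,16,16,16,16,16]
  [0,1,2], Close [(4,5)], Close [(6,7),(0,5)], Close [(6,8),(0,5)], Close [(9,12),(3,4),(2,5),(0,1)], Ref
  hex8_24 [0,5,4,3,2,1,6,8,7,10,9,12,11,14,13,15] [1,0,2], Close [(12,13),(3,4),(2,5),(0,1)], Close
  [(12,14),(8,9),(7,10),(6,11),(3,4),(2,5),(0,1)], Ref hex8_28 [1,0,5,4,3,2,11,10,14,15,7,6,13,12,8,9]
  [0,1,2]]"])
    (simp_all only: cert_simps cong: cert_congs)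

definition hex8_31 :: pattern where [cert_simps]:
  "hex8_31 = (16,
    [[1,0,3,2,5,4,7,6,9,8,11,10,13,12,15,14],
     [5,2,1,4,3,0,8,10,6,12,7,14,9,15,11,13],
     [6,12,7,15,16,16,0,2,16,16,16,16,1,16,16,3]])"

lemma solved_hex8_31 [cert_simps]: "solved TYPE('a) False 8 hex8_31"
  by (rule solvedI[where x = "Split 2 10 [Close [(10,15),(8,9),(7,13),(6,12),(3,4),(2,5),(0,1)],
  Close [(7,10),(3,4),(2,5),(0,1)], Close [(8,10),(6,7)], Close
  [(8,13),(9,12),(7,10),(6,15),(4,5),(0,3),(1,2)], Close [(10,11)], Close
  [(10,15),(8,9),(7,13),(6,12),(4,5),(2,3),(0,1)], Close [(14,15),(8,9),(7,10),(6,12),(4,5),(2,3),(0,1)]]"])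
    (simp_all only: cert_simps cong: cert_congs)

text \<open>Distance 3 in the other direction, along 6, 8, 9, 12.\<close>

definition hex8_32 :: pattern where [cert_simps]:
  "hex8_32 = (16,
    [[1,0,3,2,5,4,7,6,9,8,11,10,13,12,15,14],
     [5,2,1,4,3,0,8,10,6,12,7,14,9,15,11,13],
     [6,12,7,16,16,16,0,2,16,16,16,16,1,16,16,16]])"

lemma solved_hex8_32 [cert_simps]: "solved TYPE('a) False 8 hex8_32"
  by (rule solvedI[where x = "Split 2 3 [Close [(3,4)], Close [(6,7),(2,3),(1,4),(0,5)], Close
  [(6,8),(4,5),(0,3),(1,2)], Ref hex8_27 [3,2,1,0,5,4,9,8,12,13,6,7,15,14,10,11] [0,1,2], Close
  [(7,10),(2,3)], Ref hex8_24 [2,3,4,5,0,1,7,6,10,11,8,9,14,15,12,13] [0,1,2], Close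
  [(8,9),(7,13),(6,12),(4,5),(2,3),(0,1)], Close [(10,11),(8,9),(7,14),(6,12),(4,5),(2,3),(0,1)], Ref hex8_31
  labels [0,1,2]]"])
    (simp_all only: cert_simps cong: cert_congs)

definition hex8_33 :: pattern where [cert_simps]:
  "hex8_33 = (16,
    [[1,0,3,2,5,4,7,6,9,8,11,10,13,12,15,14],
     [5,2,1,4,3,0,8,10,6,12,7,14,9,15,11,13],
     [6,12,10,16,16,14,0,16,16,16,2,16,1,16,5,16]])"

lemma solved_hex8_33 [cert_simps]: "solved TYPE('a) False 8 hex8_33"
  by (rule solvedI[where x = "Split 2 15 [Close [(10,15),(8,9),(7,13),(6,12),(4,5),(2,3),(0,1)],
  Close [(14,15),(4,5)], Close [(14,15),(8,9),(7,10),(6,12),(3,4),(2,5),(0,1)], Close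
  [(14,15),(10,12),(7,9),(6,8),(3,4),(1,2),(0,5)], Close [(12,13),(9,15)], Close
  [(14,15),(10,11),(8,9),(6,12),(3,4),(2,5),(0,1)], Close [(13,15)]]"])
    (simp_all only: cert_simps cong: cert_congs)

definition hex8_34 :: pattern where [cert_simps]:
  "hex8_34 = (16,
    [[1,0,3,2,5,4,7,6,9,8,11,10,13,12,15,14],
     [5,2,1,4,3,0,8,10,6,12,7,14,9,15,11,13],
     [6,12,10,16,16,16,0,16,16,16,2,16,1,16,16,16]])"

lemma solved_hex8_34 [cert_simps]: "solved TYPE('a) False 8 hex8_34"
  by (rule solvedI[where x = "Split 2 5 [Ref hex8_18 [5,4,3,2,1,0,16,16,16,16,16,16,16,16,16,16]
  [0,1,2], Close [(4,5)], Close [(6,7),(0,5)], Close [(6,8),(0,5)], Ref hex8_24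
  [5,0,1,2,3,4,9,12,8,6,13,15,7,10,14,11] [1,0,2], Close [(10,11),(3,4),(2,5),(0,1)], Ref hex8_32
  [1,0,5,4,3,2,12,13,9,8,15,14,6,7,11,10] [0,1,2], Ref hex8_33 labels [0,1,2], Close
  [(10,15),(8,9),(7,13),(6,12),(3,4),(2,5),(0,1)]]"])
    (simp_all only: cert_simps cong: cert_congs)

definition hex8_35 :: pattern where [cert_simps]:
  "hex8_35 = (16,
    [[1,0,3,2,5,4,7,6,9,8,11,10,13,12,15,14],
     [5,2,1,4,3,0,8,10,6,12,7,14,9,15,11,13],
     [6,13,7,15,8,16,0,2,4,16,16,16,16,1,16,3]])"

lemma solved_hex8_35 [cert_simps]: "solved TYPE('a) False 8 hex8_35"
  by (rule solvedI[where x = "Split 2 5 [Close [(8,9),(4,5)], Close [(7,10),(3,4),(2,5),(0,1)],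
  Close [(9,12),(8,13),(7,10),(6,11),(2,3),(1,4),(0,5)], Close [(8,15),(7,12),(6,13),(3,4),(2,5),(0,1)], Close
  [(13,15),(10,11),(8,14),(6,7),(4,5),(2,3),(0,1)]]"])
    (simp_all only: cert_simps cong: cert_congs)

definition hex8_36 :: pattern where [cert_simps]:
  "hex8_36 = (16,
    [[1,0,3,2,5,4,7,6,9,8,11,10,13,12,15,14],
     [5,2,1,4,3,0,8,10,6,12,7,14,9,15,11,13],
     [6,13,7,16,16,16,0,2,16,16,16,16,16,1,16,16]])"

lemma solved_hex8_36 [cert_simps]: "solved TYPE('a) False 8 hex8_36"
  by (rule solvedI[where x = "Split 2 3 [Close [(3,4)], Close [(6,7),(2,3),(1,4),(0,5)], Close
  [(6,8),(4,5),(0,3),(1,2)], Ref hex8_29 [3,2,1,0,5,4,9,8,12,13,6,7,15,14,10,11] [0,1,2], Close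
  [(7,10),(2,3)], Ref hex8_24 [2,3,4,5,0,1,7,6,10,11,8,9,14,15,12,13] [0,1,2], Close
  [(8,9),(7,13),(6,12),(4,5),(0,3),(1,2)], Ref hex8_34 [3,2,1,0,5,4,14,15,11,10,13,12,7,6,9,8] [0,1,2], Split
  2 4 [Close [(4,5)], Ref hex8_35 labels [0,1,2], Ref hex8_30 [4,3,2,1,0,5,9,12,8,6,13,15,7,10,14,11] [1,0,2],
  Close [(11,14),(10,15),(7,13),(3,4),(1,2),(0,5)], Ref hex8_24 [3,4,5,0,1,2,15,13,14,11,12,9,10,7,8,6]
  [1,0,2], Close [(12,13),(2,3),(1,4),(0,5)], Close [(14,15),(3,4)]]]"])
    (simp_all only: cert_simps cong: cert_congs)

text \<open>Distance 4 on the outer 10-cycle, along 6, 8, 9, 12, 13.\<close>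

definition hex8_37 :: pattern where [cert_simps]:
  "hex8_37 = (16,
    [[1,0,3,2,5,4,7,6,9,8,11,10,13,12,15,14],
     [5,2,1,4,3,0,8,10,6,12,7,14,9,15,11,13],
     [6,13,16,16,16,16,0,16,16,16,16,16,16,1,16,16]])"

lemma solved_hex8_37 [cert_simps]: "solved TYPE('a) False 8 hex8_37"
  by (rule solvedI[where x = "Split 2 2 [Close [(2,3)], Ref hex8_18
  [2,3,4,5,0,1,16,16,16,16,16,16,16,16,16,16] [0,1,2], Close [(2,5),(0,1)], Ref hex8_36 labels [0,1,2], Ref
  hex8_32 [2,1,0,5,4,3,8,6,9,12,7,10,13,15,11,14] [1,0,2], Ref hex8_24 [1,2,3,4,5,0,13,15,12,9,14,11,8,6,10,7]
  [1,0,2], Split 2 3 [Close [(3,4)], Ref hex8_18 [5,4,3,2,1,0,16,16,16,16,16,16,16,16,16,16] [0,1,2], Close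
  [(7,10),(2,3)], Close [(6,8),(4,5),(0,3),(1,2)], Split 2 4 [Close [(4,5)], Ref hex8_31
  [4,3,2,1,0,5,7,10,6,8,11,14,9,12,15,13] [1,0,2], Close [(8,9),(3,4)], Ref hex8_36
  [2,3,4,5,0,1,10,11,7,6,14,15,8,9,13,12] [0,1,2], Close [(9,12),(3,4)], Split 2 5 [Close [(6,7),(0,5)], Close
  [(6,8),(0,5)], Close [(11,14),(4,5)], Close [(8,9),(5,12),(4,14),(3,11),(2,10),(1,7),(0,6)], Close
  [(14,15),(4,5)]], Close [(13,15),(2,3),(1,4),(0,5)]], Close [(10,11),(2,3)], Split 2 4 [Close [(4,5)], Ref
  hex8_35 [4,3,2,1,0,5,7,10,6,8,11,14,9,12,15,13] [1,0,2], Ref hex8_24 [4,3,2,1,0,5,8,6,9,12,7,10,13,15,11,14]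
  [1,0,2], Close [(9,12),(3,4)], Close [(14,15),(11,13),(10,12),(2,3),(1,4),(0,5)], Ref hex8_34
  [4,3,2,1,0,5,14,11,15,13,10,7,12,9,6,8] [1,0,2], Close [(13,15),(2,3),(1,4),(0,5)]], Ref hex8_24
  [3,2,1,0,5,4,14,15,11,10,13,12,7,6,9,8] [0,1,2], Ref hex8_27 [3,2,1,0,5,4,15,14,13,12,11,10,9,8,7,6]
  [0,1,2]], Ref hex8_30 [2,1,0,5,4,3,11,14,10,7,15,13,6,8,12,9] [1,0,2], Close [(12,13),(1,2)], Ref hex8_24
  [2,1,0,5,4,3,14,11,15,13,10,7,12,9,6,8] [1,0,2], Close [(13,15),(1,2)]]"])
    (simp_all only: cert_simps cong: cert_congs)

text \<open>With 0 attached at 6, the edge at 1 decides. Chords of the hexagon and an attachment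
  next to 6 give a short cycle or an earlier pattern. On an outer 10-cycle the distances 2 to 5
  remain, up to reflection.\<close>

lemma solved_hexagon8 [cert_simps]: "solved TYPE('a) False 8 hexagon_pattern"
  by (rule solvedI[where x = "Split 2 0 [Close [(0,1)], Ref hex8_18 labels [0,1,2], Close
  [(1,2),(0,3)], Ref hex8_18 [4,5,0,1,2,3,16,16,16,16,16,16,16,16,16,16] [0,1,2], Close [(0,5)], Split 0 6
  [Split 1 6 [Close [(6,7)], Split 0 8 [Split 1 7 [Close [(8,9),(6,7)], Split 0 10 [Split 1 9 [Split 2 1
  [Close [(1,2)], Ref hex8_18 [3,2,1,0,5,4,16,16,16,16,16,16,16,16,16,16] [0,1,2], Close [(1,4),(0,5)], Ref
  hex8_1 [1,0,5,4,3,2,6,7,8,9,10,11,16,16,16,16] [0,1,2], Close [(6,7),(0,1)], Close [(6,8),(0,1)], Ref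
  hex8_19 labels [0,1,2], Ref hex8_19 [1,0,5,4,3,2,10,11,7,6,9,8,16,16,16,16] [0,1,2], Close
  [(8,9),(7,10),(6,11),(0,1)], Split 0 12 [Split 1 12 [Close [(12,13)], Split 0 14 [Split 1 13 [Close
  [(14,15),(12,13)]]]]]], Split 0 12 [Split 1 11 [Split 2 1 [Close [(1,2)], Ref hex8_18
  [3,2,1,0,5,4,16,16,16,16,16,16,16,16,16,16] [0,1,2], Close [(1,4),(0,5)], Ref hex8_3
  [1,0,5,4,3,2,6,7,8,9,10,11,12,13,16,16] [0,1,2], Close [(6,7),(0,1)], Close [(6,8),(0,1)], Ref hex8_20
  labels [0,1,2], Ref hex8_20 [1,0,5,4,3,2,10,11,7,6,13,12,8,9,16,16] [0,1,2], Close
  [(12,13),(8,9),(7,10),(6,11),(4,5),(2,3),(0,1)], Close [(10,11),(8,9),(7,13),(6,12),(4,5),(2,3),(0,1)],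
  Split 2 2 [Close [(2,3)], Ref hex8_18 [2,3,4,5,0,1,16,16,16,16,16,16,16,16,16,16] [0,1,2], Close
  [(2,5),(0,1)], Close [(10,11),(9,12),(7,13),(6,8),(3,4),(1,2),(0,5)], Close
  [(10,11),(9,12),(8,13),(6,7),(3,4),(1,2),(0,5)], Ref hex8_20 [1,2,3,4,5,0,13,11,12,9,10,7,8,6,16,16]
  [1,0,2], Ref hex8_20 [2,1,0,5,4,3,10,7,11,13,6,8,12,9,16,16] [1,0,2], Close [(11,13),(1,2)], Close
  [(12,13),(1,2)], Split 0 14 [Split 1 14 [Close [(14,15)]]]], Split 0 14 [Split 1 14 [Close [(14,15)]]]],
  Split 0 14 [Split 1 13 [Split 2 1 [Close [(1,2)], Ref hex8_18 [3,2,1,0,5,4,16,16,16,16,16,16,16,16,16,16]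
  [0,1,2], Close [(1,4),(0,5)], Ref hex8_16 [1,0,5,4,3,2,6,7,8,9,10,11,12,13,14,15] [0,1,2], Close
  [(6,7),(0,1)], Close [(6,8),(0,1)], Ref hex8_24 labels [0,1,2], Ref hex8_24
  [1,0,5,4,3,2,10,11,7,6,14,15,8,9,13,12] [0,1,2], Split 2 2 [Close [(2,3)], Ref hex8_18
  [2,3,4,5,0,1,16,16,16,16,16,16,16,16,16,16] [0,1,2], Close [(2,5),(0,1)], Ref hex8_24
  [1,2,3,4,5,0,11,14,10,7,15,13,6,8,12,9] [1,0,2], Ref hex8_27 labels [0,1,2], Ref hex8_29 labels [0,1,2],
  Close [(10,11),(1,2)], Ref hex8_30 labels [0,1,2], Split 2 3 [Close [(3,4)], Ref hex8_18
  [5,4,3,2,1,0,16,16,16,16,16,16,16,16,16,16] [0,1,2], Close [(6,7),(4,5),(0,3),(1,2)], Close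
  [(6,8),(4,5),(0,3),(1,2)], Ref hex8_24 [3,2,1,0,5,4,9,8,12,13,6,7,15,14,10,11] [0,1,2], Ref hex8_25
  [1,2,3,4,5,0,11,14,10,7,15,13,6,8,12,9] [1,0,2], Close [(12,13),(2,3)], Ref hex8_24
  [2,3,4,5,0,1,13,12,15,14,9,8,11,10,6,7] [0,1,2], Close [(13,15),(2,3)]], Close [(11,14),(1,2)], Ref hex8_24
  [2,1,0,5,4,3,15,13,14,11,12,9,10,7,8,6] [1,0,2]], Split 2 2 [Close [(2,3)], Ref hex8_18
  [2,3,4,5,0,1,16,16,16,16,16,16,16,16,16,16] [0,1,2], Close [(2,5),(0,1)], Ref hex8_32 labels [0,1,2], Ref
  hex8_24 [2,1,0,5,4,3,8,6,9,12,7,10,13,15,11,14] [1,0,2], Close [(9,12),(1,2)], Ref hex8_34 labels [0,1,2],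
  Split 2 5 [Ref hex8_18 [5,4,3,2,1,0,16,16,16,16,16,16,16,16,16,16] [0,1,2], Close [(4,5)], Close
  [(6,7),(0,5)], Close [(6,8),(0,5)], Ref hex8_24 [5,0,1,2,3,4,9,12,8,6,13,15,7,10,14,11] [1,0,2], Close
  [(10,11),(3,4),(2,5),(0,1)], Close [(11,13),(8,9),(7,10),(6,12),(3,4),(2,5),(0,1)], Close
  [(11,14),(3,4),(2,5),(0,1)], Ref hex8_33 [1,0,5,4,3,2,12,13,9,8,15,14,6,7,11,10] [0,1,2]], Close
  [(12,13),(1,2)], Split 2 3 [Close [(3,4)], Ref hex8_18 [5,4,3,2,1,0,16,16,16,16,16,16,16,16,16,16] [0,1,2],
  Close [(6,7),(4,5),(0,3),(1,2)], Close [(6,8),(4,5),(0,3),(1,2)], Ref hex8_32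
  [1,2,3,4,5,0,12,9,13,15,8,6,14,11,7,10] [1,0,2], Ref hex8_24 [2,3,4,5,0,1,14,15,11,10,13,12,7,6,9,8]
  [0,1,2], Close [(11,14),(2,3)], Ref hex8_24 [3,2,1,0,5,4,13,12,15,14,9,8,11,10,6,7] [0,1,2], Close
  [(14,15),(2,3)]], Ref hex8_24 [1,2,3,4,5,0,12,9,13,15,8,6,14,11,7,10] [1,0,2]], Ref hex8_37 labels [0,1,2],
  Ref hex8_37 [1,0,5,4,3,2,14,15,11,10,13,12,7,6,9,8] [0,1,2], Split 2 2 [Close [(2,3)], Ref hex8_18
  [2,3,4,5,0,1,16,16,16,16,16,16,16,16,16,16] [0,1,2], Close [(2,5),(0,1)], Ref hex8_37
  [1,2,3,4,5,0,15,13,14,11,12,9,10,7,8,6] [1,0,2], Ref hex8_36 [2,1,0,5,4,3,8,6,9,12,7,10,13,15,11,14]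
  [1,0,2], Ref hex8_29 [2,1,0,5,4,3,9,12,8,6,13,15,7,10,14,11] [1,0,2], Ref hex8_34
  [2,1,0,5,4,3,10,7,11,14,6,8,15,13,9,12] [1,0,2], Ref hex8_24 [1,2,3,4,5,0,15,13,14,11,12,9,10,7,8,6]
  [1,0,2], Ref hex8_24 [2,1,0,5,4,3,12,9,13,15,8,6,14,11,7,10] [1,0,2], Close [(13,15),(1,2)], Close
  [(14,15),(1,2)]]]]]]]]]]]]]]"])
    (simp_all only: cert_simps cong: cert_congs)

text \<open>The octagon search runs with the flag \<open>True\<close>, since it may end in the
  exceptional graph; hexagons cited there need the same flag.\<close>

lemmas [cert_simps] = solved_hexagon8[THEN solved_weaken, of True]

section \<open>Octagonal faces on 16 vertices\<close>

definition oct8_1 :: pattern where [cert_simps]: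
  "oct8_1 = (16,
    [[1,0,3,2,5,4,7,6,9,8,11,10,13,12,15,14],
     [7,2,1,4,3,6,5,0,10,12,8,14,9,15,11,13],
     [2,8,0,10,6,9,4,14,1,5,3,16,16,16,7,16]])"

lemma solved_oct8_1 [cert_simps]: "solved TYPE('a) True 8 oct8_1"
  by (rule solvedI[where x = "Split 2 11 [Close [(12,14),(9,11),(8,10),(6,7),(4,5),(2,3),(0,1)],
  Close [(14,15),(11,13)], Close [(14,15),(9,11),(8,10),(6,7),(4,5),(2,3),(0,1)]]"])
    (simp_all only: cert_simps cong: cert_congs)

definition oct8_2 :: pattern where [cert_simps]:
  "oct8_2 = (16,
    [[1,0,3,2,5,4,7,6,9,8,11,10,13,12,15,14],
     [7,2,1,4,3,6,5,0,10,12,8,14,9,15,11,13],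
     [2,8,0,10,6,13,4,9,1,7,3,16,16,5,16,16]])"

lemma solved_oct8_2 [cert_simps]: "solved TYPE('a) True 8 oct8_2"
  by (rule solvedI[where x = "Split 2 11 [Close [(12,13),(9,11),(8,10),(6,7),(4,5),(2,3),(0,1)],
  Close [(11,14)], Close [(13,15),(9,11),(8,10),(6,7),(4,5),(2,3),(0,1)]]"])
    (simp_all only: cert_simps cong: cert_congs)

definition oct8_3 :: pattern where [cert_simps]:
  "oct8_3 = (16,
    [[1,0,3,2,5,4,7,6,9,8,11,10,13,12,15,14],
     [7,2,1,4,3,6,5,0,10,12,8,14,9,15,11,13],
     [2,8,0,10,6,16,4,16,1,16,3,16,16,16,16,16]])"

lemma solved_oct8_3 [cert_simps]: "solved TYPE('a) True 8 oct8_3"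
  by (rule solvedI[where x = "Split 2 9 [Split 2 7 [Close
  [(9,11),(8,10),(6,7),(4,5),(2,3),(0,1)], Close [(9,12),(8,10),(6,7),(4,5),(2,3),(0,1)], Split 2 11 [Close
  [(12,13),(9,11),(8,10),(6,7),(4,5),(2,3),(0,1)], Close [(11,14)], Close
  [(13,15),(9,11),(8,10),(6,7),(4,5),(2,3),(0,1)]], Ref oct8_1 labels [0,1,2], Close
  [(11,14),(9,15),(8,10),(6,7),(4,5),(2,3),(0,1)]], Split 2 5 [Close [(9,11),(8,10),(6,7),(4,5),(2,3),(0,1)],
  Close [(9,12),(8,10),(6,7),(4,5),(2,3),(0,1)], Ref oct8_2 labels [0,1,2], Ref oct8_2
  [2,1,0,7,6,5,4,3,8,10,9,12,11,14,13,15] [1,0,2], Close [(11,14),(9,15),(8,10),(6,7),(4,5),(2,3),(0,1)]],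
  Close [(9,11),(8,10)], Close [(9,12)], Split 2 11 [Split 2 7 [Close
  [(12,13),(9,11),(8,10),(6,7),(4,5),(2,3),(0,1)], Close [(11,14),(8,10),(6,7),(4,5),(2,3),(0,1)], Close
  [(13,15),(9,11),(8,10),(6,7),(4,5),(2,3),(0,1)]], Split 2 5 [Close
  [(12,13),(9,11),(8,10),(6,7),(4,5),(2,3),(0,1)], Close [(11,14),(8,10),(6,7),(4,5),(2,3),(0,1)], Close
  [(13,15),(9,11),(8,10),(6,7),(4,5),(2,3),(0,1)]], Close [(14,15),(12,13),(9,11),(8,10)], Close [(11,14)],
  Close [(13,15),(12,14),(9,11),(8,10)]], Split 2 11 [Split 2 7 [Close
  [(12,14),(9,11),(8,10),(6,7),(4,5),(2,3),(0,1)], Close [(11,13),(9,12),(8,10),(6,7),(4,5),(2,3),(0,1)],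
  Close [(14,15),(9,11),(8,10),(6,7),(4,5),(2,3),(0,1)]], Split 2 5 [Close
  [(12,14),(9,11),(8,10),(6,7),(4,5),(2,3),(0,1)], Close [(11,13),(9,12),(8,10),(6,7),(4,5),(2,3),(0,1)],
  Close [(14,15),(9,11),(8,10),(6,7),(4,5),(2,3),(0,1)]], Close [(11,14),(9,12)], Close [(14,15),(11,13)],
  Close [(14,15),(12,13),(9,11),(8,10)]], Close [(12,13),(9,15)]]"])
    (simp_all only: cert_simps cong: cert_congs)

definition oct8_4 :: pattern where [cert_simps]:
  "oct8_4 = (16,
    [[1,0,3,2,5,4,7,6,9,8,11,10,13,12,15,14],
     [7,2,1,4,3,6,5,0,10,12,8,14,9,15,11,13],
     [2,8,0,10,9,16,16,16,1,4,3,16,16,16,16,16]])"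

lemma solved_oct8_4 [cert_simps]: "solved TYPE('a) True 8 oct8_4"
  by (rule solvedI[where x = "Split 2 5 [Close [(5,6)], Close [(3,4),(2,5),(1,6),(0,7)], Close
  [(9,11),(8,10),(6,7),(4,5),(2,3),(0,1)], Close [(9,12),(4,5)], Split 2 11 [Close
  [(11,13),(9,12),(8,10),(5,6),(4,7),(2,3),(0,1)], Close [(9,11),(8,10),(5,6),(4,7),(2,3),(0,1)], Close
  [(12,13),(9,11),(8,10),(6,7),(4,5),(2,3),(0,1)], Close [(11,14)], Close
  [(13,15),(9,11),(8,10),(6,7),(4,5),(2,3),(0,1)]], Split 2 11 [Close [(11,14),(5,6)], Close
  [(9,11),(8,10),(5,6),(4,7),(2,3),(0,1)], Close [(12,14),(9,11),(8,10),(6,7),(4,5),(2,3),(0,1)], Close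
  [(14,15),(11,13)], Close [(14,15),(9,11),(8,10),(6,7),(4,5),(2,3),(0,1)]], Close
  [(11,14),(9,15),(8,10),(6,7),(4,5),(2,3),(0,1)]]"])
    (simp_all only: cert_simps cong: cert_congs)

definition oct8_5 :: pattern where [cert_simps]:
  "oct8_5 = (16,
    [[1,0,3,2,5,4,7,6,9,8,11,10,13,12,15,14],
     [7,2,1,4,3,6,5,0,10,12,8,14,9,15,11,13],
     [2,8,0,10,16,16,16,16,1,16,3,16,16,16,16,16]])"

lemma solved_oct8_5 [cert_simps]: "solved TYPE('a) True 8 oct8_5"
  by (rule solvedI[where x = "Split 2 4 [Close [(4,5)], Ref oct8_3 labels [0,1,2], Close
  [(5,6),(4,7)], Ref oct8_4 labels [0,1,2], Close [(10,11),(3,4)], Split 2 5 [Close [(5,6)], Close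
  [(3,4),(2,5),(1,6),(0,7)], Close [(9,12),(4,5)], Split 2 9 [Close [(9,11),(8,10),(5,6),(4,7),(2,3),(0,1)],
  Close [(9,12),(8,10),(5,6),(4,7),(2,3),(0,1)], Close [(12,13),(9,11),(8,10),(6,7),(4,5),(2,3),(0,1)], Close
  [(12,14),(9,11),(8,10),(6,7),(4,5),(2,3),(0,1)], Close [(12,13),(9,15)]], Close [(12,13),(4,5)], Close
  [(12,14),(9,11),(8,10),(6,7),(4,5),(2,3),(0,1)], Split 2 9 [Close [(10,12),(8,9),(3,4),(2,5),(1,6),(0,7)],
  Close [(9,12),(8,10),(5,6),(4,7),(2,3),(0,1)], Close [(9,11),(8,10)], Close
  [(13,15),(9,12),(8,10),(6,7),(4,5),(2,3),(0,1)], Close [(14,15),(9,12),(8,10),(6,7),(4,5),(2,3),(0,1)]]],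
  Split 2 5 [Close [(5,6)], Close [(3,4),(2,5),(1,6),(0,7)], Split 2 11 [Close
  [(9,11),(8,10),(5,6),(4,7),(2,3),(0,1)], Close [(11,13),(9,12),(8,10),(5,6),(4,7),(2,3),(0,1)], Close
  [(12,13),(9,11),(8,10),(6,7),(4,5),(2,3),(0,1)], Close [(11,14)], Close
  [(13,15),(9,11),(8,10),(6,7),(4,5),(2,3),(0,1)]], Close [(11,13),(9,12),(8,10),(6,7),(4,5),(2,3),(0,1)],
  Close [(12,13),(4,5)], Split 2 11 [Close [(11,14),(5,6)], Close
  [(11,13),(9,12),(8,10),(5,6),(4,7),(2,3),(0,1)], Close [(9,11),(8,10)], Close
  [(12,13),(11,14),(8,10),(6,7),(4,5),(2,3),(0,1)], Close [(13,15),(11,14),(8,10),(6,7),(4,5),(2,3),(0,1)]],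
  Close [(13,15),(4,5)]], Split 2 5 [Close [(5,6)], Close [(3,4),(2,5),(1,6),(0,7)], Split 2 7 [Close [(6,7)],
  Close [(11,14),(8,10),(5,6),(4,7),(2,3),(0,1)], Close [(12,14),(9,11),(8,10),(5,6),(4,7),(2,3),(0,1)], Close
  [(7,13),(5,9),(0,15),(4,8),(1,14),(2,11),(3,10)], Close [(14,15),(8,10),(5,6),(4,7),(2,3),(0,1)]], Close
  [(11,14),(4,5)], Close [(12,14),(9,11),(8,10),(6,7),(4,5),(2,3),(0,1)], Split 2 11 [Close
  [(11,13),(9,12),(8,10),(5,6),(4,7),(2,3),(0,1)], Close [(11,14),(8,10),(5,6),(4,7),(2,3),(0,1)], Close
  [(9,11),(8,10)], Close [(12,13),(11,14),(8,10),(6,7),(4,5),(2,3),(0,1)], Close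
  [(13,15),(11,14),(8,10),(6,7),(4,5),(2,3),(0,1)]], Close [(14,15),(4,5)]], Split 2 5 [Close [(5,6)], Close
  [(3,4),(2,5),(1,6),(0,7)], Close [(11,14),(9,15),(8,10),(6,7),(4,5),(2,3),(0,1)], Split 2 9 [Close
  [(9,11),(8,10),(5,6),(4,7),(2,3),(0,1)], Close [(11,14),(9,15),(8,10),(5,6),(4,7),(2,3),(0,1)], Close
  [(9,12)], Close [(13,15),(9,11),(8,10),(6,7),(4,5),(2,3),(0,1)], Close
  [(14,15),(9,11),(8,10),(6,7),(4,5),(2,3),(0,1)]], Split 2 9 [Close [(9,12),(5,6)], Close
  [(11,14),(9,15),(8,10),(5,6),(4,7),(2,3),(0,1)], Close [(9,11),(8,10)], Close
  [(13,15),(9,12),(8,10),(6,7),(4,5),(2,3),(0,1)], Close [(14,15),(9,12),(8,10),(6,7),(4,5),(2,3),(0,1)]],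
  Close [(13,15),(4,5)], Close [(14,15),(4,5)]]]"])
    (simp_all only: cert_simps cong: cert_congs)

definition oct8_6 :: pattern where [cert_simps]:
  "oct8_6 = (16,
    [[1,0,3,2,5,4,7,6,9,8,11,10,13,12,15,14],
     [7,2,1,4,3,6,5,0,10,12,8,14,9,15,11,13],
     [2,8,0,11,15,16,16,12,1,16,16,3,7,16,16,4]])"

lemma solved_oct8_6 [cert_simps]: "solved TYPE('a) True 8 oct8_6"
  by (rule solvedI[where x = "Split 2 14 [Close [(14,15),(4,5)], Close
  [(7,12),(6,14),(4,5),(3,11),(2,10),(0,9),(1,8)], Close [(11,12),(9,14),(8,15),(5,6),(1,4),(2,3),(0,7)], Ref
  oct8_5 [10,11,14,15,13,12,9,8,3,2,4,5,1,0,6,7] [0,1,2], Close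
  [(13,15),(7,12),(4,14),(3,11),(2,10),(0,9),(1,8)]]"])
    (simp_all only: cert_simps cong: cert_congs)

definition oct8_7 :: pattern where [cert_simps]:
  "oct8_7 = (16,
    [[1,0,3,2,5,4,7,6,9,8,11,10,13,12,15,14],
     [7,2,1,4,3,6,5,0,10,12,8,14,9,15,11,13],
     [2,8,0,11,16,16,16,13,1,16,16,3,16,7,16,16]])"

lemma solved_oct8_7 [cert_simps]: "solved TYPE('a) True 8 oct8_7"
  by (rule solvedI[where x = "Split 2 6 [Split 2 5 [Close
  [(11,13),(10,12),(8,9),(6,7),(2,5),(3,4),(0,1)], Close [(10,11),(9,12),(8,13),(4,5),(3,6),(2,7),(0,1)],
  Close [(4,13),(6,7),(5,12),(3,11),(2,10),(0,9),(1,8)], Close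
  [(11,14),(9,12),(8,13),(4,5),(3,6),(2,7),(0,1)], Ref oct8_3 [4,5,6,7,0,1,2,3,15,14,13,12,11,10,9,8]
  [0,1,2]], Close [(5,6)], Close [(11,13),(10,12),(8,9),(4,5),(2,3),(1,6),(0,7)], Close
  [(10,11),(9,12),(8,13),(4,5),(3,6),(2,7),(0,1)], Close [(12,13),(6,7)], Close
  [(11,14),(9,12),(8,13),(4,5),(3,6),(2,7),(0,1)], Close [(13,15),(6,7)]]"])
    (simp_all only: cert_simps cong: cert_congs)

definition oct8_8 :: pattern where [cert_simps]:
  "oct8_8 = (16,
    [[1,0,3,2,5,4,7,6,9,8,11,10,13,12,15,14],
     [7,2,1,4,3,6,5,0,10,12,8,14,9,15,11,13],
     [2,8,0,11,16,16,16,14,1,16,16,3,16,16,7,16]])"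

lemma solved_oct8_8 [cert_simps]: "solved TYPE('a) True 8 oct8_8"
  by (rule solvedI[where x = "Split 2 6 [Split 2 5 [Close
  [(11,14),(8,9),(6,7),(2,5),(3,4),(0,1)], Close [(10,11),(8,14),(4,5),(3,6),(2,7),(0,1)], Close
  [(5,12),(6,7),(4,14),(3,11),(2,10),(0,9),(1,8)], Close [(11,14),(9,12),(8,13),(6,7),(2,5),(3,4),(0,1)],
  Close [(6,7),(5,15),(4,14),(3,11)]], Close [(5,6)], Close [(11,14),(8,9),(4,5),(2,3),(1,6),(0,7)], Close
  [(10,11),(8,14),(4,5),(3,6),(2,7),(0,1)], Split 2 9 [Close [(11,14),(8,9),(5,6),(1,4),(2,3),(0,7)], Close
  [(9,12),(5,6)], Close [(3,11),(2,10),(0,9),(1,8)], Close [(12,13),(11,14),(8,9),(4,5),(2,3),(1,6),(0,7)],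
  Close [(12,13),(9,15)]], Close [(11,14),(9,12),(8,13),(4,5),(2,3),(1,6),(0,7)], Close [(14,15),(6,7)]]"])
    (simp_all only: cert_simps cong: cert_congs)

definition oct8_9 :: pattern where [cert_simps]:
  "oct8_9 = (16,
    [[1,0,3,2,5,4,7,6,9,8,11,10,13,12,15,14],
     [7,2,1,4,3,6,5,0,10,12,8,14,9,15,11,13],
     [2,8,0,11,16,16,16,15,1,16,16,3,16,16,16,7]])"

lemma solved_oct8_9 [cert_simps]: "solved TYPE('a) True 8 oct8_9"
  by (rule solvedI[where x = "Split 2 10 [Close [(10,11),(3,4)], Split 2 4 [Ref oct8_1
  [6,5,4,3,2,1,0,7,10,8,11,14,9,12,15,13] [1,0,2], Close [(9,11),(8,10),(6,7),(2,5),(3,4),(0,1)], Split 2 6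
  [Close [(10,12),(8,9),(4,5),(2,3),(1,6),(0,7)], Close [(13,15),(6,7)], Close [(14,15),(6,7)]], Close
  [(11,13),(9,12),(8,10),(6,7),(2,5),(3,4),(0,1)], Close [(11,14),(3,4)]], Split 2 9 [Close
  [(9,11),(8,10),(3,4),(2,5),(1,6),(0,7)], Close [(11,14),(10,15),(8,9),(6,7),(2,5),(3,4),(0,1)], Close
  [(9,12)], Close [(13,15),(10,11),(8,9),(4,5),(3,6),(2,7),(0,1)], Close
  [(10,15),(11,14),(8,9),(6,7),(4,5),(2,3),(0,1)]], Close [(3,11),(2,10),(0,9),(1,8)], Close [(10,12),(8,9)],
  Close [(9,12),(7,15),(3,11),(0,13),(2,10),(1,8)], Split 2 4 [Close [(4,5)], Split 2 5 [Close
  [(9,15),(11,14),(8,10),(6,7),(4,5),(2,3),(0,1)], Close [(14,15),(6,9),(5,12),(3,11),(2,10),(1,8),(0,7)],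
  Close [(13,15),(11,14),(8,10),(6,7),(4,5),(2,3),(0,1)]], Close
  [(9,15),(11,14),(8,10),(5,6),(4,7),(2,3),(0,1)], Split 2 5 [Close [(5,6)], Close [(9,12),(4,5)], Close
  [(12,13),(4,5)]], Close [(14,15),(4,13),(3,11),(2,10),(1,8),(0,7)]]]"])
    (simp_all only: cert_simps cong: cert_congs)

definition oct8_10 :: pattern where [cert_simps]:
  "oct8_10 = (16,
    [[1,0,3,2,5,4,7,6,9,8,11,10,13,12,15,14],
     [7,2,1,4,3,6,5,0,10,12,8,14,9,15,11,13],
     [2,8,0,11,16,16,16,16,1,16,16,3,16,16,16,16]])"

lemma solved_oct8_10 [cert_simps]: "solved TYPE('a) True 8 oct8_10"
  by (rule solvedI[where x = "Split 2 7 [Close [(5,6),(4,7)], Close [(3,4),(2,5),(1,6),(0,7)],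
  Close [(6,7)], Ref oct8_5 [2,1,0,7,6,5,4,3,8,10,9,12,11,14,13,15] [1,0,2], Close
  [(3,11),(2,10),(1,8),(0,7)], Split 2 15 [Ref oct8_6 labels [0,1,2], Close
  [(7,12),(5,15),(4,14),(3,11),(2,10),(0,9),(1,8)], Ref oct8_6 [2,1,0,7,6,5,4,3,8,10,9,12,11,14,13,15]
  [1,0,2], Close [(12,13),(9,15)], Close [(11,14),(10,15)], Close [(13,15)], Close [(14,15)]], Ref oct8_7
  labels [0,1,2], Ref oct8_8 labels [0,1,2], Ref oct8_9 labels [0,1,2]]"])
    (simp_all only: cert_simps cong: cert_congs)

definition oct8_11 :: pattern where [cert_simps]:
  "oct8_11 = (16,
    [[1,0,3,2,5,4,7,6,9,8,11,10,13,12,15,14],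
     [7,2,1,4,3,6,5,0,10,12,8,14,9,15,11,13],
     [2,8,0,12,10,16,16,11,1,16,4,7,3,16,16,16]])"

lemma solved_oct8_11 [cert_simps]: "solved TYPE('a) True 8 oct8_11"
  by (rule solvedI[where x = "Split 2 9 [Close [(10,12),(8,9),(6,7),(2,5),(3,4),(0,1)], Close
  [(10,12),(8,9),(3,4),(2,5),(1,6),(0,7)], Close [(12,13),(10,11),(8,9),(5,6),(4,7),(2,3),(0,1)], Close
  [(12,14),(10,11),(8,9),(5,6),(4,7),(2,3),(0,1)], Close [(12,13),(9,15)]]"])
    (simp_all only: cert_simps cong: cert_congs)

definition oct8_12 :: pattern where [cert_simps]:
  "oct8_12 = (16,
    [[1,0,3,2,5,4,7,6,9,8,11,10,13,12,15,14],
     [7,2,1,4,3,6,5,0,10,12,8,14,9,15,11,13],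
     [2,8,0,12,14,16,16,11,1,16,16,7,3,16,4,16]])"

lemma solved_oct8_12 [cert_simps]: "solved TYPE('a) True 8 oct8_12"
  by (rule solvedI[where x = "Split 2 5 [Close [(5,6)], Close
  [(12,14),(10,11),(8,9),(6,7),(2,5),(3,4),(0,1)], Close [(12,14),(9,11),(8,10),(6,7),(2,5),(3,4),(0,1)],
  Close [(12,13),(10,11),(8,14),(6,7),(0,5),(1,4),(2,3)], Close [(14,15),(4,5)]]"])
    (simp_all only: cert_simps cong: cert_congs)

definition oct8_13 :: pattern where [cert_simps]:
  "oct8_13 = (16,
    [[1,0,3,2,5,4,7,6,9,8,11,10,13,12,15,14],
     [7,2,1,4,3,6,5,0,10,12,8,14,9,15,11,13],
     [2,8,0,12,6,11,4,13,1,16,16,5,3,7,16,16]])"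

lemma solved_oct8_13 [cert_simps]: "solved TYPE('a) True 8 oct8_13"
  by (rule solvedI[where x = "Split 2 9 [Close [(11,13),(10,12),(8,9),(6,7),(4,5),(2,3),(0,1)],
  Close [(11,14),(9,12),(8,13),(4,5),(3,6),(2,7),(0,1)], Close [(12,13),(9,15)]]"])
    (simp_all only: cert_simps cong: cert_congs)

definition oct8_14 :: pattern where [cert_simps]:
  "oct8_14 = (16,
    [[1,0,3,2,5,4,7,6,9,8,11,10,13,12,15,14],
     [7,2,1,4,3,6,5,0,10,12,8,14,9,15,11,13],
     [2,8,0,12,16,16,16,13,1,16,16,16,3,7,16,16]])"

lemma solved_oct8_14 [cert_simps]: "solved TYPE('a) True 8 oct8_14"
  by (rule solvedI[where x = "Split 2 6 [Split 2 5 [Close [(7,13),(6,12),(5,9),(3,4)], Close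
  [(12,13),(8,10),(6,7),(2,5),(3,4),(0,1)], Ref oct8_13 labels [0,1,2], Close
  [(12,13),(10,11),(8,14),(6,7),(2,5),(3,4),(0,1)], Ref oct8_3 [4,5,6,7,0,1,2,3,15,14,13,12,11,10,9,8]
  [0,1,2]], Close [(5,6)], Close [(9,12),(8,13),(4,5),(3,6),(2,7),(0,1)], Close
  [(12,13),(8,10),(4,5),(2,3),(1,6),(0,7)], Split 2 9 [Close [(9,12),(3,4)], Close
  [(11,13),(10,12),(8,9),(6,7),(2,5),(3,4),(0,1)], Close [(11,13),(10,12),(8,9),(6,7),(4,5),(2,3),(0,1)],
  Close [(11,14),(9,12),(8,13),(4,5),(3,6),(2,7),(0,1)], Close [(12,13),(9,15)]], Close
  [(12,13),(10,11),(8,14),(4,5),(2,3),(1,6),(0,7)], Close [(13,15),(6,7)]]"])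
    (simp_all only: cert_simps cong: cert_congs)

definition oct8_15 :: pattern where [cert_simps]:
  "oct8_15 = (16,
    [[1,0,3,2,5,4,7,6,9,8,11,10,13,12,15,14],
     [7,2,1,4,3,6,5,0,10,12,8,14,9,15,11,13],
     [2,8,0,12,16,16,16,14,1,16,16,16,3,16,7,16]])"

lemma solved_oct8_15 [cert_simps]: "solved TYPE('a) True 8 oct8_15"
  by (rule solvedI[where x = "Split 2 6 [Split 2 5 [Close
  [(10,11),(9,12),(8,14),(4,5),(3,6),(2,7),(0,1)], Close [(12,14),(9,11),(8,10),(6,7),(2,5),(3,4),(0,1)], Ref
  oct8_3 [4,5,6,7,0,1,2,3,11,10,14,15,8,9,13,12] [0,1,2], Close
  [(12,13),(10,11),(8,14),(4,5),(3,6),(2,7),(0,1)], Ref hexagon_pattern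
  [4,5,15,14,7,6,16,16,16,16,16,16,16,16,16,16] [0,2,1]], Close [(5,6)], Close
  [(10,11),(9,12),(8,14),(4,5),(3,6),(2,7),(0,1)], Close [(12,14),(9,11),(8,10),(4,5),(2,3),(1,6),(0,7)],
  Close [(11,14),(6,7)], Close [(12,13),(10,11),(8,14),(4,5),(3,6),(2,7),(0,1)], Close [(14,15),(6,7)]]"])
    (simp_all only: cert_simps cong: cert_congs)

definition oct8_16 :: pattern where [cert_simps]:
  "oct8_16 = (16,
    [[1,0,3,2,5,4,7,6,9,8,11,10,13,12,15,14],
     [7,2,1,4,3,6,5,0,10,12,8,14,9,15,11,13],
     [2,8,0,12,6,16,4,15,1,16,16,16,3,16,16,7]])"

lemma solved_oct8_16 [cert_simps]: "solved TYPE('a) True 8 oct8_16"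
  by (rule solvedI[where x = "Split 2 11 [Ref oct8_9 [4,5,6,7,0,1,2,3,11,10,14,15,8,9,13,12]
  [0,1,2], Close [(9,11),(8,10)], Close [(10,11)], Close [(14,15),(11,13)], Close [(11,14)]]"])
    (simp_all only: cert_simps cong: cert_congs)

definition oct8_17 :: pattern where [cert_simps]:
  "oct8_17 = (16,
    [[1,0,3,2,5,4,7,6,9,8,11,10,13,12,15,14],
     [7,2,1,4,3,6,5,0,10,12,8,14,9,15,11,13],
     [2,8,0,12,16,16,16,15,1,16,16,16,3,16,16,7]])"

lemma solved_oct8_17 [cert_simps]: "solved TYPE('a) True 8 oct8_17"
  by (rule solvedI[where x = "Split 2 6 [Ref oct8_16 labels [0,1,2], Close [(5,6)], Split 2 10
  [Close [(10,12),(8,9),(3,4),(2,5),(1,6),(0,7)], Close [(11,14),(9,15),(8,10),(6,7),(2,5),(3,4),(0,1)], Close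
  [(10,11)], Close [(9,15),(12,13),(8,10),(6,7),(4,5),(2,3),(0,1)], Close
  [(14,15),(9,12),(8,10),(4,5),(3,6),(2,7),(0,1)]], Split 2 5 [Close [(4,5)], Close
  [(11,14),(10,15),(8,9),(6,7),(2,5),(3,4),(0,1)], Close [(10,11),(5,6)], Close
  [(13,15),(8,10),(3,4),(2,5),(1,6),(0,7)], Close [(14,15),(8,10),(3,4),(2,5),(1,6),(0,7)]], Split 2 10 [Split
  2 5 [Close [(10,12),(8,9),(6,7),(2,5),(3,4),(0,1)], Close [(12,13),(8,10),(6,7),(0,5),(1,4),(2,3)], Close
  [(11,14),(5,6)]], Close [(10,11),(5,6)], Ref oct8_15 [10,8,9,12,13,15,14,11,1,2,0,7,3,4,6,5] [1,0,2], Close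
  [(11,12),(10,13),(8,15),(4,5),(3,6),(2,7),(0,1)], Ref hexagon_pattern
  [6,7,15,14,10,11,16,16,16,16,16,16,16,16,16,16] [0,2,1]], Close [(13,15),(6,7)], Close [(14,15),(6,7)]]"])
    (simp_all only: cert_simps cong: cert_congs)

definition oct8_18 :: pattern where [cert_simps]:
  "oct8_18 = (16,
    [[1,0,3,2,5,4,7,6,9,8,11,10,13,12,15,14],
     [7,2,1,4,3,6,5,0,10,12,8,14,9,15,11,13],
     [2,8,0,13,16,16,16,15,1,16,16,16,16,3,16,7]])"

lemma solved_oct8_18 [cert_simps]: "solved TYPE('a) True 8 oct8_18"
  by (rule solvedI[where x = "Split 2 4 [Close [(4,5)], Split 2 5 [Close
  [(13,15),(8,9),(6,7),(2,5),(3,4),(0,1)], Close [(13,15),(8,10),(6,7),(2,5),(3,4),(0,1)], Close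
  [(6,14),(5,11),(4,10),(7,15),(0,13),(2,3),(1,8)], Ref oct8_3 [6,5,4,3,2,1,0,7,12,9,13,15,8,10,14,11]
  [1,0,2], Close [(6,7),(5,14),(4,15),(3,13)]], Close [(13,15),(8,9),(5,6),(1,4),(2,3),(0,7)], Close
  [(13,15),(8,10),(5,6),(1,4),(2,3),(0,7)], Split 2 9 [Close [(11,13),(10,12),(8,9),(6,7),(2,5),(3,4),(0,1)],
  Close [(13,15),(8,9),(4,5),(2,3),(1,6),(0,7)], Close [(13,15),(10,11),(8,9),(5,6),(1,4),(2,3),(0,7)], Close
  [(9,12)], Close [(11,13),(14,15),(8,9),(5,6),(3,4),(2,7),(0,1)]], Close [(12,13),(3,4)], Close
  [(14,15),(9,12),(8,13),(5,6),(4,7),(2,3),(0,1)]]"])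
    (simp_all only: cert_simps cong: cert_congs)

definition oct8_19 :: pattern where [cert_simps]:
  "oct8_19 = (16,
    [[1,0,3,2,5,4,7,6,9,8,11,10,13,12,15,14],
     [7,2,1,4,3,6,5,0,10,12,8,14,9,15,11,13],
     [2,8,0,13,16,16,16,16,1,16,16,16,16,3,16,16]])"

lemma solved_oct8_19 [cert_simps]: "solved TYPE('a) True 8 oct8_19"
  by (rule solvedI[where x = "Split 2 7 [Close [(5,6),(4,7)], Close [(3,4),(2,5),(1,6),(0,7)],
  Close [(6,7)], Ref oct8_5 [2,1,0,7,6,5,4,3,8,10,9,12,11,14,13,15] [1,0,2], Ref hexagon_pattern
  [0,2,1,8,10,7,16,16,16,16,16,16,16,16,16,16] [2,1,0], Ref oct8_15 [2,1,0,7,6,5,4,3,8,10,9,12,11,14,13,15]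
  [1,0,2], Ref oct8_8 [2,1,0,7,6,5,4,3,8,10,9,12,11,14,13,15] [1,0,2], Split 2 4 [Close [(4,5)], Split 2 5
  [Ref oct8_16 [6,5,4,3,2,1,0,7,9,12,8,10,13,15,11,14] [1,0,2], Ref oct8_16
  [4,5,6,7,0,1,2,3,10,11,8,9,14,15,12,13] [0,1,2], Close [(11,14),(9,12),(8,13),(6,7),(4,5),(2,3),(0,1)],
  Close [(12,13),(10,11),(8,14),(4,5),(3,6),(2,7),(0,1)], Close [(7,14),(6,15),(4,5),(3,13)]], Split 2 11
  [Close [(11,13),(10,12),(8,9),(6,7),(0,5),(1,4),(2,3)], Close [(11,14),(6,7)], Close [(10,11)], Close
  [(11,14),(9,12),(8,13),(5,6),(4,7),(2,3),(0,1)], Close [(13,15),(11,14),(8,9),(5,6),(1,4),(2,3),(0,7)]],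
  Split 2 11 [Close [(10,11),(4,5)], Close [(11,14),(6,7)], Close [(9,11),(8,10)], Close
  [(12,13),(10,11),(8,14),(5,6),(3,4),(2,7),(0,1)], Close [(8,13),(14,15),(10,11),(5,6),(4,7),(2,3),(0,1)]],
  Close [(11,14),(9,12),(8,13),(5,6),(4,7),(2,3),(0,1)], Close [(12,13),(3,4)], Close [(13,15),(3,4)]], Ref
  oct8_18 labels [0,1,2]]"])
    (simp_all only: cert_simps cong: cert_congs)

definition oct8_20 :: pattern where [cert_simps]:
  "oct8_20 = (16,
    [[1,0,3,2,5,4,7,6,9,8,11,10,13,12,15,14],
     [7,2,1,4,3,6,5,0,10,12,8,14,9,15,11,13],
     [2,8,0,14,16,16,16,15,1,16,16,16,16,16,3,7]])"

lemma solved_oct8_20 [cert_simps]: "solved TYPE('a) True 8 oct8_20"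
  by (rule solvedI[where x = "Split 2 4 [Close [(4,5)], Split 2 5 [Close
  [(14,15),(8,9),(6,7),(2,5),(3,4),(0,1)], Close [(14,15),(8,10),(6,7),(2,5),(3,4),(0,1)], Close
  [(7,15),(6,14),(5,11),(3,4)], Ref oct8_13 [4,5,6,7,0,1,2,3,12,13,9,8,15,14,10,11] [0,1,2], Close
  [(13,15),(10,11),(8,14),(6,7),(4,5),(2,3),(0,1)]], Close [(14,15),(8,9),(5,6),(1,4),(2,3),(0,7)], Close
  [(14,15),(8,10),(5,6),(1,4),(2,3),(0,7)], Close [(11,14),(3,4)], Split 2 9 [Close [(9,12),(4,5)], Close
  [(14,15),(8,9),(4,5),(2,3),(1,6),(0,7)], Close [(14,15),(10,12),(8,9),(5,6),(1,4),(2,3),(0,7)], Close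
  [(9,11),(8,10)], Close [(8,14),(13,15),(9,12),(5,6),(4,7),(2,3),(0,1)]], Close
  [(13,15),(10,11),(8,14),(5,6),(4,7),(2,3),(0,1)]]"])
    (simp_all only: cert_simps cong: cert_congs)

text \<open>Two octagons, the first with chord 0-2 and with 1 attached outside. The subcases are the
  colour-2 neighbours of 3: 10 is \<open>oct8_5\<close>, 11 is \<open>oct8_10\<close>, 13 is
  \<open>oct8_19\<close>. The reflection fixing 1 exchanges 3 with 7 and colour 0 with colour
  1.\<close>

definition oct8_21 :: pattern where [cert_simps]:
  "oct8_21 = (16,
    [[1,0,3,2,5,4,7,6,9,8,11,10,13,12,15,14],
     [7,2,1,4,3,6,5,0,10,12,8,14,9,15,11,13],
     [2,8,0,16,16,16,16,16,1,16,16,16,16,16,16,16]])"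

text \<open>One leaf admits no gain: the colour-2 edges 3-12, 7-11, 4-6, 5-15, 9-13 and 10-14
  complete the exceptional graph.\<close>

lemma solved_oct8_21 [cert_simps]: "solved TYPE('a) True 8 oct8_21"
  by (rule solvedI[where x = "Split 2 3 [Close [(3,4)], Close [(6,7),(1,4),(0,5),(2,3)], Close
  [(4,5),(3,6)], Close [(2,3),(0,7)], Ref hexagon_pattern [0,1,8,9,3,2,16,16,16,16,16,16,16,16,16,16] [0,2,1],
  Ref oct8_5 labels [0,1,2], Ref oct8_10 labels [0,1,2], Split 2 7 [Close [(5,6),(4,7)], Close
  [(3,4),(2,5),(1,6),(0,7)], Close [(6,7)], Ref oct8_5 [2,1,0,7,6,5,4,3,8,10,9,12,11,14,13,15] [1,0,2], Ref
  hexagon_pattern [0,2,1,8,10,7,16,16,16,16,16,16,16,16,16,16] [2,1,0], Split 2 4 [Close [(4,5)], Split 2 5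
  [Ref hexagon_pattern [3,12,9,5,6,4,16,16,16,16,16,16,16,16,16,16] [2,1,0], Ref hexagon_pattern
  [4,5,10,11,7,6,16,16,16,16,16,16,16,16,16,16] [0,2,1], Ref oct8_3 [6,5,4,3,2,1,0,7,13,15,12,9,14,11,8,10]
  [1,0,2], Ref oct8_3 [4,5,6,7,0,1,2,3,14,15,11,10,13,12,8,9] [0,1,2], Split 2 9 [Close
  [(7,12),(5,15),(4,14),(3,11),(2,10),(0,9),(1,8)], Split 2 10 [Ref exceptional_pattern labels [0,1,2]], Close
  [(11,12),(9,14),(8,15),(6,7),(2,5),(3,4),(0,1)]]], Close [(9,12),(3,4)], Ref oct8_11 labels [0,1,2], Close
  [(12,13),(3,4)], Ref oct8_12 labels [0,1,2], Split 2 6 [Close [(5,6)], Ref oct8_11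
  [2,1,0,7,6,5,4,3,8,10,9,12,11,14,13,15] [1,0,2], Close [(10,11),(6,7)], Ref oct8_12
  [2,1,0,7,6,5,4,3,8,10,9,12,11,14,13,15] [1,0,2], Close [(11,14),(6,7)]]], Ref oct8_14 labels [0,1,2], Ref
  oct8_15 labels [0,1,2], Ref oct8_17 labels [0,1,2]], Ref oct8_19 labels [0,1,2], Split 2 7 [Close
  [(5,6),(4,7)], Close [(3,4),(2,5),(1,6),(0,7)], Close [(6,7)], Ref oct8_5
  [2,1,0,7,6,5,4,3,8,10,9,12,11,14,13,15] [1,0,2], Ref hexagon_pattern
  [0,2,1,8,10,7,16,16,16,16,16,16,16,16,16,16] [2,1,0], Ref oct8_14 [2,1,0,7,6,5,4,3,8,10,9,12,11,14,13,15]
  [1,0,2], Ref oct8_7 [2,1,0,7,6,5,4,3,8,10,9,12,11,14,13,15] [1,0,2], Split 2 4 [Close [(4,5)], Split 2 5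
  [Ref oct8_9 [4,5,6,7,0,1,2,3,9,8,12,13,10,11,15,14] [0,1,2], Ref oct8_9
  [6,5,4,3,2,1,0,7,10,8,11,14,9,12,15,13] [1,0,2], Close [(11,14),(9,12),(8,13),(4,5),(3,6),(2,7),(0,1)],
  Close [(12,13),(10,11),(8,14),(6,7),(4,5),(2,3),(0,1)], Close
  [(13,15),(10,11),(8,14),(6,7),(4,5),(2,3),(0,1)]], Split 2 11 [Close
  [(11,14),(8,9),(6,7),(0,5),(1,4),(2,3)], Close [(11,14),(9,12),(8,13),(4,5),(3,6),(2,7),(0,1)], Close
  [(10,11)], Close [(11,14),(9,12),(8,13),(5,6),(3,4),(2,7),(0,1)], Close
  [(13,15),(11,14),(8,9),(5,6),(1,4),(2,3),(0,7)]], Split 2 11 [Close [(10,11),(4,5)], Close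
  [(11,14),(9,12),(8,13),(4,5),(3,6),(2,7),(0,1)], Close [(9,11),(8,10)], Close
  [(12,13),(10,11),(8,14),(5,6),(4,7),(2,3),(0,1)], Close [(13,15),(10,11),(8,14),(5,6),(4,7),(2,3),(0,1)]],
  Close [(11,14),(3,4)], Close [(12,13),(10,11),(8,14),(5,6),(4,7),(2,3),(0,1)], Close [(14,15),(3,4)]], Ref
  oct8_20 labels [0,1,2]], Split 2 7 [Close [(5,6),(4,7)], Close [(3,4),(2,5),(1,6),(0,7)], Close [(6,7)], Ref
  oct8_5 [2,1,0,7,6,5,4,3,8,10,9,12,11,14,13,15] [1,0,2], Ref hexagon_pattern
  [0,2,1,8,10,7,16,16,16,16,16,16,16,16,16,16] [2,1,0], Ref oct8_17 [2,1,0,7,6,5,4,3,8,10,9,12,11,14,13,15]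
  [1,0,2], Ref oct8_9 [2,1,0,7,6,5,4,3,8,10,9,12,11,14,13,15] [1,0,2], Ref oct8_20
  [2,1,0,7,6,5,4,3,8,10,9,12,11,14,13,15] [1,0,2], Ref oct8_18 [2,1,0,7,6,5,4,3,8,10,9,12,11,14,13,15]
  [1,0,2]]]"])
    (simp_all only: cert_simps cong: cert_congs)

definition oct8_22 :: pattern where [cert_simps]:
  "oct8_22 = (8,
    [[1,0,3,2,5,4,7,6,16,16,16,16,16,16,16,16],
     [7,2,1,4,3,6,5,0,16,16,16,16,16,16,16,16],
     [2,16,0,16,16,16,16,16,16,16,16,16,16,16,16,16]])"

text \<open>A second chord at 1 gives a 4-cycle or another local gain, so 1 is attached outside. An
  outer face of length 2, 4 or 6 is already settled, which leaves a second octagon.\<close>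

lemma solved_oct8_22 [cert_simps]: "solved TYPE('a) True 8 oct8_22"
  by (rule solvedI[where x = "Split 2 1 [Close [(2,3),(0,1)], Close [(2,3),(1,4)], Close
  [(6,7),(3,4),(2,5),(0,1)], Close [(1,6),(0,7)], Close [(2,7),(0,1)], Split 0 8 [Split 1 8 [Close [(8,9)],
  Split 0 10 [Split 1 9 [Close [(10,11),(8,9)], Split 0 12 [Split 1 11 [Ref hexagon_pattern
  [8,9,12,13,11,10,16,16,16,16,16,16,16,16,16,16] [0,1,2], Split 0 14 [Split 1 13 [Ref oct8_21 labels
  [0,1,2]]]]]]]]]]"])
    (simp_all only: cert_simps cong: cert_congs)

definition oct8_23 :: pattern where [cert_simps]:
  "oct8_23 = (16,
    [[1,0,3,2,5,4,7,6,9,8,11,10,13,12,15,14],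
     [7,2,1,4,3,6,5,0,10,12,8,14,9,15,11,13],
     [4,8,14,9,0,16,16,16,1,3,16,16,16,16,2,16]])"

lemma solved_oct8_23 [cert_simps]: "solved TYPE('a) True 8 oct8_23"
  by (rule solvedI[where x = "Split 2 15 [Close [(14,15),(8,9),(6,7),(2,5),(3,4),(0,1)], Close
  [(10,11),(9,15),(8,14),(4,5),(3,6),(1,2),(0,7)], Close [(14,15),(8,9),(5,6),(3,4),(2,7),(0,1)], Close
  [(11,14),(10,15)], Ref oct8_21 [15,14,11,10,8,9,12,13,2,3,1,0,4,5,7,6] [0,1,2], Ref oct8_22
  [12,13,15,14,11,10,8,9,16,16,16,16,16,16,16,16] [0,1,2], Close [(13,15)]]"])
    (simp_all only: cert_simps cong: cert_congs)

definition oct8_24 :: pattern where [cert_simps]: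
  "oct8_24 = (16,
    [[1,0,3,2,5,4,7,6,9,8,11,10,13,12,15,14],
     [7,2,1,4,3,6,5,0,10,12,8,14,9,15,11,13],
     [4,8,16,9,0,16,16,16,1,3,16,16,16,16,16,16]])"

lemma solved_oct8_24 [cert_simps]: "solved TYPE('a) True 8 oct8_24"
  by (rule solvedI[where x = "Split 2 14 [Ref oct8_23 labels [0,1,2], Split 2 15 [Close
  [(14,15),(8,9),(6,7),(2,5),(3,4),(0,1)], Close [(14,15),(5,6)], Close
  [(10,11),(9,15),(8,14),(3,7),(2,6),(1,5),(0,4)], Close [(11,14),(10,15)], Ref oct8_21
  [15,14,11,10,8,9,12,13,5,4,6,7,3,2,0,1] [0,1,2], Ref oct8_22 [12,13,15,14,11,10,8,9,16,16,16,16,16,16,16,16]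
  [0,1,2], Close [(13,15)]], Split 2 15 [Close [(10,11),(9,15),(8,14),(4,5),(2,3),(1,6),(0,7)], Close
  [(14,15),(5,6)], Close [(14,15),(6,7)], Close [(11,14),(10,15)], Ref oct8_21
  [15,14,11,10,8,9,12,13,6,7,5,4,0,1,3,2] [0,1,2], Ref oct8_22 [12,13,15,14,11,10,8,9,16,16,16,16,16,16,16,16]
  [0,1,2], Close [(13,15)]], Split 2 2 [Close [(3,4),(2,5)], Close [(3,7),(2,6),(1,5),(0,4)], Close
  [(8,10),(1,2)], Close [(11,14),(8,9),(5,6),(3,4),(2,7),(0,1)], Close [(9,12),(2,3)], Split 2 11 [Close
  [(11,13),(10,12),(8,9),(6,7),(2,5),(3,4),(0,1)], Close [(11,14),(6,7)], Close [(10,11)], Close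
  [(12,13),(11,14),(8,9),(5,6),(3,4),(2,7),(0,1)], Close [(13,15),(11,14),(8,9),(5,6),(3,4),(2,7),(0,1)]],
  Close [(14,15),(8,9),(5,6),(3,4),(2,7),(0,1)]], Ref oct8_22 [10,11,14,15,13,12,9,8,16,16,16,16,16,16,16,16]
  [0,1,2], Close [(11,14)], Close [(13,15),(12,14)], Ref oct8_22
  [14,15,13,12,9,8,10,11,16,16,16,16,16,16,16,16] [0,1,2], Close [(14,15)]]"])
    (simp_all only: cert_simps cong: cert_congs)

definition oct8_25 :: pattern where [cert_simps]:
  "oct8_25 = (16,
    [[1,0,3,2,5,4,7,6,9,8,11,10,13,12,15,14],
     [7,2,1,4,3,6,5,0,10,12,8,14,9,15,11,13],
     [4,8,16,16,0,16,9,16,1,6,16,16,16,16,16,16]])"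

lemma solved_oct8_25 [cert_simps]: "solved TYPE('a) True 8 oct8_25"
  by (rule solvedI[where x = "Split 2 12 [Split 2 10 [Close
  [(10,12),(8,9),(4,5),(2,3),(1,6),(0,7)], Close [(10,12),(8,9),(3,4),(2,5),(1,6),(0,7)], Split 2 3 [Close
  [(6,7),(3,5),(1,2),(0,4)], Close [(10,11),(8,9),(3,4),(2,5),(1,6),(0,7)], Close [(12,13),(2,3)], Close
  [(12,14),(9,11),(8,10),(5,6),(4,7),(2,3),(0,1)], Close [(11,14),(10,15),(8,9),(3,4),(2,5),(1,6),(0,7)]],
  Close [(10,11)], Ref oct8_23 [10,8,9,12,13,15,14,11,1,2,0,7,3,4,6,5] [1,0,2], Ref oct8_22
  [10,11,14,15,13,12,9,8,16,16,16,16,16,16,16,16] [0,1,2], Close [(11,14),(10,15)]], Split 2 14 [Close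
  [(12,14),(10,11),(8,9),(4,5),(2,3),(1,6),(0,7)], Close [(10,11),(9,12),(8,14),(4,5),(3,6),(2,7),(0,1)],
  Close [(12,14),(10,11),(8,9),(3,4),(2,5),(1,6),(0,7)], Ref oct8_22
  [10,11,14,15,13,12,9,8,16,16,16,16,16,16,16,16] [0,1,2], Close [(11,14)], Ref oct8_22
  [14,15,13,12,9,8,10,11,16,16,16,16,16,16,16,16] [0,1,2], Close [(14,15)]], Close [(9,12),(5,6)], Close
  [(9,12),(6,7)], Close [(10,12),(8,9)], Split 2 10 [Close [(8,10),(1,2)], Ref oct8_24
  [4,3,2,1,0,7,6,5,10,8,11,14,9,12,15,13] [1,0,2], Ref oct8_23 [12,9,8,10,11,14,15,13,6,5,7,0,4,3,1,2]
  [1,0,2], Ref oct8_24 [11,10,8,9,12,13,15,14,7,6,0,1,5,4,2,3] [0,1,2], Close [(12,13),(10,11)], Close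
  [(13,15),(12,14),(10,11),(8,9)], Close [(11,14),(10,15)]], Close [(12,13)], Close [(13,15),(12,14)], Ref
  oct8_22 [12,13,15,14,11,10,8,9,16,16,16,16,16,16,16,16] [0,1,2]]"])
    (simp_all only: cert_simps cong: cert_congs)

definition oct8_26 :: pattern where [cert_simps]:
  "oct8_26 = (16,
    [[1,0,3,2,5,4,7,6,9,8,11,10,13,12,15,14],
     [7,2,1,4,3,6,5,0,10,12,8,14,9,15,11,13],
     [4,8,16,16,0,10,16,9,1,7,5,12,11,16,16,16]])"

lemma solved_oct8_26 [cert_simps]: "solved TYPE('a) True 8 oct8_26"
  by (rule solvedI[where x = "Split 2 2 [Close [(2,3)], Close [(3,7),(2,6),(1,5),(0,4)], Close
  [(12,13),(9,11),(8,10),(4,5),(3,6),(2,7),(0,1)], Close [(12,14),(9,11),(8,10),(4,5),(3,6),(2,7),(0,1)],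
  Close [(11,14),(9,15),(8,10),(4,5),(3,6),(2,7),(0,1)]]"])
    (simp_all only: cert_simps cong: cert_congs)

definition oct8_27 :: pattern where [cert_simps]:
  "oct8_27 = (16,
    [[1,0,3,2,5,4,7,6,9,8,11,10,13,12,15,14],
     [7,2,1,4,3,6,5,0,10,12,8,14,9,15,11,13],
     [4,8,16,16,0,16,16,9,1,7,16,12,11,16,16,16]])"

lemma solved_oct8_27 [cert_simps]: "solved TYPE('a) True 8 oct8_27"
  by (rule solvedI[where x = "Split 2 10 [Close [(8,10),(1,2)], Ref oct8_24
  [4,3,2,1,0,7,6,5,10,8,11,14,9,12,15,13] [1,0,2], Ref oct8_26 labels [0,1,2], Ref oct8_24
  [11,10,8,9,12,13,15,14,6,7,5,4,0,1,3,2] [0,1,2], Close [(12,13),(10,11)], Close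
  [(13,15),(12,14),(10,11),(8,9)], Close [(11,14),(10,15)]]"])
    (simp_all only: cert_simps cong: cert_congs)

definition oct8_28 :: pattern where [cert_simps]:
  "oct8_28 = (16,
    [[1,0,3,2,5,4,7,6,9,8,11,10,13,12,15,14],
     [7,2,1,4,3,6,5,0,10,12,8,14,9,15,11,13],
     [4,8,16,16,0,16,16,9,1,7,16,16,16,16,16,16]])"

lemma solved_oct8_28 [cert_simps]: "solved TYPE('a) True 8 oct8_28"
  by (rule solvedI[where x = "Split 2 12 [Ref oct8_25 [0,7,6,5,4,3,2,1,9,12,8,10,13,15,11,14]
  [1,0,2], Ref hexagon_pattern [0,4,3,12,9,7,16,16,16,16,16,16,16,16,16,16] [2,1,0], Ref oct8_24
  [0,7,6,5,4,3,2,1,9,12,8,10,13,15,11,14] [1,0,2], Close [(9,12),(6,7)], Close [(10,12),(8,9)], Ref oct8_27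
  labels [0,1,2], Close [(12,13)], Close [(13,15),(12,14)], Ref oct8_22
  [12,13,15,14,11,10,8,9,16,16,16,16,16,16,16,16] [0,1,2]]"])
    (simp_all only: cert_simps cong: cert_congs)

text \<open>The antipodal chord 0-4, with 1 attached to a second octagon. In the references either
  octagon may play the part of the first.\<close>

definition oct8_29 :: pattern where [cert_simps]:
  "oct8_29 = (16,
    [[1,0,3,2,5,4,7,6,9,8,11,10,13,12,15,14],
     [7,2,1,4,3,6,5,0,10,12,8,14,9,15,11,13],
     [4,8,16,16,0,16,16,16,1,16,16,16,16,16,16,16]])"

lemma solved_oct8_29 [cert_simps]: "solved TYPE('a) True 8 oct8_29"
  by (rule solvedI[where x = "Split 2 9 [Close [(8,9),(1,2)], Ref oct8_24 labels [0,1,2], Ref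
  hexagon_pattern [0,1,8,9,5,4,16,16,16,16,16,16,16,16,16,16] [0,2,1], Ref oct8_25 labels [0,1,2], Ref oct8_28
  labels [0,1,2], Ref oct8_21 [9,8,10,11,14,15,13,12,1,0,2,3,7,6,4,5] [0,1,2], Close [(9,11),(8,10)], Close
  [(9,12)], Ref oct8_22 [13,12,9,8,10,11,14,15,16,16,16,16,16,16,16,16] [0,1,2], Split 2 2 [Close [(2,3)],
  Close [(3,4),(2,5)], Close [(3,7),(2,6),(1,5),(0,4)], Close [(2,7),(0,1)], Close [(8,10),(1,2)], Ref oct8_24
  [14,11,10,8,9,12,13,15,2,1,3,4,0,7,5,6] [1,0,2], Ref oct8_27 [9,12,13,15,14,11,10,8,2,1,3,4,0,7,5,6]
  [1,0,2], Split 2 3 [Close [(6,7),(3,5),(1,2),(0,4)], Close [(4,5),(3,6)], Close [(3,4),(0,7)], Ref oct8_24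
  [4,3,2,1,0,7,6,5,10,8,11,14,9,12,15,13] [1,0,2], Split 2 5 [Close [(5,6)], Close [(4,5),(0,7)], Close
  [(11,13),(9,12),(8,10),(6,7),(4,5),(2,3),(0,1)], Close [(12,13),(11,14),(8,9),(6,7),(2,5),(3,4),(0,1)],
  Close [(5,15),(4,14),(3,11),(2,10),(0,9),(1,8)]], Close [(12,13),(2,3)], Close [(13,15),(2,3)]], Split 2 3
  [Close [(6,7),(3,5),(1,2),(0,4)], Close [(4,5),(3,6)], Close [(3,4),(0,7)], Ref oct8_23
  [4,3,2,1,0,7,6,5,10,8,11,14,9,12,15,13] [1,0,2], Ref oct8_26 [14,15,13,12,9,8,10,11,2,3,1,0,4,5,7,6]
  [0,1,2], Ref oct8_24 [14,15,13,12,9,8,10,11,2,3,1,0,4,5,7,6] [0,1,2], Close [(13,15),(2,3)]]], Close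
  [(12,13),(9,15)]]"])
    (simp_all only: cert_simps cong: cert_congs)

definition oct8_30 :: pattern where [cert_simps]:
  "oct8_30 = (16,
    [[1,0,3,2,5,4,7,6,9,8,11,10,13,12,15,14],
     [7,2,1,4,3,6,5,0,10,12,8,14,9,15,11,13],
     [8,11,15,10,16,14,16,16,0,16,3,1,16,16,5,2]])"

lemma solved_oct8_30 [cert_simps]: "solved TYPE('a) True 8 oct8_30"
  by (rule solvedI[where x = "Split 2 4 [Close [(11,14),(10,15),(4,5),(2,3),(1,6),(0,7)], Close
  [(5,6),(4,7)], Close [(10,15),(11,14),(8,9),(6,7),(4,5),(2,3),(0,1)], Close
  [(14,15),(11,13),(10,12),(8,9),(2,5),(3,4)], Close [(8,13),(11,14),(10,15),(6,7),(4,5),(2,3),(0,1)]]"])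
    (simp_all only: cert_simps cong: cert_congs)

definition oct8_31 :: pattern where [cert_simps]:
  "oct8_31 = (16,
    [[1,0,3,2,5,4,7,6,9,8,11,10,13,12,15,14],
     [7,2,1,4,3,6,5,0,10,12,8,14,9,15,11,13],
     [8,11,16,10,16,16,16,16,0,16,3,1,16,16,16,16]])"

lemma solved_oct8_31 [cert_simps]: "solved TYPE('a) True 8 oct8_31"
  by (rule solvedI[where x = "Split 2 2 [Ref oct8_4 [4,3,2,1,0,7,6,5,10,8,11,14,9,12,15,13]
  [1,0,2], Close [(3,4),(2,5)], Ref oct8_28 [2,3,4,5,6,7,0,1,10,11,8,9,14,15,12,13] [0,1,2], Close
  [(2,7),(0,1)], Close [(9,11),(8,10),(0,3),(1,2)], Split 2 4 [Close [(4,5)], Ref oct8_22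
  [4,5,6,7,0,1,2,3,16,16,16,16,16,16,16,16] [0,1,2], Close [(5,6),(4,7)], Split 2 5 [Close [(5,6)], Close
  [(10,12),(8,9),(4,5),(2,3),(1,6),(0,7)], Close [(10,11),(5,13),(3,4),(2,12),(1,9),(0,8)], Close
  [(11,14),(10,12),(8,9),(6,7),(4,5),(2,3),(0,1)], Close [(11,14),(9,15),(8,10),(6,7),(4,5),(0,3),(1,2)]],
  Close [(14,15),(11,13),(10,12),(8,9),(1,4),(2,3)], Close [(13,15),(11,14),(10,12),(8,9),(1,4),(2,3)], Split
  2 5 [Close [(5,6)], Ref oct8_22 [7,6,5,4,3,2,1,0,16,16,16,16,16,16,16,16] [0,1,2], Close
  [(10,12),(8,9),(6,7),(0,5),(1,4),(2,3)], Close [(13,15),(4,5)], Close [(14,15),(4,5)]]], Close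
  [(14,15),(11,13),(9,12),(8,10),(0,3),(1,2)], Close [(11,14),(1,2)], Split 2 5 [Close [(4,5)], Close [(5,6)],
  Ref oct8_22 [7,6,5,4,3,2,1,0,16,16,16,16,16,16,16,16] [0,1,2], Close
  [(11,14),(10,15),(8,9),(6,7),(0,5),(1,4),(2,3)], Split 2 4 [Ref oct8_19
  [6,5,4,3,2,1,0,7,12,9,13,15,8,10,14,11] [1,0,2], Close [(5,6),(4,7)], Close [(9,12),(4,5)], Close
  [(12,13),(4,5)], Close [(11,14),(10,15),(1,4),(2,3)]], Close
  [(10,15),(9,12),(8,13),(6,7),(0,5),(1,4),(2,3)], Ref oct8_30 labels [0,1,2]]]"])
    (simp_all only: cert_simps cong: cert_congs)

definition oct8_32 :: pattern where [cert_simps]: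
  "oct8_32 = (16,
    [[1,0,3,2,5,4,7,6,9,8,11,10,13,12,15,14],
     [7,2,1,4,3,6,5,0,10,12,8,14,9,15,11,13],
     [8,11,16,16,10,16,14,16,0,16,4,1,16,16,6,16]])"

lemma solved_oct8_32 [cert_simps]: "solved TYPE('a) True 8 oct8_32"
  by (rule solvedI[where x = "Split 2 5 [Close [(3,4),(2,5)], Ref oct8_10
  [3,4,5,6,7,0,1,2,10,8,11,14,9,12,15,13] [1,0,2], Close [(11,14),(8,10),(4,5),(2,3),(1,6),(0,7)], Close
  [(10,11),(8,9),(6,7),(0,5),(1,4),(2,3)], Close [(11,14),(10,12),(8,9),(4,5),(2,3),(1,6),(0,7)], Close
  [(10,11),(9,12),(8,13),(6,7),(0,5),(1,4),(2,3)], Close [(14,15),(5,6)]]"])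
    (simp_all only: cert_simps cong: cert_congs)

definition oct8_33 :: pattern where [cert_simps]:
  "oct8_33 = (16,
    [[1,0,3,2,5,4,7,6,9,8,11,10,13,12,15,14],
     [7,2,1,4,3,6,5,0,10,12,8,14,9,15,11,13],
     [8,11,16,16,10,16,16,16,0,16,4,1,16,16,16,16]])"

lemma solved_oct8_33 [cert_simps]: "solved TYPE('a) True 8 oct8_33"
  by (rule solvedI[where x = "Split 2 14 [Close [(11,14),(1,2)], Ref oct8_31
  [4,3,2,1,0,7,6,5,10,8,11,14,9,12,15,13] [1,0,2], Close [(10,11),(8,14),(6,7),(0,5),(1,4),(2,3)], Ref oct8_32
  labels [0,1,2], Close [(10,11),(8,14),(5,6),(1,4),(2,3),(0,7)], Ref oct8_24
  [9,8,10,11,14,15,13,12,0,1,7,6,2,3,5,4] [0,1,2], Close [(13,15),(12,14)], Ref oct8_22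
  [14,15,13,12,9,8,10,11,16,16,16,16,16,16,16,16] [0,1,2], Close [(14,15)]]"])
    (simp_all only: cert_simps cong: cert_congs)

definition oct8_34 :: pattern where [cert_simps]:
  "oct8_34 = (16,
    [[1,0,3,2,5,4,7,6,9,8,11,10,13,12,15,14],
     [7,2,1,4,3,6,5,0,10,12,8,14,9,15,11,13],
     [8,11,16,16,16,10,16,16,0,16,5,1,16,16,16,16]])"

lemma solved_oct8_34 [cert_simps]: "solved TYPE('a) True 8 oct8_34"
  by (rule solvedI[where x = "Split 2 2 [Close [(2,3)], Ref oct8_22
  [2,3,4,5,6,7,0,1,16,16,16,16,16,16,16,16] [0,1,2], Ref oct8_25 [6,5,4,3,2,1,0,7,10,8,11,14,9,12,15,13]
  [1,0,2], Close [(2,7),(0,1)], Close [(9,11),(8,10),(6,7),(0,5),(3,4),(1,2)], Split 2 4 [Close [(3,4)], Ref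
  oct8_21 [4,5,6,7,0,1,2,3,10,11,8,9,14,15,12,13] [0,1,2], Close [(5,6),(4,7)], Close
  [(6,7),(5,10),(4,11),(2,12),(1,9),(0,8)], Close [(11,13),(9,12),(8,10),(6,7),(0,5),(1,4),(2,3)], Close
  [(11,14),(8,10),(6,7),(0,5),(1,4),(2,3)], Close [(6,7),(5,10),(4,15),(3,13),(2,12),(1,9),(0,8)]], Close
  [(11,13),(9,12),(8,10),(6,7),(0,5),(3,4),(1,2)], Close [(11,14),(1,2)], Split 2 14 [Close [(14,15),(2,3)],
  Close [(11,14),(8,10),(6,7),(0,5),(1,4),(2,3)], Close [(11,14),(10,15),(3,4),(2,5),(1,6),(0,7)], Ref oct8_30
  [2,1,0,7,6,5,4,3,15,13,14,11,12,9,10,8] [1,0,2], Close [(10,15),(11,14),(8,9),(6,7),(2,5),(3,4),(0,1)],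
  Close [(13,15),(12,14)], Close [(8,13),(11,14),(10,15),(6,7),(2,5),(3,4),(0,1)]]]"])
    (simp_all only: cert_simps cong: cert_congs)

definition oct8_35 :: pattern where [cert_simps]:
  "oct8_35 = (16,
    [[1,0,3,2,5,4,7,6,9,8,11,10,13,12,15,14],
     [7,2,1,4,3,6,5,0,10,12,8,14,9,15,11,13],
     [8,11,16,16,16,16,10,16,0,16,6,1,16,16,16,16]])"

lemma solved_oct8_35 [cert_simps]: "solved TYPE('a) True 8 oct8_35"
  by (rule solvedI[where x = "Split 2 7 [Close [(2,7),(0,1)], Ref oct8_25
  [7,6,5,4,3,2,1,0,10,11,8,9,14,15,12,13] [0,1,2], Close [(5,6),(4,7)], Close [(6,10),(5,8),(1,11),(0,7)],
  Close [(8,9),(0,7)], Ref oct8_31 [10,8,9,12,13,15,14,11,6,5,7,0,4,3,1,2] [1,0,2], Close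
  [(14,15),(10,11),(9,12),(8,13),(1,6),(0,7)], Close [(10,11),(8,14),(1,6),(0,7)], Ref oct8_34
  [10,8,9,12,13,15,14,11,6,5,7,0,4,3,1,2] [1,0,2]]"])
    (simp_all only: cert_simps cong: cert_congs)

definition oct8_36 :: pattern where [cert_simps]:
  "oct8_36 = (16,
    [[1,0,3,2,5,4,7,6,9,8,11,10,13,12,15,14],
     [7,2,1,4,3,6,5,0,10,12,8,14,9,15,11,13],
     [8,11,16,16,16,16,16,16,0,16,16,1,16,16,16,16]])"

text \<open>The attachments 8 and 11 of 0 and 1 have the common neighbour 10 on the outer octagon,
  so its colour-2 edge is the most restrictive one to split.\<close>

lemma solved_oct8_36 [cert_simps]: "solved TYPE('a) True 8 oct8_36"
  by (rule solvedI[where x = "Split 2 10 [Close [(10,11),(1,2)], Ref oct8_31 labels [0,1,2], Ref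
  oct8_33 labels [0,1,2], Ref oct8_34 labels [0,1,2], Ref oct8_35 labels [0,1,2], Close [(8,10),(0,7)], Ref
  hexagon_pattern [0,1,11,10,9,8,16,16,16,16,16,16,16,16,16,16] [0,2,1], Close [(10,12),(8,9)], Ref oct8_28
  [10,11,14,15,13,12,9,8,1,0,2,3,7,6,4,5] [0,1,2], Ref oct8_5 [14,11,10,8,9,12,13,15,1,2,0,7,3,4,6,5] [1,0,2],
  Close [(11,14),(10,15)]]"])
    (simp_all only: cert_simps cong: cert_congs)

text \<open>A chord of odd length at 0 is a double edge or makes a 4-cycle; lengths 2 and 4 lead to
  \<open>oct8_22\<close> and \<open>oct8_29\<close>. Otherwise 0 is attached to a second octagon. If
  1 is attached there too, distance 1 gives a 4-cycle, distance 2 is \<open>oct8_36\<close>, and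
  distances 3 and 4 are split further at 2.\<close>

lemma solved_octagon8 [cert_simps]: "solved TYPE('a) True 8 octagon_pattern"
  by (rule solvedI[where x = "Split 2 0 [Close [(0,1)], Ref oct8_22 labels [0,1,2], Close
  [(1,2),(0,3)], Split 2 1 [Close [(1,2)], Close [(3,4),(0,1)], Close [(4,5),(0,1)], Close [(1,6),(0,7)],
  Close [(5,6),(4,7),(2,3),(0,1)], Split 0 8 [Split 1 8 [Close [(8,9)], Split 0 10 [Split 1 9 [Close
  [(10,11),(8,9)], Split 0 12 [Split 1 11 [Ref hexagon_pattern [8,9,12,13,11,10,16,16,16,16,16,16,16,16,16,16]
  [0,1,2], Split 0 14 [Split 1 13 [Ref oct8_29 labels [0,1,2]]]]]]]]]], Close [(6,7),(0,5)], Ref oct8_22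
  [6,7,0,1,2,3,4,5,16,16,16,16,16,16,16,16] [0,1,2], Close [(0,7)], Split 0 8 [Split 1 8 [Close [(8,9)], Split
  0 10 [Split 1 9 [Close [(10,11),(8,9)], Split 0 12 [Split 1 11 [Ref hexagon_pattern
  [8,9,12,13,11,10,16,16,16,16,16,16,16,16,16,16] [0,1,2], Split 0 14 [Split 1 13 [Split 2 1 [Close [(1,2)],
  Ref oct8_22 [3,2,1,0,7,6,5,4,16,16,16,16,16,16,16,16] [0,1,2], Close [(2,3),(1,4)], Ref oct8_29
  [1,0,7,6,5,4,3,2,8,9,10,11,12,13,14,15] [0,1,2], Close [(1,6),(0,7)], Ref oct8_21
  [1,0,7,6,5,4,3,2,8,9,10,11,12,13,14,15] [0,1,2], Close [(8,9),(0,1)], Close [(8,10),(0,1)], Ref oct8_36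
  labels [0,1,2], Ref oct8_36 [1,0,7,6,5,4,3,2,12,13,9,8,15,14,10,11] [0,1,2], Split 2 2 [Close [(2,3)], Ref
  oct8_22 [2,3,4,5,6,7,0,1,16,16,16,16,16,16,16,16] [0,1,2], Close [(3,4),(2,5)], Ref oct8_29
  [2,1,0,7,6,5,4,3,13,15,12,9,14,11,8,10] [1,0,2], Close [(2,7),(0,1)], Ref oct8_35
  [9,8,10,11,14,15,13,12,2,3,1,0,4,5,7,6] [0,1,2], Ref oct8_34 [8,10,11,14,15,13,12,9,0,7,1,2,6,5,3,4]
  [1,0,2], Split 2 3 [Close [(3,4)], Ref oct8_22 [5,4,3,2,1,0,7,6,16,16,16,16,16,16,16,16] [0,1,2], Close
  [(4,5),(3,6)], Ref oct8_29 [3,2,1,0,7,6,5,4,11,10,14,15,8,9,13,12] [0,1,2], Close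
  [(14,15),(11,13),(10,12),(8,9),(0,3),(1,2)], Close [(10,11),(2,3)], Ref oct8_34
  [13,12,9,8,10,11,14,15,1,0,2,3,7,6,4,5] [0,1,2], Close [(11,14),(2,3)], Ref oct8_35
  [15,13,12,9,8,10,11,14,3,4,2,1,5,6,0,7] [1,0,2]], Close [(12,13),(1,2)], Ref oct8_36
  [2,1,0,7,6,5,4,3,14,11,15,13,10,8,12,9] [1,0,2], Close [(13,15),(1,2)]], Split 2 2 [Close [(2,3)], Ref
  oct8_22 [2,3,4,5,6,7,0,1,16,16,16,16,16,16,16,16] [0,1,2], Close [(3,4),(2,5)], Ref oct8_29
  [2,1,0,7,6,5,4,3,14,11,15,13,10,8,12,9] [1,0,2], Close [(2,7),(0,1)], Ref oct8_33
  [9,8,10,11,14,15,13,12,2,3,1,0,4,5,7,6] [0,1,2], Ref oct8_31 [8,10,11,14,15,13,12,9,0,7,1,2,6,5,3,4]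
  [1,0,2], Close [(11,14),(1,2)], Split 2 3 [Close [(3,4)], Ref oct8_22
  [5,4,3,2,1,0,7,6,16,16,16,16,16,16,16,16] [0,1,2], Close [(4,5),(3,6)], Ref oct8_29
  [3,2,1,0,7,6,5,4,12,13,9,8,15,14,10,11] [0,1,2], Close [(9,12),(2,3)], Close
  [(13,15),(12,14),(9,11),(8,10),(0,3),(1,2)], Ref oct8_32 [11,14,15,13,12,9,8,10,3,4,2,1,5,6,0,7] [1,0,2],
  Close [(12,13),(2,3)], Ref oct8_31 [14,15,13,12,9,8,10,11,1,0,2,3,7,6,4,5] [0,1,2]], Ref oct8_36
  [1,2,3,4,5,6,7,0,14,11,15,13,10,8,12,9] [1,0,2], Close [(14,15),(1,2)]], Split 2 2 [Close [(2,3)], Ref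
  oct8_22 [2,3,4,5,6,7,0,1,16,16,16,16,16,16,16,16] [0,1,2], Close [(3,4),(2,5)], Ref oct8_29
  [2,1,0,7,6,5,4,3,15,13,14,11,12,9,10,8] [1,0,2], Close [(2,7),(0,1)], Ref oct8_34
  [9,8,10,11,14,15,13,12,2,3,1,0,4,5,7,6] [0,1,2], Ref oct8_33 [8,10,11,14,15,13,12,9,0,7,1,2,6,5,3,4]
  [1,0,2], Ref oct8_36 [1,2,3,4,5,6,7,0,15,13,14,11,12,9,10,8] [1,0,2], Ref oct8_36
  [2,1,0,7,6,5,4,3,12,9,13,15,8,10,14,11] [1,0,2], Close [(13,15),(1,2)], Close [(14,15),(1,2)]]]]]]]]]]]]"])
    (simp_all only: cert_simps cong: cert_congs)

section \<open>Graphs with at most 18 vertices\<close>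

lemma goodD:
  "good TYPE('a) n \<Longrightarrow> invol_graph (V :: 'a set) e \<Longrightarrow> card V = 2 * n \<Longrightarrow> attains V e (target n)"
  by (simp add: good_def)

lemma attains_contract_edge:
  fixes V :: "'a set"
  assumes inv: "invol_graph V e" and V: "card V = 2 * Suc n" and good: "good TYPE('a) n"
    and x: "x \<in> V"
  shows "attains V e (target n + mult e x (e 0 x))"
proof (rule attains_step)
  note ex = invol_graphD[OF inv _ x, of 0]
  show "x \<in> V" "e 0 x \<in> V" "x \<noteq> e 0 x" using x ex by auto
  then have "card (V - {x, e 0 x}) = 2 * n"
    using V inv by (simp add: invol_graph_def card_Diff_subset)
  with goodD[OF good invol_graph_contract[OF inv]] x ex
  show "attains (V - {x, e 0 x}) (contract e x (e 0 x)) (target n)" by auto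
qed simp

text \<open>Every edge gains at least 1. This settles the sizes 2, 3, 5 and 7.\<close>

lemma good_Suc:
  assumes good: "good TYPE('a) n" and "target (Suc n) \<le> Suc (target n)"
  shows "good TYPE('a) (Suc n)"
  unfolding good_def
proof (intro allI impI)
  fix V :: "'a set" and e
  assume A: "invol_graph V e \<and> card V = 2 * Suc n"
  then obtain x where x: "x \<in> V" by fastforce
  have "1 \<le> mult e x (e 0 x)" by (simp add: mult_eq numeral_3_eq_3)
  then show "attains V e (target (Suc n))"
    using attains_contract_edge[OF _ _ good x, of e] A assms(2) by (auto intro: attains_mono)
qed

lemma good_0: "good TYPE('a) 0"
  by (auto simp: good_def invol_graph_def target_eval intro: attains_empty)

text \<open>All three colours join the only two vertices, which is the reason for
  \<open>target 1 = 3\<close>.\<close>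

lemma good_1: "good TYPE('a) 1"
  unfolding good_def
proof (intro allI impI)
  fix V :: "'a set" and e
  assume A: "invol_graph V e \<and> card V = 2 * 1"
  then obtain x y where V: "V = {x, y}" "x \<noteq> y" by (auto simp: card_2_iff)
  have "e c x = y" if "c < 3" for c
    using invol_graphD[of V e c x] A that V by auto
  then have "mult e x (e 0 x) = 3" by (simp add: mult_eq)
  then show "attains V e (target 1)"
    using attains_contract_edge[OF _ _ good_0, of V e x] A V by (simp add: target_def)
qed

lemma good_vertex:
  assumes "solved TYPE('a) False n vertex_pattern" "\<And>m. m < n \<Longrightarrow> good TYPE('a) m" "0 < n"
  shows "good TYPE('a) n"
  unfolding good_def
proof (intro allI impI)
  fix V :: "'a set" and e
  assume A: "invol_graph V e \<and> card V = 2 * n"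
  then have "V \<noteq> {}" using assms(3) by auto
  then obtain x where x: "x \<in> V" by blast
  have "occurs V e (fst vertex_pattern) (snd vertex_pattern) (\<lambda>_. x)"
    using x by (auto simp: occurs_def vertex_pattern_def less_3_cases inj_on_def)
  from solvedD[OF assms(1,2) _ _ this] A show "attains V e (target n)" by auto
qed

lemma good_less_8:
  assumes "n < 8"
  shows "good TYPE('a) n"
proof -
  have g2: "good TYPE('a) 2" using good_Suc[where 'a = 'a, OF good_1] by (simp add: target_def numeral_2_eq_2)
  have g3: "good TYPE('a) 3" using good_Suc[OF g2] by (simp add: target_eval)
  have "good TYPE('a) m" if "m < 4" for m
  proof -
    have "m \<in> {0, 1, 2, 3}" using that by auto
    then show ?thesis using good_0 good_1 g2 g3 by (elim insertE) simp_all
  qed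
  note less4 = this
  have g4: "good TYPE('a) 4" by (rule good_vertex[OF solved_vertex4 less4]) simp_all
  have g5: "good TYPE('a) 5" using good_Suc[OF g4] by (simp add: target_eval)
  have less6: "good TYPE('a) m" if "m < 6" for m
  proof -
    have "m < 4 \<or> m \<in> {4, 5}" using that by auto
    then show ?thesis using less4 g4 g5 by (elim disjE insertE) simp_all
  qed
  have g6: "good TYPE('a) 6" by (rule good_vertex[OF solved_vertex6 less6]) simp_all
  have g7: "good TYPE('a) 7" using good_Suc[OF g6] by (simp add: target_eval)
  have "n < 6 \<or> n \<in> {6, 7}" using assms by auto
  then show ?thesis using less6 g6 g7 by (elim disjE insertE) simp_all
qed


section \<open>Small faces on 16 vertices\<close>

lemma solved_check:
  fixes V :: "'a set"
  assumes "invol_graph V e" "card V = 16" "wf_table K t" "occurs V e K t h"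
    and "check 8 (solved TYPE('a) b 8) K t x"
  shows "attains V e 13 \<or> b \<and> exceptional V e"
  using check_sound[OF assms(1) _ _ good_less_8 assms(5,3,4)] assms(2) by (simp add: target_eval)

text \<open>A path that alternates between colours 0 and 1 cannot leave a set closed under both, so
  its distinct labels count elements of \<open>S\<close>. This bounds how far a face can be
  followed.\<close>

lemma card_path:
  assumes occ: "occurs V e K t h" and "h 0 \<in> S" "finite S" and S: "\<And>c v. c < 2 \<Longrightarrow> v \<in> S \<Longrightarrow> e c v \<in> S"
    and k: "k \<le> K" "K \<le> 16" and path: "list_all (\<lambda>i. t ! (i mod 2) ! i = i + 1) (take (k - 1) labels)"
  shows "k \<le> card S"
proof -
  have "h i \<in> S" if "i < k" for i
    using that
  proof (induction i)
    case (Suc i)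
    have "take (k - 1) labels = [0..<k - 1]" using k by (simp add: labels_eq take_upt)
    then have "t ! (i mod 2) ! i = Suc i" using path Suc.prems by (simp add: list_all_iff)
    then have "e (i mod 2) (h i) = h (Suc i)"
      using occ Suc.prems k by (auto simp: occurs_def dest!: spec[of _ "i mod 2"])
    then show ?case using S[of "i mod 2" "h i"] Suc by simp
  qed (use assms in simp)
  then have "h ` {..<k} \<subseteq> S" by auto
  moreover have "card (h ` {..<k}) = k"
    using occ k by (subst card_image) (auto simp: occurs_def intro: inj_on_subset)
  ultimately show ?thesis using card_mono[OF \<open>finite S\<close>] by metis
qed

text \<open>The face is followed vertex by vertex from \<open>x\<close>; each colour-1 step closes
  it at label 0 or reaches a new vertex. Closing after 2 or 4 vertices gives a local gain, after 6
  or 8 a solved pattern, and a ninth vertex contradicts the size of \<open>S\<close>.\<close>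

lemma small_face_cases:
  fixes V :: "'a set"
  assumes inv: "invol_graph V e" and V: "card V = 16"
    and S: "S \<subseteq> V" "S \<noteq> {}" "\<And>c v. c < 2 \<Longrightarrow> v \<in> S \<Longrightarrow> e c v \<in> S" and card_S: "card S \<le> 8"
  shows "attains V e 13 \<or> card S = 8 \<and> exceptional V e"
proof (rule ccontr)
  assume contra: "\<not> ?thesis"
  obtain x where x: "x \<in> S" using S by blast
  have fin: "finite S" using inv S(1) by (auto simp: invol_graph_def intro: finite_subset)
  \<comment> \<open>Label 0 is tied to \<open>x\<close>, so that the path counted by
    \<open>card_path\<close> starts in \<open>S\<close>.\<close>
  define St where "St K t \<longleftrightarrow> wf_table K t \<and> (\<exists>h. occurs V e K t h \<and> h 0 = x)" for K t
  \<comment> \<open>Along the path every inner label already has the colour in question, so only 0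
    and the fresh label can come next.\<close>
  have step: "St (K + 1) (link t c v K) \<or> 0 \<in> set (candidates 16 K (t ! c) v labels) \<and> St K (link t c v 0)"
    if "St K t" "0 < K" "c < 3" "v < K" "t ! c ! v = 16"
      "set (candidates 16 K (t ! c) v labels) \<subseteq> {0, K}" for K t c v
  proof -
    from that(1) obtain h where h: "wf_table K t" "occurs V e K t h" "h 0 = x" by (auto simp: St_def)
    show ?thesis
    proof (rule split_cases[OF h(1,2) inv, of 8 c v])
      fix w h'
      assume w: "w \<in> set (candidates (2 * 8) K (t ! c) v labels)"
        "wf_table (if w = K then K + 1 else K) (link t c v w)"
        "occurs V e (if w = K then K + 1 else K) (link t c v w) h'" "\<And>i. i < K \<Longrightarrow> h' i = h i"
      then have "w = 0 \<or> w = K" using that(6) by auto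
      then show ?thesis
      proof
        assume "w = 0"
        with w that(2) h(3) show ?thesis unfolding St_def by auto
      next
        assume "w = K"
        with w that(2) h(3) show ?thesis unfolding St_def by auto
      qed
    qed (use V that in auto)
  qed
  have closed: False if "St K t" "check 8 (solved TYPE('a) False 8) K t y" for K t y
    using solved_check[OF inv V] that contra unfolding St_def by blast
  have path: False if "St K t" "k \<le> K" "card S < k"
      "list_all (\<lambda>i. t ! (i mod 2) ! i = i + 1) (take (k - 1) labels)" for K t k
    using that card_path[where K = K and t = t and k = k, OF _ _ fin S(3)] x wf_tableD(1)[of K t] unfolding St_def by fastforce
  have hexagon: "\<not> St 6 (snd hexagon_pattern)"
    using solvedD[OF solved_hexagon8 good_less_8 inv] V contra
    by (auto simp: St_def hexagon_pattern_def target_eval)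
  have octagon: "\<not> St 8 (snd octagon_pattern)"
  proof
    assume oct: "St 8 (snd octagon_pattern)"
    then have "attains V e 13 \<or> exceptional V e"
      using solvedD[OF solved_octagon8 good_less_8 inv] V
      by (auto simp: St_def octagon_pattern_def target_eval)
    moreover have "\<not> card S < 8"
      using path[OF oct, of 8] by (auto simp: octagon_pattern_def labels_def)
    ultimately show False using contra card_S by simp
  qed
  let ?U = "[16,16,16,16,16,16,16,16,16,16,16,16,16,16,16,16]"
  note eval = cert_simps insert_subset empty_subsetI
  have "wf_table 1 (snd vertex_pattern)"
    by (simp only: eval cong: cert_congs)
  moreover have "occurs V e 1 (snd vertex_pattern) (\<lambda>_. x)"
    using x S(1) by (auto simp: occurs_def vertex_pattern_def less_3_cases inj_on_def)
  ultimately have "St 1 (snd vertex_pattern)" unfolding St_def by blast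
  from step[OF this, of 0 0] have "St 2 [[1,0,16,16,16,16,16,16,16,16,16,16,16,16,16,16],
      [16,16,16,16,16,16,16,16,16,16,16,16,16,16,16,16], ?U]"
    by (simp only: eval cong: cert_congs)
  from step[OF this, of 1 1] have "St 3 [[1,0,16,16,16,16,16,16,16,16,16,16,16,16,16,16],
      [16,2,1,16,16,16,16,16,16,16,16,16,16,16,16,16], ?U] \<or>
     St 2 [[1,0,16,16,16,16,16,16,16,16,16,16,16,16,16,16],
      [1,0,16,16,16,16,16,16,16,16,16,16,16,16,16,16], ?U]"
    by (simp only: eval cong: cert_congs)
  then have "St 3 [[1,0,16,16,16,16,16,16,16,16,16,16,16,16,16,16],
      [16,2,1,16,16,16,16,16,16,16,16,16,16,16,16,16], ?U]"
  proof
    assume "St 2 [[1,0,16,16,16,16,16,16,16,16,16,16,16,16,16,16],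
      [1,0,16,16,16,16,16,16,16,16,16,16,16,16,16,16], ?U]"
    from closed[OF this, of "Close [(0, 1)]"] show ?thesis by (simp only: eval True_implies_equals cong: cert_congs)
  qed
  from step[OF this, of 0 2] have "St 4 [[1,0,3,2,16,16,16,16,16,16,16,16,16,16,16,16],
      [16,2,1,16,16,16,16,16,16,16,16,16,16,16,16,16], ?U]"
    by (simp only: eval cong: cert_congs)
  from step[OF this, of 1 3] have "St 5 [[1,0,3,2,16,16,16,16,16,16,16,16,16,16,16,16],
      [16,2,1,4,3,16,16,16,16,16,16,16,16,16,16,16], ?U] \<or>
     St 4 [[1,0,3,2,16,16,16,16,16,16,16,16,16,16,16,16],
      [3,2,1,0,16,16,16,16,16,16,16,16,16,16,16,16], ?U]"
    by (simp only: eval cong: cert_congs)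
  then have "St 5 [[1,0,3,2,16,16,16,16,16,16,16,16,16,16,16,16],
      [16,2,1,4,3,16,16,16,16,16,16,16,16,16,16,16], ?U]"
  proof
    assume "St 4 [[1,0,3,2,16,16,16,16,16,16,16,16,16,16,16,16],
      [3,2,1,0,16,16,16,16,16,16,16,16,16,16,16,16], ?U]"
    from closed[OF this, of "Close [(2, 3), (0, 1)]"] show ?thesis by (simp only: eval True_implies_equals cong: cert_congs)
  qed
  from step[OF this, of 0 4] have "St 6 [[1,0,3,2,5,4,16,16,16,16,16,16,16,16,16,16],
      [16,2,1,4,3,16,16,16,16,16,16,16,16,16,16,16], ?U]"
    by (simp only: eval cong: cert_congs)
  from step[OF this, of 1 5] have "St 7 [[1,0,3,2,5,4,16,16,16,16,16,16,16,16,16,16],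
      [16,2,1,4,3,6,5,16,16,16,16,16,16,16,16,16], ?U] \<or>
     St 6 [[1,0,3,2,5,4,16,16,16,16,16,16,16,16,16,16],
      [5,2,1,4,3,0,16,16,16,16,16,16,16,16,16,16], ?U]"
    by (simp only: eval cong: cert_congs)
  then have "St 7 [[1,0,3,2,5,4,16,16,16,16,16,16,16,16,16,16],
      [16,2,1,4,3,6,5,16,16,16,16,16,16,16,16,16], ?U]"
    using hexagon by (auto simp only: eval cong: cert_congs)
  from step[OF this, of 0 6] have "St 8 [[1,0,3,2,5,4,7,6,16,16,16,16,16,16,16,16],
      [16,2,1,4,3,6,5,16,16,16,16,16,16,16,16,16], ?U]"
    by (simp only: eval cong: cert_congs)
  from step[OF this, of 1 7] have "St 9 [[1,0,3,2,5,4,7,6,16,16,16,16,16,16,16,16],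
      [16,2,1,4,3,6,5,8,7,16,16,16,16,16,16,16], ?U] \<or>
     St 8 [[1,0,3,2,5,4,7,6,16,16,16,16,16,16,16,16],
      [7,2,1,4,3,6,5,0,16,16,16,16,16,16,16,16], ?U]"
    by (simp only: eval cong: cert_congs)
  then have "St 9 [[1,0,3,2,5,4,7,6,16,16,16,16,16,16,16,16],
      [16,2,1,4,3,6,5,8,7,16,16,16,16,16,16,16], ?U]"
    using octagon by (auto simp only: eval cong: cert_congs)
  \<comment> \<open>Nine labels on the path exceed the at most eight elements of
    \<open>S\<close>.\<close>
  from path[OF this, of 9] card_S show False by (simp add: labels_def)
qed


section \<open>Graphs on 18 vertices\<close>

lemma attains_14:
  fixes V :: "'a set"
  assumes inv: "invol_graph V e" and V: "card V = 18"
    and S: "S \<subseteq> V" "S \<noteq> {}" "\<And>c v. c < 2 \<Longrightarrow> v \<in> S \<Longrightarrow> e c v \<in> S" and card_S: "card S \<le> 9"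
  shows "attains V e 14"
proof -
  obtain x where x: "x \<in> S" using S by blast
  define y where "y = e 0 x"
  let ?V = "V - {x, y}" and ?e = "contract e x y" and ?S = "S - {x, y}"
  have xV: "x \<in> V" using x S by blast
  have y: "y \<in> S" "y \<in> V" "x \<noteq> y" using x S(3)[of 0 x] S(1) invol_graphD[OF inv _ xV, of 0] by (auto simp: y_def)
  have fin: "finite V" "finite S" using inv S(1) by (auto simp: invol_graph_def intro: finite_subset)
  have inv': "invol_graph ?V ?e" by (rule invol_graph_contract[OF inv xV y(2,3)])
  have V': "card ?V = 16" and S': "card ?S \<le> 7"
    using V card_S x y xV fin by (simp_all add: card_Diff_subset)
  have m: "mult e x y = (\<Sum>c<3. if e c x = y then 1 else 0)" by (rule mult_eq)
  show ?thesis
  proof (cases "?S = {}")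
    case True
    \<comment> \<open>The face is a double edge: 2 for it, 1 for any edge of the remaining graph and
      11 for the size 7 after that make 14.\<close>
    then have "e 1 x = y" using x S(3)[of 1 x] invol_graphD[OF inv _ xV, of 1] by auto
    then have "2 \<le> mult e x y" unfolding m by (simp add: numeral_3_eq_3 y_def)
    have "?V \<noteq> {}" using V' by (metis card.empty zero_neq_numeral)
    then obtain z where "z \<in> ?V" by blast
    then have "attains ?V ?e (11 + mult ?e z (?e 0 z))"
      using attains_contract_edge[OF inv' _ good_less_8, of 7] V' by (simp add: target_eval)
    moreover have "1 \<le> mult ?e z (?e 0 z)" by (simp add: mult_eq numeral_3_eq_3)
    ultimately have "attains ?V ?e 12" by (auto intro: attains_mono)
    then show ?thesis using \<open>2 \<le> mult e x y\<close> xV y by (intro attains_step[of x V y e 12 14]) auto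
  next
    case False
    \<comment> \<open>A rerouted edge ends at a neighbour of \<open>x\<close> or \<open>y\<close> in
      the same colour, which lies in \<open>S\<close> again.\<close>
    have "?e c v \<in> ?S" if "c < 2" "v \<in> ?S" for c v
      using that S(1,3) x y(1) invol_graphD(1)[OF inv', of c v] by (auto simp: contract_def split: if_splits)
    \<comment> \<open>At most 7 vertices remain in the face, so the exceptional alternative, which
      needs 8, is impossible.\<close>
    then have "attains ?V ?e 13"
      using small_face_cases[OF inv' V', of ?S] S(1) False S' by auto
    moreover have "1 \<le> mult e x y" unfolding m by (simp add: numeral_3_eq_3 y_def)
    ultimately show ?thesis using xV y by (intro attains_step[of x V y e 13 14]) auto
  qed
qed

section \<open>From several faces to a small one\<close>

lemma small_component:
  assumes fin: "finite V" and V: "V \<noteq> {}"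
    and p: "\<forall>v\<in>V. p v \<in> V \<and> p v \<noteq> v \<and> p (p v) = v"
    and q: "\<forall>v\<in>V. q v \<in> V \<and> q v \<noteq> v \<and> q (q v) = v"
    and ne: "card (components V (pairing_of V p \<union> pairing_of V q)) \<noteq> 1"
  obtains S where "S \<subseteq> V" "S \<noteq> {}" "p ` S \<subseteq> S" "q ` S \<subseteq> S" "2 * card S \<le> card V"
proof -
  define R where "R = adj (pairing_of V p \<union> pairing_of V q)"
  have R: "(u, v) \<in> R \<longleftrightarrow> u \<in> V \<and> (v = p u \<or> v = q u)" for u v
    by (auto simp: R_def adj_Un adj_pairing_of[OF p] adj_pairing_of[OF q])
  have comps: "components V (pairing_of V p \<union> pairing_of V q) = (\<lambda>v. R\<^sup>* `` {v}) ` V"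
    by (simp add: components_image R_def)
  have RV: "v \<in> V" if "(u, v) \<in> R\<^sup>*" "u \<in> V" for u v
    using that by (induction rule: rtrancl_induct) (use R p q in auto)
  obtain a where a: "a \<in> V" using V by blast
  have "\<exists>b\<in>V. R\<^sup>* `` {b} \<noteq> R\<^sup>* `` {a}"
  proof (rule ccontr)
    assume "\<not> ?thesis"
    then have "(\<lambda>v. R\<^sup>* `` {v}) ` V = (\<lambda>v. R\<^sup>* `` {a}) ` V" by (intro image_cong) blast+
    with ne a show False by (simp add: comps image_constant[OF a])
  qed
  then obtain b where b: "b \<in> V" "R\<^sup>* `` {b} \<noteq> R\<^sup>* `` {a}" by blast
  have cl: "R\<^sup>* `` {u} = R\<^sup>* `` {v}" if "(u, v) \<in> R\<^sup>*" for u v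
    using that by (simp add: component_eq_iff R_def)
  have "R\<^sup>* `` {a} \<inter> R\<^sup>* `` {b} = {}"
  proof (rule ccontr)
    assume "\<not> ?thesis"
    then obtain z where "(a, z) \<in> R\<^sup>*" "(b, z) \<in> R\<^sup>*" by blast
    with cl[of a z] cl[of b z] b(2) show False by simp
  qed
  then have "card (R\<^sup>* `` {a}) + card (R\<^sup>* `` {b}) = card (R\<^sup>* `` {a} \<union> R\<^sup>* `` {b})"
    using RV[OF _ a] RV[OF _ b(1)] fin by (intro card_Un_disjoint[symmetric]) (auto intro: finite_subset[OF _ fin])
  also have "\<dots> \<le> card V" using RV[OF _ a] RV[OF _ b(1)] fin by (intro card_mono) auto
  \<comment> \<open>Of two disjoint classes, one has at most half of the vertices.\<close>
  finally obtain c where c: "c \<in> V" "2 * card (R\<^sup>* `` {c}) \<le> card V"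
    using a b(1) by (cases "card (R\<^sup>* `` {a}) \<le> card (R\<^sup>* `` {b})") force+
  show thesis
  proof (rule that[of "R\<^sup>* `` {c}"])
    have "(v, p v) \<in> R \<and> (v, q v) \<in> R" if "(c, v) \<in> R\<^sup>*" for v using RV[OF that c(1)] R by auto
    then show "p ` (R\<^sup>* `` {c}) \<subseteq> R\<^sup>* `` {c}" "q ` (R\<^sup>* `` {c}) \<subseteq> R\<^sup>* `` {c}"
      by (auto intro: rtrancl_into_rtrancl)
  qed (use c RV[OF _ c(1)] in auto)
qed

section \<open>Colour symmetry of the exceptional graph\<close>

lemma all_less_3: "(\<forall>c<3. P c) \<longleftrightarrow> P 0 \<and> P 1 \<and> P (2 :: nat)"
  by (auto simp: less_3_cases)

text \<open>Isomorphism has to respect the colours, whereas the search determines the exceptional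
  graph only up to renaming them. The gap closes because this graph is isomorphic to each of its six
  recolourings. For every permutation an explicit list \<open>g\<close> is given,
  \<open>g ! i\<close> being the vertex that the table calls \<open>i\<close>.\<close>

lemma exceptional_graph_labellings:
  assumes "s \<in> {[0, 1, 2], [0, 2, 1], [1, 0, 2], [1, 2, 0], [2, 0, 1], [2, 1, 0]}"
  shows "\<exists>g. bij_betw (\<lambda>i. g ! i) {..<16} {1..16::nat} \<and>
    (\<forall>c<3. (\<lambda>i. {g ! i, g ! (exceptional_table ! c ! i)}) ` {..<16} =
      edges exceptional_graph (Suc (s ! c)))"
proof -
  define ok where "ok g \<longleftrightarrow> distinct g \<and> length g = 16 \<and> set g = {1..16::nat} \<and>
    (\<forall>c<3. (\<lambda>i. {g ! i, g ! (exceptional_table ! c ! i)}) ` set labels =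
      edges exceptional_graph (Suc (s ! c)))" for g
  have set16: "{Suc 0..16} = set [1,2,3,4,5,6,7,8,9,10,11,12,13,14,15,16]"
    by (simp add: atLeastAtMost_insertL[symmetric] numeral_eq_Suc atLeastAtMostSuc_conv)
  note ok_simps = ok_def set16 all_less_3 labels_def exceptional_table_def exceptional_graph_def
    set_eq_subset doubleton_eq_iff
  from assms have ok: "\<exists>g. ok g"
  proof (elim insertE emptyE)
    assume "s = [0, 1, 2]"
    then have "ok [1, 2, 3, 4, 5, 6, 7, 8, 9, 10, 16, 15, 11, 12, 14, 13]" by (simp add: ok_simps)
    then show ?thesis ..
  next
    assume "s = [0, 2, 1]"
    then have "ok [2, 1, 3, 4, 11, 12, 10, 9, 8, 7, 15, 16, 5, 6, 14, 13]" by (simp add: ok_simps)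
    then show ?thesis ..
  next
    assume "s = [1, 0, 2]"
    then have "ok [3, 2, 1, 8, 7, 6, 5, 4, 9, 16, 10, 11, 15, 14, 12, 13]" by (simp add: ok_simps)
    then show ?thesis ..
  next
    assume "s = [1, 2, 0]"
    then have "ok [2, 3, 1, 8, 15, 14, 16, 9, 4, 5, 11, 10, 7, 6, 12, 13]" by (simp add: ok_simps)
    then show ?thesis ..
  next
    assume "s = [2, 0, 1]"
    then have "ok [3, 1, 2, 9, 10, 12, 11, 4, 8, 15, 7, 5, 16, 14, 6, 13]" by (simp add: ok_simps)
    then show ?thesis ..
  next
    assume "s = [2, 1, 0]"
    then have "ok [1, 3, 2, 9, 16, 14, 15, 8, 4, 11, 5, 7, 10, 12, 6, 13]" by (simp add: ok_simps)
    then show ?thesis ..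
  qed
  then obtain g where g: "ok g" ..
  moreover have "bij_betw (\<lambda>i. g ! i) {..<16} {1..16::nat}"
    using g bij_betw_nth[of g "{..<16}" "{1..16}"] by (simp add: ok_def)
  ultimately show ?thesis by (intro exI[of _ g]) (simp add: ok_def labels_eq lessThan_atLeast0)
qed

lemma list_permutations_3:
  fixes a b c :: nat
  assumes "a < 3" "b < 3" "c < 3" "a \<noteq> b" "a \<noteq> c" "b \<noteq> c"
  shows "[a, b, c] \<in> {[0, 1, 2], [0, 2, 1], [1, 0, 2], [1, 2, 0], [2, 0, 1], [2, 1, 0]}"
  using assms unfolding less_3_cases by (elim disjE) simp_all

lemma exceptional_isomorphic:
  assumes exc: "exceptional V e" and V: "verts G = V"
    and edges: "\<And>c. c < 3 \<Longrightarrow> edges G (Suc c) = pairing_of V (e c)"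
  shows "graph_isomorphic G exceptional_graph"
proof -
  obtain \<sigma> h where \<sigma>: "bij_betw \<sigma> {..<3} {..<3::nat}" and h: "bij_betw h {..<16::nat} V"
    and e: "\<And>c i. c < 3 \<Longrightarrow> i < 16 \<Longrightarrow> e (\<sigma> c) (h i) = h (exceptional_table ! c ! i)"
    using exc by (auto simp: exceptional_def)
  have table: "exceptional_table ! c ! i < 16" if "c < 3" "i < 16" for c i
    using that by (auto simp: less_3_cases exceptional_table_def numeral_eq_Suc less_Suc_eq)
  let ?s = "[\<sigma> 0, \<sigma> 1, \<sigma> 2]"
  have s: "?s ! c = \<sigma> c" if "c < 3" for c using that by (auto simp: less_3_cases)
  have "\<sigma> 0 < 3" "\<sigma> 1 < 3" "\<sigma> 2 < 3" "\<sigma> 0 \<noteq> \<sigma> 1" "\<sigma> 0 \<noteq> \<sigma> 2" "\<sigma> 1 \<noteq> \<sigma> 2"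
    using bij_betwE[OF \<sigma>] by (simp_all add: inj_on_eq_iff[OF bij_betw_imp_inj_on[OF \<sigma>]])
  then have "?s \<in> {[0, 1, 2], [0, 2, 1], [1, 0, 2], [1, 2, 0], [2, 0, 1], [2, 1, 0]}"
    by (rule list_permutations_3)
  from exceptional_graph_labellings[OF this]
  obtain g where g: "bij_betw (\<lambda>i. g ! i) {..<16} {1..16::nat}"
    and g_edges: "\<forall>c<3. (\<lambda>i. {g ! i, g ! (exceptional_table ! c ! i)}) ` {..<16} =
      edges exceptional_graph (Suc (?s ! c))"
    by (elim exE conjE)
  \<comment> \<open>The table mediates: back from \<open>V\<close> to the labels by
    \<open>h\<close>, then on to the exceptional graph by \<open>g\<close>. As \<open>g\<close> was
    chosen for \<open>?s\<close>, it absorbs the renaming \<open>\<sigma>\<close>.\<close>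
  define f where "f v = g ! inv_into {..<16} h v" for v
  have f: "f (h i) = g ! i" if "i < 16" for i
    using that bij_betw_imp_inj_on[OF h] by (simp add: f_def)
  have f_bij: "bij_betw f V (verts exceptional_graph)"
    using bij_betw_trans[OF bij_betw_inv_into[OF h] g] by (simp add: f_def[abs_def] comp_def exceptional_graph_def)
  have f_edges: "(\<lambda>e. f ` e) ` edges G (Suc (\<sigma> c)) = edges exceptional_graph (Suc (\<sigma> c))" if c: "c < 3" for c
  proof -
    have "edges G (Suc (\<sigma> c)) = (\<lambda>i. {h i, h (exceptional_table ! c ! i)}) ` {..<16}"
      using edges[of "\<sigma> c"] bij_betwE[OF \<sigma>] c e[OF c] bij_betw_imp_surj_on[OF h, symmetric]
      by (simp add: pairing_of_def image_image)
    then have "(\<lambda>e. f ` e) ` edges G (Suc (\<sigma> c)) = (\<lambda>i. {g ! i, g ! (exceptional_table ! c ! i)}) ` {..<16}"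
      using f table[OF c] by (simp add: image_image)
    with g_edges c s[OF c] show ?thesis by simp
  qed
  have "(\<lambda>e. f ` e) ` edges G i = edges exceptional_graph i" if "i \<in> {1, 2, 3}" for i
  proof -
    have "i - 1 \<in> \<sigma> ` {..<3}" using that \<sigma> by (auto simp: bij_betw_def)
    then obtain c where "c < 3" "i - 1 = \<sigma> c" by auto
    moreover from this have "i = Suc (\<sigma> c)" using that by auto
    ultimately show ?thesis using f_edges by simp
  qed
  with f_bij show ?thesis
    unfolding graph_isomorphic_def V by blast
qed

section \<open>The pairing for coloured graphs\<close>

theorem mainTheorem1:
  fixes G :: "'a colored_graph" and n :: nat
  assumes "1 \<le> n" and "n \<le> 9"
    and "cubic_colored_graph n G"
    and "graph_connected G"
    and "\<not> MST G"
    and "\<not> graph_isomorphic G exceptional_graph"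
  shows "\<exists>M. is_pairing (verts G) M \<and> real (total_faces M G) > 3 * real n / 2"
proof -
  define V where "V = verts G"
  have fin: "finite V" and V: "card V = 2 * n" and pair: "\<And>i. i \<in> {1, 2, 3} \<Longrightarrow> is_pairing V (edges G i)"
    using assms(3) by (auto simp: cubic_colored_graph_def V_def)
  have "\<exists>q. (\<forall>v\<in>V. q v \<in> V \<and> q v \<noteq> v \<and> q (q v) = v) \<and> edges G i = pairing_of V q"
    if "i \<in> {1, 2, 3}" for i
    by (rule pairing_is_pairing_of[OF pair[OF that]]) (rule exI, erule conjI)
  then have "\<forall>i\<in>{1, 2, 3}. \<exists>q. (\<forall>v\<in>V. q v \<in> V \<and> q v \<noteq> v \<and> q (q v) = v) \<and> edges G i = pairing_of V q"
    by (intro ballI)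
  from bchoice[OF this] obtain p where p_edges:
    "\<forall>i\<in>{1, 2, 3}. (\<forall>v\<in>V. p i v \<in> V \<and> p i v \<noteq> v \<and> p i (p i v) = v) \<and> edges G i = pairing_of V (p i)" ..
  have p: "\<forall>v\<in>V. p i v \<in> V \<and> p i v \<noteq> v \<and> p i (p i v) = v"
    and edges: "edges G i = pairing_of V (p i)" if "i \<in> {1, 2, 3}" for i
    using bspec[OF p_edges that] by (rule conjunct1, rule conjunct2)
  define e where "e c = p (Suc c)" for c
  have Suc_c: "Suc c \<in> {1, 2, 3}" if "c < 3" for c using that by auto
  have inv: "invol_graph V e"
    unfolding invol_graph_def e_def using fin p[OF Suc_c] by (intro conjI allI impI) simp_all
  have edges_e: "edges G (Suc c) = pairing_of V (e c)" if "c < 3" for c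
    using edges[OF Suc_c[OF that]] by (simp add: e_def)
  have "attains V e (target n)"
  proof (cases "n < 8")
    case True
    then show ?thesis using goodD[OF good_less_8 inv V] by simp
  next
    case False
    then have n: "n = 8 \<or> n = 9" using assms(2) by auto
    \<comment> \<open>Some pair of colours violates the MST condition; its smallest face has at most
      half of the vertices.\<close>
    obtain a b where ab: "a < 3" "b < 3" "a \<noteq> b" "faces (Suc a) (Suc b) G \<noteq> 1"
    proof -
      consider "faces (Suc 0) (Suc 1) G \<noteq> 1" | "faces (Suc 0) (Suc 2) G \<noteq> 1" | "faces (Suc 1) (Suc 2) G \<noteq> 1"
        using assms(5) by (auto simp: MST_def numeral_2_eq_2 numeral_3_eq_3)
      then show thesis using that[of 0 1] that[of 0 2] that[of 1 2] by cases simp_all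
    qed
    \<comment> \<open>The two chosen colours move to positions 0 and 1, where the results on small
      faces expect them; the third is \<open>3 - a - b\<close> because the three colours add up to
      3.\<close>
    define \<sigma> where "\<sigma> c = (if c = 0 then a else if c = 1 then b else 3 - a - b)" for c :: nat
    have "inj_on \<sigma> {..<3}" "\<sigma> ` {..<3} \<subseteq> {..<3}"
      using ab by (auto simp: inj_on_def less_3_cases \<sigma>_def)
    then have \<sigma>: "bij_betw \<sigma> {..<3} {..<3}" "\<sigma> 0 = a" "\<sigma> 1 = b"
      using endo_inj_surj[of "{..<3}" \<sigma>] by (simp_all add: bij_betw_def \<sigma>_def)
    have "V \<noteq> {}" using V n by auto
    moreover have "\<forall>v\<in>V. e c v \<in> V \<and> e c v \<noteq> v \<and> e c (e c v) = v" if "c < 3" for c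
      using invol_graphD[OF inv that] by blast
    moreover have "card (components V (pairing_of V (e a) \<union> pairing_of V (e b))) \<noteq> 1"
      using ab edges_e by (simp add: faces_def V_def)
    ultimately obtain S where S: "S \<subseteq> V" "S \<noteq> {}" "e a ` S \<subseteq> S" "e b ` S \<subseteq> S" "2 * card S \<le> card V"
      using small_component[OF fin, of "e a" "e b"] ab(1,2) by metis
    have inv': "invol_graph V (e \<circ> \<sigma>)" by (rule invol_graph_permute[OF \<sigma>(1) inv])
    have closed: "(e \<circ> \<sigma>) c v \<in> S" if "c < 2" "v \<in> S" for c v
      using that S(3,4) \<sigma>(2,3) by (auto simp: less_2_cases_iff)
    have "attains V (e \<circ> \<sigma>) (target n)"
      using n
    proof
      assume "n = 8"
      then have "card V = 16" "card S \<le> 8" using S(5) V by simp_all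
      then have "attains V (e \<circ> \<sigma>) 13 \<or> exceptional V (e \<circ> \<sigma>)"
        using small_face_cases[OF inv' _ S(1,2) closed] by blast
      moreover have "\<not> exceptional V (e \<circ> \<sigma>)"
        using exceptional_permute[OF \<sigma>(1)] exceptional_isomorphic[OF _ V_def[symmetric] edges_e] assms(6) by blast
      ultimately show ?thesis using \<open>n = 8\<close> by (simp add: target_eval)
    next
      assume "n = 9"
      then have "card V = 18" "card S \<le> 9" using S(5) V by simp_all
      then have "attains V (e \<circ> \<sigma>) 14" using attains_14[OF inv' _ S(1,2) closed] by blast
      then show ?thesis using \<open>n = 9\<close> by (simp only: target_eval)
    qed
    then show ?thesis by (rule attains_permute[OF \<sigma>(1)])
  qed
  from attains_pairing[OF this inv] obtain M where M: "is_pairing V M"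
    and "target n \<le> (\<Sum>c<3. card (components V (M \<union> pairing_of V (e c))))" by blast
  note this(2)
  also have "(\<Sum>c<3. card (components V (M \<union> pairing_of V (e c)))) = (\<Sum>c<3. faces 0 (Suc c) (add_pairing G M))"
    using edges_e by (intro sum.cong) (simp_all add: faces_def add_pairing_def V_def)
  also have "\<dots> = total_faces M G"
    by (simp add: total_faces_def numeral_3_eq_3)
  finally have "target n \<le> total_faces M G" .
  \<comment> \<open>Only here the targets are compared with 3n/2, and the inequality is strict for
    each of the nine sizes.\<close>
  moreover have "3 * n < 2 * target n"
  proof -
    have "n \<in> {1, 2, 3, 4, 5, 6, 7, 8, 9}" using assms(1,2) by auto
    then show ?thesis by (elim insertE) (simp_all add: target_def)
  qed
  ultimately have "3 * real n / 2 < real (total_faces M G)" by linarith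
  with M show ?thesis unfolding V_def by blast
qed

end
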